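(* Let $\sigma_0,\sigma_1,\sigma_2>0$ be the spectral moments of a centered, homogeneous, isotropic Gaussian random field $\delta$ on $\mathbb{R}^3$, with $\gamma:=\sigma_1^2/(\sigma_0\sigma_2)<1$. Let $q(\nu,\eta,H)$ be the joint probability density of $(\nu,\eta,H)$ at a point, where $\nu=\delta/\sigma_0$, $\eta_i=\partial_i\delta$ and $H_{ij}=-\partial_i\partial_j\delta$. For $\nu\in\mathbb{R}$ let $$n_{\rm pk}(\nu)=\int_{\mathcal{C}_+}|\det H|\;q(\nu,0,H)\,dH$$ be the density of peaks of height $\nu$, where $\mathcal{C}_+$ is the set of positive definite real symmetric $3\times3$ matrices. Then, with $R_\ast=\sqrt{3}\,\sigma_1/\sigma_2$, $$n_{\rm pk}(\nu)=\frac{1}{(2\pi)^2R_\ast^3}\,e^{-\nu^2/2}\,G(\gamma,\gamma\nu),$$ where $$G(\gamma,w)=\int_0^\infty f(x)\,\frac{1}{\sqrt{2\pi(1-\gamma^2)}}\exp\!\left[-\frac{(x-w)^2}{2(1-\gamma^2)}\right]dx$$ and $$f(x)=\frac{x^3-3x}{2}\left[\operatorname{erf}\!\left(\sqrt{\tfrac52}\,x\right)+\operatorname{erf}\!\left(\sqrt{\tfrac52}\,\tfrac{x}{2}\right)\right]+\sqrt{\frac{2}{5\pi}}\left[\left(\frac{31x^2}{4}+\frac85\right)e^{-5x^2/8}+\left(\frac{x^2}{2}-\frac85\right)e^{-5x^2/2}\right].$$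
   Context: The field has power spectrum $P(k)$ and spectral moments $\sigma_j^2=\int_0^\infty \frac{k^2\,dk}{2\pi^2}P(k)k^{2j}$, $j=0,1,2$, assumed finite. At any point, the vector $(\delta,\eta_i,H_{ij})$ with $\eta_i=\partial_i\delta$ and $H_{ij}=-\partial_i\partial_j\delta$ ($i\le j$) is a centered multivariate Gaussian with covariances (with $\delta_{ij}$ the Kronecker symbol) $\langle\delta^2\rangle=\sigma_0^2$, $\langle\delta\,\eta_i\rangle=0$, $\langle\delta H_{ij}\rangle=\frac{\sigma_1^2}{3}\delta_{ij}$, $\langle\eta_i\eta_j\rangle=\frac{\sigma_1^2}{3}\delta_{ij}$, $\langle\eta_iH_{jk}\rangle=0$, and $\langle H_{ij}H_{kl}\rangle=\frac{\sigma_2^2}{15}(\delta_{ij}\delta_{kl}+\delta_{ik}\delta_{jl}+\delta_{il}\delta_{jk})$. The density $q$ is taken with respect to $d\nu\,d^3\eta\,dH$ with $dH=\prod_{i\le j}dH_{ij}$. Here $\operatorname{erf}(z)=\frac{2}{\sqrt\pi}\int_0^z e^{-t^2}dt$. *)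

theory Defs
  imports "HOL-Probability.Probability"
begin

section \<open>Gaussian random variables and random fields\<close>

text \<open>The degenerate case of variance zero is allowed, as is usual for Gaussian vectors and
  processes; \<^const>\<open>normal_density\<close> takes the standard deviation as its second argument.\<close>

definition centered_gaussian :: "'a measure \<Rightarrow> ('a \<Rightarrow> real) \<Rightarrow> bool" where
  "centered_gaussian M X \<longleftrightarrow> X \<in> borel_measurable M \<and>
     (\<exists>s\<ge>0. distr M borel X =
        (if s = 0 then return borel 0 else density lborel (\<lambda>x. ennreal (normal_density 0 s x))))"

definition centered_gaussian_vector :: "'a measure \<Rightarrow> ('a \<Rightarrow> 'b::euclidean_space) \<Rightarrow> bool" where
  "centered_gaussian_vector M X \<longleftrightarrow> (\<forall>u. centered_gaussian M (\<lambda>\<omega>. u \<bullet> X \<omega>))"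

type_synonym 'a field3 = "real ^ 3 \<Rightarrow> 'a \<Rightarrow> real"

definition centered_gaussian_field :: "'a measure \<Rightarrow> 'a field3 \<Rightarrow> bool" where
  "centered_gaussian_field M \<delta> \<longleftrightarrow>
     (\<forall>I c. finite I \<longrightarrow> centered_gaussian M (\<lambda>\<omega>. \<Sum>x\<in>I. c x * \<delta> x \<omega>))"

text \<open>Laws of fields are taken on the product space indexed by all points, i.e. equality of laws
  is equality of all finite-dimensional distributions.\<close>

definition field_law :: "'a measure \<Rightarrow> 'a field3 \<Rightarrow> (real ^ 3 \<Rightarrow> real) measure" where
  "field_law M \<delta> = distr M (Pi\<^sub>M UNIV (\<lambda>_. borel)) (\<lambda>\<omega> x. \<delta> x \<omega>)"

definition homogeneous_field :: "'a measure \<Rightarrow> 'a field3 \<Rightarrow> bool" where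
  "homogeneous_field M \<delta> \<longleftrightarrow> (\<forall>a. field_law M (\<lambda>x. \<delta> (x + a)) = field_law M \<delta>)"

definition isotropic_field :: "'a measure \<Rightarrow> 'a field3 \<Rightarrow> bool" where
  "isotropic_field M \<delta> \<longleftrightarrow>
     (\<forall>Q. rotation_matrix Q \<longrightarrow> field_law M (\<lambda>x. \<delta> (Q *v x)) = field_law M \<delta>)"

text \<open>The two-point function is the Fourier transform of the spectrum with the
  convention \<open>d\<^sup>3k / (2\<pi>)\<^sup>3\<close>; after integration over directions this is the radial weight
  \<open>k\<^sup>2 dk / (2\<pi>\<^sup>2)\<close> of the spectral moments.\<close>

definition has_power_spectrum :: "'a measure \<Rightarrow> 'a field3 \<Rightarrow> (real \<Rightarrow> real) \<Rightarrow> bool" where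
  "has_power_spectrum M \<delta> P \<longleftrightarrow> P \<in> borel_measurable borel \<and> (\<forall>k\<ge>0. 0 \<le> P k) \<and>
     (\<forall>x y. (\<integral>\<omega>. \<delta> x \<omega> * \<delta> y \<omega> \<partial>M) =
        (\<integral>k. P (norm k) * cos (k \<bullet> (x - y)) / (2 * pi) ^ 3 \<partial>(lborel :: (real ^ 3) measure)))"

definition spectral_integrand :: "(real \<Rightarrow> real) \<Rightarrow> nat \<Rightarrow> real \<Rightarrow> real" where
  "spectral_integrand P j k = k ^ 2 / (2 * pi ^ 2) * P k * k ^ (2 * j)"


section \<open>Derivatives of the field\<close>

definition partial :: "3 \<Rightarrow> (real ^ 3 \<Rightarrow> real) \<Rightarrow> real ^ 3 \<Rightarrow> real" where
  "partial i f x = deriv (\<lambda>t. f (x + t *\<^sub>R axis i 1)) 0"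

definition C1 :: "(real ^ 3 \<Rightarrow> real) \<Rightarrow> bool" where
  "C1 f \<longleftrightarrow> (\<forall>i. (\<forall>x. (\<lambda>t. f (x + t *\<^sub>R axis i 1)) differentiable at 0) \<and>
     continuous_on UNIV (partial i f))"

definition C2 :: "(real ^ 3 \<Rightarrow> real) \<Rightarrow> bool" where
  "C2 f \<longleftrightarrow> C1 f \<and> (\<forall>i. C1 (partial i f))"

definition field_grad :: "'a field3 \<Rightarrow> real ^ 3 \<Rightarrow> 'a \<Rightarrow> real ^ 3" where
  "field_grad \<delta> x \<omega> = (\<chi> i. partial i (\<lambda>y. \<delta> y \<omega>) x)"

definition field_neg_hess :: "'a field3 \<Rightarrow> real ^ 3 \<Rightarrow> 'a \<Rightarrow> real ^ 3 ^ 3" where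
  "field_neg_hess \<delta> x \<omega> = (\<chi> i j. - partial i (partial j (\<lambda>y. \<delta> y \<omega>)) x)"


section \<open>Symmetric matrices and the measure \<open>dH\<close>\<close>

text \<open>A symmetric matrix is given by its entries on and above the diagonal, in the order
  \<open>11, 12, 13, 22, 23, 33\<close>. Lebesgue measure on these six coordinates is \<open>dH\<close>.\<close>

type_synonym sym3 = "real \<times> real \<times> real \<times> real \<times> real \<times> real"

fun sym_matrix :: "sym3 \<Rightarrow> real ^ 3 ^ 3" where
  "sym_matrix (a, b, c, d, e, f) = vector [vector [a, b, c], vector [b, d, e], vector [c, e, f]]"

definition upper_entries :: "real ^ 3 ^ 3 \<Rightarrow> sym3" where
  "upper_entries A = (A $ 1 $ 1, A $ 1 $ 2, A $ 1 $ 3, A $ 2 $ 2, A $ 2 $ 3, A $ 3 $ 3)"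

definition pos_def_matrices :: "(real ^ 3 ^ 3) set" where
  "pos_def_matrices = {A. transpose A = A \<and> (\<forall>v. v \<noteq> 0 \<longrightarrow> 0 < v \<bullet> (A *v v))}"


section \<open>Peak density and the functions in its closed form\<close>

text \<open>The density is evaluated on the null set \<open>\<eta> = 0\<close>, so \<open>q\<close> must be a pointwise
  determined version of the joint density; the continuous one is meant.\<close>

definition peak_density :: "(real \<times> (real ^ 3) \<times> sym3 \<Rightarrow> real) \<Rightarrow> real \<Rightarrow> real" where
  "peak_density q \<nu> =
     (LINT h : {h. sym_matrix h \<in> pos_def_matrices} | lborel. \<bar>det (sym_matrix h)\<bar> * q (\<nu>, 0, h))"

definition erf :: "real \<Rightarrow> real" where
  "erf z = 2 / sqrt pi * (LBINT t=0..ereal z. exp (- (t ^ 2)))"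

definition peak_f :: "real \<Rightarrow> real" where
  "peak_f x = (x ^ 3 - 3 * x) / 2 * (erf (sqrt (5 / 2) * x) + erf (sqrt (5 / 2) * (x / 2)))
     + sqrt (2 / (5 * pi)) *
         ((31 * x ^ 2 / 4 + 8 / 5) * exp (- 5 * x ^ 2 / 8)
          + (x ^ 2 / 2 - 8 / 5) * exp (- 5 * x ^ 2 / 2))"

definition peak_G :: "real \<Rightarrow> real \<Rightarrow> real" where
  "peak_G \<gamma> w = (LBINT x : {0..}. peak_f x * (1 / sqrt (2 * pi * (1 - \<gamma> ^ 2)))
     * exp (- ((x - w) ^ 2 / (2 * (1 - \<gamma> ^ 2)))))"

definition kron :: "'i \<Rightarrow> 'i \<Rightarrow> real" where
  "kron i j = (if i = j then 1 else 0)"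

end

(* The characteristic function of a Gaussian vector determines its continuous density, so q is the
   explicit normal density, written as a chain of conditional normal laws. At eta = 0 it depends on
   H only through the coefficients e1 = tr H, e2, e3 = det H of the characteristic polynomial, and
   H is positive definite iff e1, e2, e3 > 0.

   For integrands depending only on (e1, e2, e3) the integral over the six entries of H reduces to
   three variables without diagonalising H. Write H = [[B, v], [v^T, f]]. By the Schur complement,
   f = l - v^T (l - B)^-1 v replaces f by the largest eigenvalue l, with S = l - B positive
   definite. Then v = S w parametrises the eigenvector (w, 1), and C^T S C with C C^T = 1 + w w^T
   is a 2x2 matrix T such that the spectrum of H is l together with that of l - T; the variable w
   splits off with total mass 2 pi. Finally T enters only via trace and determinant, so polar
   coordinates for its traceless part leave l, mu = tr T / 2 and tau = mu^2 - det T.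

   With u, t rescaled from mu, tau and x = tr H / sigma_2, the exponent is quadratic in u and linear
   in t, and the u, t integrals for fixed x have elementary primitives up to erf. *)
theory Submission
  imports Defs
begin

text \<open>Diagonalising would call for a parametrisation of the matrices by eigenvalues and
  orthogonal frames, together with its Jacobian. Singling out the largest eigenvalue l needs only
  substitutions in one real variable, because the last diagonal entry is an increasing function of
  l. The repulsion factor of the eigenvalues l, l2, l3 then appears in two portions. Replacing f by
  l contributes 1 + |w|^2 and v = S w contributes det S; their product is det T = (l - l2)(l - l3).
  The remaining factor l2 - l3 is hidden in d tau, since tau = ((l2 - l3)/2)^2. The matrix integral
  is computed with nonnegative extended integrals, so that exchanging the order of integration asks
  for measurability only; real numbers return at the very end. Non-generic matrices, for which the
  substitution of l fails to be onto, form a null set in each coordinate and are dropped. The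
  Gaussian weight involves e1^2 - 3 e2, which is 3/2 of the squared norm of the traceless part of H.
  In the reduced variables it equals mu^2 + 3 tau, whence the exponent u^2 + 3 t.\<close>

section \<open>Substitution and polar coordinates\<close>

text \<open>Both sides are measures of an increasing union of compact intervals
  \<open>{l n..u n}\<close> or of their images, and on each interval the compact substitution rule
  applies. The images are again compact intervals, by monotonicity and the intermediate value
  theorem. Writing the left domain as an image avoids distinguishing the limits of \<open>g\<close>
  at both ends.\<close>

lemma nn_integral_substitution_Ioi:
  fixes f :: "real \<Rightarrow> ennreal" and g g' :: "real \<Rightarrow> real"
  assumes f [measurable]: "f \<in> borel_measurable borel"
    and deriv: "\<And>x. a < x \<Longrightarrow> (g has_real_derivative g' x) (at x)"
    and cont: "continuous_on {a<..} g'"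
    and nonneg: "\<And>x. a < x \<Longrightarrow> 0 \<le> g' x"
  shows "(\<integral>\<^sup>+y. f y * indicator (g ` {a<..}) y \<partial>lborel) =
    (\<integral>\<^sup>+x. f (g x) * ennreal (g' x) * indicator {a<..} x \<partial>lborel)"
proof -
  define l where "l n = a + 1 / (real n + 1)" for n
  define u where "u n = a + (real n + 2)" for n
  have la: "a < l n" for n by (simp add: l_def)
  have l1: "l n \<le> a + 1" for n by (simp add: l_def)
  have lu: "l n < u n" for n
    using l1[of n] by (simp add: u_def)
  have anti: "l n \<le> l m" if "m \<le> n" for m n
    using that by (simp add: l_def frac_le)
  have incu: "u m \<le> u n" if "m \<le> n" for m n
    using that by (simp add: u_def)
  have ex: "\<exists>n. x \<in> {l n..u n}" if "a < x" for x
  proof -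
    obtain n1 where n1: "inverse (real (Suc n1)) < x - a"
      using reals_Archimedean[of "x - a"] \<open>a < x\<close> by auto
    obtain n2 :: nat where n2: "x - a \<le> real n2"
      using real_arch_simple by blast
    have "l (max n1 n2) \<le> l n1" by (rule anti) simp
    also have "l n1 \<le> x" using n1 by (simp add: l_def field_simps)
    finally have *: "l (max n1 n2) \<le> x" .
    have "x \<le> u n2" using n2 by (simp add: u_def)
    also have "\<dots> \<le> u (max n1 n2)" by (rule incu) simp
    finally show ?thesis using * by auto
  qed
  have mono: "g x \<le> g y" if "a < x" "x \<le> y" for x y
  proof (rule DERIV_nonneg_imp_nondecreasing[OF that(2)])
    fix z assume "x \<le> z" "z \<le> y"
    then show "\<exists>d. (g has_real_derivative d) (at z) \<and> 0 \<le> d"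
      using that deriv[of z] nonneg[of z] by (intro exI[of _ "g' z"]) simp
  qed
  have img: "g ` {l n..u n} = {g (l n)..g (u n)}" for n
  proof
    show "g ` {l n..u n} \<subseteq> {g (l n)..g (u n)}"
      using mono la[of n] by (auto intro: mono less_le_trans)
    show "{g (l n)..g (u n)} \<subseteq> g ` {l n..u n}"
    proof
      fix y assume "y \<in> {g (l n)..g (u n)}"
      moreover have "isCont g x" if "l n \<le> x" for x
        using DERIV_isCont[OF deriv[of x]] la[of n] that by simp
      ultimately obtain x where "l n \<le> x" "x \<le> u n" "g x = y"
        using IVT[of g "l n" y "u n"] lu[of n] by (auto simp: less_imp_le)
      then show "y \<in> g ` {l n..u n}" by auto
    qed
  qed
  have UI: "(\<Union>n. {l n..u n}) = {a<..}"
    using ex by (auto intro: less_le_trans[OF la])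
  have UG: "(\<Union>n. {g (l n)..g (u n)}) = g ` {a<..}"
    unfolding img[symmetric] UI[symmetric] by (simp add: image_UN)
  have inc1: "incseq (\<lambda>n. {l n..u n})"
    using anti incu by (auto simp: incseq_def intro: order_trans)
  have inc2: "incseq (\<lambda>n. {g (l n)..g (u n)})"
    unfolding img[symmetric] using inc1 unfolding incseq_def by (intro allI impI image_mono) blast
  have gm [measurable]: "g \<in> borel_measurable (restrict_space borel {a<..})"
    using deriv by (intro borel_measurable_continuous_on_restrict continuous_at_imp_continuous_on)
      (auto intro: DERIV_isCont)
  have g'm [measurable]: "g' \<in> borel_measurable (restrict_space borel {a<..})"
    using cont by (rule borel_measurable_continuous_on_restrict)
  have prodm: "(\<lambda>x. f (g x) * ennreal (g' x)) \<in> borel_measurable (restrict_space borel {a<..})"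
    by measurable
  have SUP1: "(SUP n. emeasure (density lborel f) {g (l n)..g (u n)}) = emeasure (density lborel f) (g ` {a<..})"
    unfolding UG[symmetric] using inc2 by (intro SUP_emeasure_incseq) auto
  define h where "h x = (f (g x) * ennreal (g' x)) * indicator {a<..} x" for x
  have hm [measurable]: "h \<in> borel_measurable borel"
    unfolding h_def using prodm
    by (subst (asm) borel_measurable_restrict_space_iff_ennreal) auto
  have SUP2: "(SUP n. emeasure (density lborel h) {l n..u n}) = emeasure (density lborel h) {a<..}"
    unfolding UI[symmetric] using inc1 by (intro SUP_emeasure_incseq) auto
  have gI: "g ` {a<..} \<in> sets borel"
    unfolding UG[symmetric] by auto
  have eq: "emeasure (density lborel f) {g (l n)..g (u n)} = emeasure (density lborel h) {l n..u n}" for n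
  proof -
    have "(\<integral>\<^sup>+x. f x * indicator {g (l n)..g (u n)} x \<partial>lborel) =
      (\<integral>\<^sup>+x. f (g x) * ennreal (g' x) * indicator {l n..u n} x \<partial>lborel)"
    proof (rule nn_integral_substitution_aux)
      show "continuous_on {l n..u n} g'"
        using la[of n] by (intro continuous_on_subset[OF cont]) auto
    qed (use deriv nonneg lu la[of n] in auto)
    also have "\<dots> = (\<integral>\<^sup>+x. h x * indicator {l n..u n} x \<partial>lborel)"
      using la[of n] by (intro nn_integral_cong) (auto simp: h_def split: split_indicator)
    finally show ?thesis by (simp add: emeasure_density)
  qed
  have "emeasure (density lborel f) (g ` {a<..}) = emeasure (density lborel h) {a<..}"
    unfolding SUP1[symmetric] SUP2[symmetric] eq ..
  then have "(\<integral>\<^sup>+y. f y * indicator (g ` {a<..}) y \<partial>lborel) = (\<integral>\<^sup>+x. h x * indicator {a<..} x \<partial>lborel)"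
    using gI by (simp add: emeasure_density)
  also have "\<dots> = (\<integral>\<^sup>+x. f (g x) * ennreal (g' x) * indicator {a<..} x \<partial>lborel)"
    by (intro nn_integral_cong) (auto simp: h_def split: split_indicator)
  finally show ?thesis .
qed

lemma nn_integral_inverse_one_plus_square:
  "(\<integral>\<^sup>+s. ennreal (1 / (1 + s\<^sup>2)) \<partial>lborel) = ennreal pi"
proof -
  have i: "integrable lborel (\<lambda>s::real. inverse (1 + s\<^sup>2))"
    and v: "(\<integral>s. inverse (1 + s\<^sup>2) \<partial>lborel) = pi"
    using integrable_inverse_1_plus_square LBINT_inverse_1_plus_square
    by (simp_all add: set_integrable_def interval_lebesgue_integral_def set_lebesgue_integral_def)
  show ?thesis
    using nn_integral_eq_integral[OF i] v by (simp add: inverse_eq_divide)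
qed

lemma nn_integral_lborel_swap:
  fixes f :: "'a::euclidean_space \<Rightarrow> 'b::euclidean_space \<Rightarrow> ennreal"
  assumes "case_prod f \<in> borel_measurable (borel \<Otimes>\<^sub>M borel)"
  shows "(\<integral>\<^sup>+y. (\<integral>\<^sup>+x. f x y \<partial>lborel) \<partial>lborel) = (\<integral>\<^sup>+x. (\<integral>\<^sup>+y. f x y \<partial>lborel) \<partial>lborel)"
proof (rule lborel_pair.Fubini')
  have "sets (lborel \<Otimes>\<^sub>M lborel :: ('a \<times> 'b) measure) = sets (borel \<Otimes>\<^sub>M borel)"
    by (intro sets_pair_measure_cong) auto
  then show "case_prod f \<in> borel_measurable (lborel \<Otimes>\<^sub>M lborel)"
    using assms by (simp cong: measurable_cong_sets)
qed

text \<open>The two half-lines contribute equally, so \<open>\<bar>q\<bar>\<close> turns into 2 q on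
  the positive one, the exact derivative of the square; no factor is left over.\<close>

lemma nn_integral_square_substitution:
  fixes F :: "real \<Rightarrow> ennreal"
  assumes [measurable]: "F \<in> borel_measurable borel"
  shows "(\<integral>\<^sup>+q. ennreal \<bar>q\<bar> * F (q\<^sup>2) \<partial>lborel) = (\<integral>\<^sup>+t. F t * indicator {0<..} t \<partial>lborel)"
proof -
  have img: "(\<lambda>x. x\<^sup>2) ` {0<..} = {0::real<..}"
  proof
    show "{0<..} \<subseteq> (\<lambda>x. x\<^sup>2) ` {0::real<..}"
    proof
      fix y :: real assume "y \<in> {0<..}"
      then show "y \<in> (\<lambda>x. x\<^sup>2) ` {0<..}"
        by (intro image_eqI[of _ _ "sqrt y"]) auto
    qed
  qed auto
  let ?h = "\<lambda>q. ennreal \<bar>q\<bar> * F (q\<^sup>2)"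
  have "(\<integral>\<^sup>+q. ?h q \<partial>lborel) = (\<integral>\<^sup>+q. ?h q * indicator {0<..} q + ?h q * indicator {..<0} q \<partial>lborel)"
    by (intro nn_integral_cong) (auto split: split_indicator)
  also have "\<dots> = (\<integral>\<^sup>+q. ?h q * indicator {0<..} q \<partial>lborel) + (\<integral>\<^sup>+q. ?h q * indicator {..<0} q \<partial>lborel)"
    by (intro nn_integral_add) auto
  also have "(\<integral>\<^sup>+q. ?h q * indicator {..<0} q \<partial>lborel) = (\<integral>\<^sup>+q. ?h q * indicator {0<..} q \<partial>lborel)"
    by (subst nn_integral_real_affine[where c = "-1" and t = 0])
      (auto simp: indicator_def intro!: nn_integral_cong)
  also have "(\<integral>\<^sup>+q. ?h q * indicator {0<..} q \<partial>lborel) + (\<integral>\<^sup>+q. ?h q * indicator {0<..} q \<partial>lborel)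
    = (\<integral>\<^sup>+q. ?h q * indicator {0<..} q + ?h q * indicator {0<..} q \<partial>lborel)"
    by (intro nn_integral_add[symmetric]) auto
  also have "\<dots> = (\<integral>\<^sup>+x. F (x\<^sup>2) * ennreal (2 * x) * indicator {0<..} x \<partial>lborel)"
    by (intro nn_integral_cong)
      (auto simp: ac_simps ennreal_mult mult_2[symmetric] split: split_indicator)
  also have "\<dots> = (\<integral>\<^sup>+t. F t * indicator ((\<lambda>x. x\<^sup>2) ` {0<..}) t \<partial>lborel)"
    by (rule nn_integral_substitution_Ioi[symmetric])
      (auto intro!: derivative_eq_intros continuous_intros)
  finally show ?thesis by (simp only: img)
qed

text \<open>The slope s = p / q serves instead of an angle: p^2 + q^2 = q^2 (1 + s^2), so for fixed
  s the radial integral is the one for s = 0 divided by 1 + s^2, and the slopes have total mass pi.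
  The variable t is the squared radius.\<close>

lemma nn_integral_polar:
  fixes F :: "real \<Rightarrow> ennreal"
  assumes [measurable]: "F \<in> borel_measurable borel"
  shows "(\<integral>\<^sup>+p. (\<integral>\<^sup>+q. F (p\<^sup>2 + q\<^sup>2) \<partial>lborel) \<partial>lborel) = ennreal pi * (\<integral>\<^sup>+t. F t * indicator {0<..} t \<partial>lborel)"
proof -
  let ?J = "\<integral>\<^sup>+t. F t * indicator {0<..} t \<partial>lborel"
  have "(\<integral>\<^sup>+p. (\<integral>\<^sup>+q. F (p\<^sup>2 + q\<^sup>2) \<partial>lborel) \<partial>lborel) = (\<integral>\<^sup>+q. (\<integral>\<^sup>+p. F (p\<^sup>2 + q\<^sup>2) \<partial>lborel) \<partial>lborel)"
    by (intro nn_integral_lborel_swap[symmetric]) measurable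
  also have "\<dots> = (\<integral>\<^sup>+q. (\<integral>\<^sup>+s. ennreal \<bar>q\<bar> * F (q\<^sup>2 * (1 + s\<^sup>2)) \<partial>lborel) \<partial>lborel)"
  proof (rule nn_integral_cong_AE, use AE_lborel_singleton[of 0] in eventually_elim)
    fix q :: real assume "q \<noteq> 0"
    then have "(\<integral>\<^sup>+p. F (p\<^sup>2 + q\<^sup>2) \<partial>lborel) = ennreal \<bar>q\<bar> * (\<integral>\<^sup>+s. F ((0 + q * s)\<^sup>2 + q\<^sup>2) \<partial>lborel)"
      by (intro nn_integral_real_affine) auto
    also have "\<dots> = (\<integral>\<^sup>+s. ennreal \<bar>q\<bar> * F (q\<^sup>2 * (1 + s\<^sup>2)) \<partial>lborel)"
      by (subst nn_integral_cmult[symmetric]) (auto simp: power_mult_distrib algebra_simps)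
    finally show "(\<integral>\<^sup>+p. F (p\<^sup>2 + q\<^sup>2) \<partial>lborel) = \<dots>" .
  qed
  also have "\<dots> = (\<integral>\<^sup>+s. (\<integral>\<^sup>+q. ennreal \<bar>q\<bar> * F (q\<^sup>2 * (1 + s\<^sup>2)) \<partial>lborel) \<partial>lborel)"
    by (intro nn_integral_lborel_swap) measurable
  also have "\<dots> = (\<integral>\<^sup>+s. ennreal (1 / (1 + s\<^sup>2)) * ?J \<partial>lborel)"
  proof (rule nn_integral_cong)
    fix s :: real
    have pos: "1 + s\<^sup>2 > 0" by (simp add: add_pos_nonneg)
    have "(\<integral>\<^sup>+q. ennreal \<bar>q\<bar> * F (q\<^sup>2 * (1 + s\<^sup>2)) \<partial>lborel) = (\<integral>\<^sup>+t. F (t * (1 + s\<^sup>2)) * indicator {0<..} t \<partial>lborel)"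
      by (rule nn_integral_square_substitution[where F = "\<lambda>t. F (t * (1 + s\<^sup>2))"]) measurable
    also have "\<dots> = ennreal \<bar>1 / (1 + s\<^sup>2)\<bar> * (\<integral>\<^sup>+t. F ((0 + (1 / (1 + s\<^sup>2)) * t) * (1 + s\<^sup>2)) * indicator {0<..} (0 + (1 / (1 + s\<^sup>2)) * t) \<partial>lborel)"
      using pos by (intro nn_integral_real_affine) auto
    also have "\<dots> = ennreal (1 / (1 + s\<^sup>2)) * ?J"
      using pos by (auto intro!: arg_cong2[where f = "(*)"] nn_integral_cong
        simp: indicator_def zero_less_divide_iff)
    finally show "(\<integral>\<^sup>+q. ennreal \<bar>q\<bar> * F (q\<^sup>2 * (1 + s\<^sup>2)) \<partial>lborel) = \<dots>" .
  qed
  also have "\<dots> = ennreal pi * ?J"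
    by (simp add: nn_integral_multc nn_integral_inverse_one_plus_square)
  finally show ?thesis .
qed

text \<open>This is the mass of the eigenvector variable. Under central projection (p, q) to the
  direction of (p, q, 1) the weight is the area element of a half sphere, whose area is 2
  pi.\<close>

lemma nn_integral_one_plus_norm_square_powr:
  "(\<integral>\<^sup>+p. (\<integral>\<^sup>+q. ennreal ((1 + p\<^sup>2 + q\<^sup>2) powr (-3/2)) \<partial>lborel) \<partial>lborel) = ennreal (2 * pi)"
proof -
  have "(\<integral>\<^sup>+p. (\<integral>\<^sup>+q. ennreal ((1 + p\<^sup>2 + q\<^sup>2) powr (-3/2)) \<partial>lborel) \<partial>lborel)
    = ennreal pi * (\<integral>\<^sup>+t. ennreal ((1 + t) powr (-3/2)) * indicator {0<..} t \<partial>lborel)"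
    by (subst nn_integral_polar[symmetric]) (simp_all add: add.assoc)
  also have "(\<integral>\<^sup>+t. ennreal ((1 + t) powr (-3/2)) * indicator {0<..} t \<partial>lborel)
    = (\<integral>\<^sup>+t. ennreal ((1 + t) powr (-3/2)) * indicator {0..} t \<partial>lborel)"
    using AE_lborel_singleton[of "0::real"]
    by (intro nn_integral_cong_AE) (auto elim!: eventually_mono simp: indicator_def)
  also have "\<dots> = ennreal (0 - (- 2 * (1 + 0) powr (-1/2)))"
  proof (rule nn_integral_FTC_atLeast)
    show "((\<lambda>t. - 2 * (1 + t) powr (-1/2)) \<longlongrightarrow> (0::real)) at_top" by real_asymp
  qed (auto intro!: derivative_eq_intros)
  also have "ennreal pi * \<dots> = ennreal (2 * pi)"
    by (subst ennreal_mult[symmetric]) (auto simp: mult.commute)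
  finally show ?thesis .
qed

section \<open>Linear changes of variables for 2x2 symmetric matrices\<close>

lemma nn_integral_reflect:
  fixes f :: "real \<Rightarrow> ennreal"
  assumes "f \<in> borel_measurable borel"
  shows "(\<integral>\<^sup>+x. f (t - x) \<partial>lborel) = (\<integral>\<^sup>+x. f x \<partial>lborel)"
  using nn_integral_real_affine[OF assms, of "-1" t] by simp

text \<open>The symmetric matrix with entries s1, s2, s3 splits into two one-variable affine maps,
  with scale D / s1 in y and then s1 in x, where D is the determinant. It is the substitution v = S
  w.\<close>

lemma nn_integral_linear_2x2:
  fixes f :: "real \<times> real \<Rightarrow> ennreal"
  assumes [measurable]: "f \<in> borel_measurable borel" and s1: "s1 > 0" and det: "s1 * s3 - s2\<^sup>2 > 0"
  shows "(\<integral>\<^sup>+x. (\<integral>\<^sup>+y. f (x, y) \<partial>lborel) \<partial>lborel) = ennreal (s1 * s3 - s2\<^sup>2) *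
    (\<integral>\<^sup>+x. (\<integral>\<^sup>+y. f (s1 * x + s2 * y, s2 * x + s3 * y) \<partial>lborel) \<partial>lborel)"
proof -
  define D where "D = s1 * s3 - s2\<^sup>2"
  have D: "D > 0" using det by (simp add: D_def)
  have "(\<integral>\<^sup>+x. (\<integral>\<^sup>+y. f (x, y) \<partial>lborel) \<partial>lborel)
    = (\<integral>\<^sup>+x. ennreal (D / s1) * (\<integral>\<^sup>+y. f (x, s2 / s1 * x + D / s1 * y) \<partial>lborel) \<partial>lborel)"
  proof (rule nn_integral_cong)
    fix x
    show "(\<integral>\<^sup>+y. f (x, y) \<partial>lborel) = ennreal (D / s1) * (\<integral>\<^sup>+y. f (x, s2 / s1 * x + D / s1 * y) \<partial>lborel)"
      using s1 D by (subst nn_integral_real_affine[where c = "D / s1" and t = "s2 / s1 * x"]) auto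
  qed
  also have "\<dots> = ennreal (D / s1) * (\<integral>\<^sup>+x. (\<integral>\<^sup>+y. f (x, s2 / s1 * x + D / s1 * y) \<partial>lborel) \<partial>lborel)"
    by (rule nn_integral_cmult) measurable
  also have "(\<integral>\<^sup>+x. (\<integral>\<^sup>+y. f (x, s2 / s1 * x + D / s1 * y) \<partial>lborel) \<partial>lborel)
    = (\<integral>\<^sup>+y. (\<integral>\<^sup>+x. f (x, s2 / s1 * x + D / s1 * y) \<partial>lborel) \<partial>lborel)"
    by (rule nn_integral_lborel_swap[symmetric]) measurable
  also have "\<dots> = (\<integral>\<^sup>+y. ennreal s1 * (\<integral>\<^sup>+x. f (s1 * x + s2 * y, s2 * x + s3 * y) \<partial>lborel) \<partial>lborel)"
  proof (rule nn_integral_cong)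
    fix y
    have "(\<integral>\<^sup>+x. f (x, s2 / s1 * x + D / s1 * y) \<partial>lborel)
      = ennreal \<bar>s1\<bar> * (\<integral>\<^sup>+x. f (s2 * y + s1 * x, s2 / s1 * (s2 * y + s1 * x) + D / s1 * y) \<partial>lborel)"
      using s1 by (intro nn_integral_real_affine) auto
    moreover have "s2 / s1 * (s2 * y + s1 * x) + D / s1 * y = s2 * x + s3 * y" for x
      using s1 by (simp add: D_def field_simps power2_eq_square)
    ultimately show "(\<integral>\<^sup>+x. f (x, s2 / s1 * x + D / s1 * y) \<partial>lborel)
      = ennreal s1 * (\<integral>\<^sup>+x. f (s1 * x + s2 * y, s2 * x + s3 * y) \<partial>lborel)"
      using s1 by (simp add: add.commute)
  qed
  also have "\<dots> = ennreal s1 * (\<integral>\<^sup>+y. (\<integral>\<^sup>+x. f (s1 * x + s2 * y, s2 * x + s3 * y) \<partial>lborel) \<partial>lborel)"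
    by (rule nn_integral_cmult) measurable
  also have "(\<integral>\<^sup>+y. (\<integral>\<^sup>+x. f (s1 * x + s2 * y, s2 * x + s3 * y) \<partial>lborel) \<partial>lborel)
    = (\<integral>\<^sup>+x. (\<integral>\<^sup>+y. f (s1 * x + s2 * y, s2 * x + s3 * y) \<partial>lborel) \<partial>lborel)"
    by (rule nn_integral_lborel_swap) measurable
  finally show ?thesis
    using s1 D by (simp add: D_def[symmetric] mult.assoc[symmetric] ennreal_mult[symmetric])
qed

text \<open>The linear map is \<open>S \<mapsto> C\<^sup>T S C\<close> on symmetric 2x2 matrices, where \<open>C\<close> has the rows
  \<open>(\<delta>, \<beta>)\<close> and \<open>(0, \<alpha>)\<close>.\<close>

lemma nn_integral_triangular_congruence:
  fixes f :: "real \<times> real \<times> real \<Rightarrow> ennreal"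
  assumes [measurable]: "f \<in> borel_measurable borel" and pos: "\<alpha> > 0" "\<delta> > 0"
  shows "(\<integral>\<^sup>+r. (\<integral>\<^sup>+s. (\<integral>\<^sup>+t. f (r, s, t) \<partial>lborel) \<partial>lborel) \<partial>lborel) = ennreal ((\<alpha> * \<delta>) ^ 3) *
    (\<integral>\<^sup>+r. (\<integral>\<^sup>+s. (\<integral>\<^sup>+t. f (\<delta>\<^sup>2 * r, \<delta> * \<beta> * r + \<delta> * \<alpha> * s, \<beta>\<^sup>2 * r + 2 * \<alpha> * \<beta> * s + \<alpha>\<^sup>2 * t)
      \<partial>lborel) \<partial>lborel) \<partial>lborel)"
proof -
  \<comment> \<open>The map is triangular in (r, s, t) with diagonal entries
    \<open>\<delta>\<^sup>2\<close>, \<open>\<delta> * \<alpha>\<close> and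
    \<open>\<alpha>\<^sup>2\<close>; their product is the factor
    \<open>(\<alpha> * \<delta>) ^ 3\<close>.\<close>
  have "(\<integral>\<^sup>+r. (\<integral>\<^sup>+s. (\<integral>\<^sup>+t. f (r, s, t) \<partial>lborel) \<partial>lborel) \<partial>lborel)
    = ennreal (\<delta>\<^sup>2) * (\<integral>\<^sup>+r. (\<integral>\<^sup>+s. (\<integral>\<^sup>+t. f (\<delta>\<^sup>2 * r, s, t) \<partial>lborel) \<partial>lborel) \<partial>lborel)"
    using pos by (subst nn_integral_real_affine[where c = "\<delta>\<^sup>2" and t = 0]) auto
  also have "(\<integral>\<^sup>+r. (\<integral>\<^sup>+s. (\<integral>\<^sup>+t. f (\<delta>\<^sup>2 * r, s, t) \<partial>lborel) \<partial>lborel) \<partial>lborel)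
    = (\<integral>\<^sup>+r. ennreal (\<delta> * \<alpha>) * (\<integral>\<^sup>+s. (\<integral>\<^sup>+t. f (\<delta>\<^sup>2 * r, \<delta> * \<beta> * r + \<delta> * \<alpha> * s, t) \<partial>lborel) \<partial>lborel) \<partial>lborel)"
  proof (rule nn_integral_cong)
    fix r show "(\<integral>\<^sup>+s. (\<integral>\<^sup>+t. f (\<delta>\<^sup>2 * r, s, t) \<partial>lborel) \<partial>lborel) =
      ennreal (\<delta> * \<alpha>) * (\<integral>\<^sup>+s. (\<integral>\<^sup>+t. f (\<delta>\<^sup>2 * r, \<delta> * \<beta> * r + \<delta> * \<alpha> * s, t) \<partial>lborel) \<partial>lborel)"
      using pos by (subst nn_integral_real_affine[where c = "\<delta> * \<alpha>" and t = "\<delta> * \<beta> * r"]) auto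
  qed
  also have "\<dots> = ennreal (\<delta> * \<alpha>) * (\<integral>\<^sup>+r. (\<integral>\<^sup>+s. (\<integral>\<^sup>+t. f (\<delta>\<^sup>2 * r, \<delta> * \<beta> * r + \<delta> * \<alpha> * s, t) \<partial>lborel) \<partial>lborel) \<partial>lborel)"
    by (rule nn_integral_cmult) measurable
  also have "(\<integral>\<^sup>+r. (\<integral>\<^sup>+s. (\<integral>\<^sup>+t. f (\<delta>\<^sup>2 * r, \<delta> * \<beta> * r + \<delta> * \<alpha> * s, t) \<partial>lborel) \<partial>lborel) \<partial>lborel)
    = (\<integral>\<^sup>+r. (\<integral>\<^sup>+s. ennreal (\<alpha>\<^sup>2) * (\<integral>\<^sup>+t. f (\<delta>\<^sup>2 * r, \<delta> * \<beta> * r + \<delta> * \<alpha> * s,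
        \<beta>\<^sup>2 * r + 2 * \<alpha> * \<beta> * s + \<alpha>\<^sup>2 * t) \<partial>lborel) \<partial>lborel) \<partial>lborel)"
  proof (intro nn_integral_cong)
    fix r s show "(\<integral>\<^sup>+t. f (\<delta>\<^sup>2 * r, \<delta> * \<beta> * r + \<delta> * \<alpha> * s, t) \<partial>lborel) =
      ennreal (\<alpha>\<^sup>2) * (\<integral>\<^sup>+t. f (\<delta>\<^sup>2 * r, \<delta> * \<beta> * r + \<delta> * \<alpha> * s, \<beta>\<^sup>2 * r + 2 * \<alpha> * \<beta> * s + \<alpha>\<^sup>2 * t) \<partial>lborel)"
      using pos by (subst nn_integral_real_affine[where c = "\<alpha>\<^sup>2" and t = "\<beta>\<^sup>2 * r + 2 * \<alpha> * \<beta> * s"]) auto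
  qed
  also have "\<dots> = (\<integral>\<^sup>+r. ennreal (\<alpha>\<^sup>2) * (\<integral>\<^sup>+s. (\<integral>\<^sup>+t. f (\<delta>\<^sup>2 * r, \<delta> * \<beta> * r + \<delta> * \<alpha> * s,
        \<beta>\<^sup>2 * r + 2 * \<alpha> * \<beta> * s + \<alpha>\<^sup>2 * t) \<partial>lborel) \<partial>lborel) \<partial>lborel)"
    by (intro nn_integral_cong nn_integral_cmult) measurable
  also have "\<dots> = ennreal (\<alpha>\<^sup>2) * (\<integral>\<^sup>+r. (\<integral>\<^sup>+s. (\<integral>\<^sup>+t. f (\<delta>\<^sup>2 * r, \<delta> * \<beta> * r + \<delta> * \<alpha> * s,
        \<beta>\<^sup>2 * r + 2 * \<alpha> * \<beta> * s + \<alpha>\<^sup>2 * t) \<partial>lborel) \<partial>lborel) \<partial>lborel)"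
    by (rule nn_integral_cmult) measurable
  finally show ?thesis
  proof -
    have scale: "ennreal (\<delta>\<^sup>2) * (ennreal (\<delta> * \<alpha>) * (ennreal (\<alpha>\<^sup>2) * X)) = ennreal ((\<alpha> * \<delta>) ^ 3) * X" for X
    proof -
      have "(\<alpha> * \<delta>) ^ 3 = \<delta>\<^sup>2 * ((\<delta> * \<alpha>) * \<alpha>\<^sup>2)"
        by (simp add: power2_eq_square power3_eq_cube)
      then have "ennreal ((\<alpha> * \<delta>) ^ 3) = ennreal (\<delta>\<^sup>2) * (ennreal (\<delta> * \<alpha>) * ennreal (\<alpha>\<^sup>2))"
        using pos by (simp only: ennreal_mult mult_nonneg_nonneg less_imp_le zero_le_power2)
      then show ?thesis by (simp only: mult.assoc)
    qed
    assume "(\<integral>\<^sup>+r. (\<integral>\<^sup>+s. (\<integral>\<^sup>+t. f (r, s, t) \<partial>lborel) \<partial>lborel) \<partial>lborel) = ennreal (\<delta>\<^sup>2) *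
      (ennreal (\<delta> * \<alpha>) * (ennreal (\<alpha>\<^sup>2) * (\<integral>\<^sup>+r. (\<integral>\<^sup>+s. (\<integral>\<^sup>+t. f (\<delta>\<^sup>2 * r, \<delta> * \<beta> * r + \<delta> * \<alpha> * s,
        \<beta>\<^sup>2 * r + 2 * \<alpha> * \<beta> * s + \<alpha>\<^sup>2 * t) \<partial>lborel) \<partial>lborel) \<partial>lborel)))"
    then show ?thesis by (simp only: scale)
  qed
qed

text \<open>Half the difference of the diagonal entries, p, and the off-diagonal entry s are
  Euclidean coordinates of the traceless part: the determinant is \<mu>^2 - (p^2 + s^2). Polar
  coordinates give the factor pi, and t = 2 \<mu> - r gives the factor 2.\<close>

lemma nn_integral_sym2_trace_det:
  fixes f :: "real \<times> real \<Rightarrow> ennreal"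
  assumes [measurable]: "f \<in> borel_measurable borel"
  shows "(\<integral>\<^sup>+r. (\<integral>\<^sup>+s. (\<integral>\<^sup>+t. f (r + t, r * t - s\<^sup>2) \<partial>lborel) \<partial>lborel) \<partial>lborel)
    = ennreal (2 * pi) * (\<integral>\<^sup>+\<mu>. (\<integral>\<^sup>+\<tau>. f (2 * \<mu>, \<mu>\<^sup>2 - \<tau>) * indicator {0<..} \<tau> \<partial>lborel) \<partial>lborel)"
proof -
  have "(\<integral>\<^sup>+r. (\<integral>\<^sup>+s. (\<integral>\<^sup>+t. f (r + t, r * t - s\<^sup>2) \<partial>lborel) \<partial>lborel) \<partial>lborel)
    = (\<integral>\<^sup>+r. (\<integral>\<^sup>+s. 2 * (\<integral>\<^sup>+\<mu>. f (2 * \<mu>, r * (2 * \<mu> - r) - s\<^sup>2) \<partial>lborel) \<partial>lborel) \<partial>lborel)"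
  proof (intro nn_integral_cong)
    fix r s show "(\<integral>\<^sup>+t. f (r + t, r * t - s\<^sup>2) \<partial>lborel) = 2 * (\<integral>\<^sup>+\<mu>. f (2 * \<mu>, r * (2 * \<mu> - r) - s\<^sup>2) \<partial>lborel)"
      by (subst nn_integral_real_affine[where c = 2 and t = "- r"]) auto
  qed
  also have "\<dots> = (\<integral>\<^sup>+r. 2 * (\<integral>\<^sup>+s. (\<integral>\<^sup>+\<mu>. f (2 * \<mu>, r * (2 * \<mu> - r) - s\<^sup>2) \<partial>lborel) \<partial>lborel) \<partial>lborel)"
    by (intro nn_integral_cong nn_integral_cmult) measurable
  also have "\<dots> = 2 * (\<integral>\<^sup>+r. (\<integral>\<^sup>+s. (\<integral>\<^sup>+\<mu>. f (2 * \<mu>, r * (2 * \<mu> - r) - s\<^sup>2) \<partial>lborel) \<partial>lborel) \<partial>lborel)"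
    by (rule nn_integral_cmult) measurable
  also have "(\<integral>\<^sup>+r. (\<integral>\<^sup>+s. (\<integral>\<^sup>+\<mu>. f (2 * \<mu>, r * (2 * \<mu> - r) - s\<^sup>2) \<partial>lborel) \<partial>lborel) \<partial>lborel)
    = (\<integral>\<^sup>+r. (\<integral>\<^sup>+\<mu>. (\<integral>\<^sup>+s. f (2 * \<mu>, r * (2 * \<mu> - r) - s\<^sup>2) \<partial>lborel) \<partial>lborel) \<partial>lborel)"
    by (rule nn_integral_cong, rule nn_integral_lborel_swap) measurable
  also have "\<dots> = (\<integral>\<^sup>+\<mu>. (\<integral>\<^sup>+r. (\<integral>\<^sup>+s. f (2 * \<mu>, r * (2 * \<mu> - r) - s\<^sup>2) \<partial>lborel) \<partial>lborel) \<partial>lborel)"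
    by (intro nn_integral_lborel_swap) measurable
  also have "\<dots> = (\<integral>\<^sup>+\<mu>. (\<integral>\<^sup>+p. (\<integral>\<^sup>+s. f (2 * \<mu>, \<mu>\<^sup>2 - (p\<^sup>2 + s\<^sup>2)) \<partial>lborel) \<partial>lborel) \<partial>lborel)"
  proof (rule nn_integral_cong)
    fix \<mu> :: real
    have "(\<integral>\<^sup>+r. (\<integral>\<^sup>+s. f (2 * \<mu>, r * (2 * \<mu> - r) - s\<^sup>2) \<partial>lborel) \<partial>lborel)
      = ennreal \<bar>1\<bar> * (\<integral>\<^sup>+p. (\<integral>\<^sup>+s. f (2 * \<mu>, (\<mu> + 1 * p) * (2 * \<mu> - (\<mu> + 1 * p)) - s\<^sup>2) \<partial>lborel) \<partial>lborel)"
      by (rule nn_integral_real_affine) auto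
    moreover have "(\<mu> + 1 * p) * (2 * \<mu> - (\<mu> + 1 * p)) - s\<^sup>2 = \<mu>\<^sup>2 - (p\<^sup>2 + s\<^sup>2)" for p s
      by (simp add: algebra_simps power2_eq_square)
    ultimately show "(\<integral>\<^sup>+r. (\<integral>\<^sup>+s. f (2 * \<mu>, r * (2 * \<mu> - r) - s\<^sup>2) \<partial>lborel) \<partial>lborel)
      = (\<integral>\<^sup>+p. (\<integral>\<^sup>+s. f (2 * \<mu>, \<mu>\<^sup>2 - (p\<^sup>2 + s\<^sup>2)) \<partial>lborel) \<partial>lborel)"
      by (simp only: abs_one ennreal_1 mult_1_left)
  qed
  also have "\<dots> = (\<integral>\<^sup>+\<mu>. ennreal pi * (\<integral>\<^sup>+\<tau>. f (2 * \<mu>, \<mu>\<^sup>2 - \<tau>) * indicator {0<..} \<tau> \<partial>lborel) \<partial>lborel)"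
  proof (rule nn_integral_cong)
    fix \<mu> :: real
    have [measurable]: "(\<lambda>\<tau>. f (2 * \<mu>, \<mu>\<^sup>2 - \<tau>)) \<in> borel_measurable borel" by measurable
    show "(\<integral>\<^sup>+p. (\<integral>\<^sup>+s. f (2 * \<mu>, \<mu>\<^sup>2 - (p\<^sup>2 + s\<^sup>2)) \<partial>lborel) \<partial>lborel)
      = ennreal pi * (\<integral>\<^sup>+\<tau>. f (2 * \<mu>, \<mu>\<^sup>2 - \<tau>) * indicator {0<..} \<tau> \<partial>lborel)"
      by (rule nn_integral_polar[where F = "\<lambda>\<tau>. f (2 * \<mu>, \<mu>\<^sup>2 - \<tau>)"]) fact
  qed
  also have "\<dots> = ennreal pi * (\<integral>\<^sup>+\<mu>. (\<integral>\<^sup>+\<tau>. f (2 * \<mu>, \<mu>\<^sup>2 - \<tau>) * indicator {0<..} \<tau> \<partial>lborel) \<partial>lborel)"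
    by (rule nn_integral_cmult) measurable
  finally show ?thesis
    by (simp only: ennreal_mult[of 2 pi, simplified] mult.assoc)
qed

text \<open>The substitution of \<open>l\<close> for \<open>f\<close> makes \<open>l\<close> the largest eigenvalue of the symmetric matrix with
  rows \<open>(b1, b2, v1)\<close>, \<open>(b2, b3, v2)\<close>, \<open>(v1, v2, f)\<close>: here \<open>N l / D l\<close> is the quadratic form of the
  inverse of \<open>l - B\<close> at \<open>v\<close>, and \<open>\<beta>\<close> is the largest eigenvalue of \<open>B\<close>.\<close>

lemma nn_integral_top_eigenvalue:
  fixes F :: "real \<Rightarrow> ennreal" and b1 b2 b3 v1 v2 :: real
  assumes [measurable]: "F \<in> borel_measurable borel" and b2: "b2 \<noteq> 0"
  defines "\<beta> \<equiv> (b1 + b3) / 2 + sqrt (((b1 - b3) / 2)\<^sup>2 + b2\<^sup>2)"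
  defines "D \<equiv> \<lambda>l. (l - b1) * (l - b3) - b2\<^sup>2"
  defines "N \<equiv> \<lambda>l. v1\<^sup>2 * (l - b3) + 2 * v1 * v2 * b2 + v2\<^sup>2 * (l - b1)"
  assumes generic: "v1 * (\<beta> - b3) + v2 * b2 \<noteq> 0"
  shows "(\<integral>\<^sup>+f. F f \<partial>lborel) = (\<integral>\<^sup>+l. (if 0 < (l - b1) + (l - b3) \<and> 0 < D l
    then ennreal (1 + (((l - b3) * v1 + b2 * v2) / D l)\<^sup>2 + ((b2 * v1 + (l - b1) * v2) / D l)\<^sup>2) * F (l - N l / D l)
    else 0) \<partial>lborel)"
proof -
  define r where "r = sqrt (((b1 - b3) / 2)\<^sup>2 + b2\<^sup>2)"
  have r2: "r\<^sup>2 = ((b1 - b3) / 2)\<^sup>2 + b2\<^sup>2" by (simp add: r_def)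
  have rpos: "r > 0" using b2 by (simp add: r_def add_nonneg_pos)
  have rb: "r > \<bar>b1 - b3\<bar> / 2"
  proof -
    have "(\<bar>b1 - b3\<bar> / 2)\<^sup>2 = ((b1 - b3) / 2)\<^sup>2" by (simp only: power_divide power2_abs)
    moreover have "b2\<^sup>2 > 0" using b2 by simp
    ultimately have "(\<bar>b1 - b3\<bar> / 2)\<^sup>2 < r\<^sup>2" unfolding r2 by linarith
    then show ?thesis using rpos by (intro power2_less_imp_less[of "\<bar>b1 - b3\<bar> / 2" r]) auto
  qed
  have \<beta>: "\<beta> = (b1 + b3) / 2 + r" by (simp add: \<beta>_def r_def)
  have Dfac: "D l = (l - \<beta>) * (l - (b1 + b3 - \<beta>))" for l
  proof -
    have "(l - \<beta>) * (l - (b1 + b3 - \<beta>)) = (l - (b1 + b3) / 2)\<^sup>2 - r\<^sup>2"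
      by (simp add: \<beta> field_simps power2_eq_square)
    also have "\<dots> = D l" unfolding r2 D_def by (simp add: field_simps power2_eq_square)
    finally show ?thesis ..
  qed
  have \<beta>b: "\<beta> > b1" "\<beta> > b3" using rb by (auto simp: \<beta> abs_if field_simps split: if_splits)
  \<comment> \<open>\<open>D\<close> is also positive below both of its roots; the condition on the
    trace rules out that branch.\<close>
  have dom: "(0 < (l - b1) + (l - b3) \<and> 0 < D l) \<longleftrightarrow> \<beta> < l" for l
  proof
    assume "\<beta> < l"
    then show "0 < (l - b1) + (l - b3) \<and> 0 < D l"
      using \<beta>b unfolding Dfac by (auto intro!: mult_pos_pos)
  next
    assume *: "0 < (l - b1) + (l - b3) \<and> 0 < D l"
    have "l - (b1 + b3 - \<beta>) > 0" using rpos conjunct1[OF *] unfolding \<beta> by (simp add: field_simps)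
    with * show "\<beta> < l" unfolding Dfac by (simp add: zero_less_mult_iff)
  qed
  have D\<beta>: "D \<beta> = 0" by (simp add: Dfac)
  \<comment> \<open>Since \<open>D\<close> vanishes at \<beta>, the product below is a perfect
    square, and \<open>generic\<close> says that its root is nonzero. Hence \<open>N l / D l\<close>
    has a genuine pole at \<beta>, which is what makes \<open>c\<close> reach minus
    infinity.\<close>
  have N\<beta>: "N \<beta> > 0"
  proof -
    have "(\<beta> - b3) * N \<beta> = (v1 * (\<beta> - b3) + v2 * b2)\<^sup>2 + v2\<^sup>2 * D \<beta>"
      unfolding N_def D_def by (simp add: algebra_simps power2_eq_square)
    also have "\<dots> > 0" using generic by (simp add: D\<beta>)
    finally show ?thesis using \<beta>b by (simp add: zero_less_mult_iff)
  qed
  define c where "c l = l - N l / D l" for l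
  define c' where "c' l = 1 + (((l - b3) * v1 + b2 * v2) / D l)\<^sup>2 + ((b2 * v1 + (l - b1) * v2) / D l)\<^sup>2" for l
  have Dpos: "D l > 0" if "\<beta> < l" for l using dom[of l] that by simp
  have deriv: "(c has_real_derivative c' l) (at l)" if "\<beta> < l" for l
  proof -
    have dD: "(D has_real_derivative ((l - b1) + (l - b3))) (at l)"
      unfolding D_def by (auto intro!: derivative_eq_intros)
    have dN: "(N has_real_derivative (v1\<^sup>2 + v2\<^sup>2)) (at l)"
      unfolding N_def by (auto intro!: derivative_eq_intros)
    have D0: "D l \<noteq> 0" using Dpos[OF that] by simp
    \<comment> \<open>With S = l - B, the derivative of v^T S^-1 v in l is minus the squared norm of
      S^-1 v; this is the identity cleared of the denominator D^2.\<close>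
    have id: "N l * ((l - b1) + (l - b3)) - (v1\<^sup>2 + v2\<^sup>2) * D l
      = ((l - b3) * v1 + b2 * v2)\<^sup>2 + (b2 * v1 + (l - b1) * v2)\<^sup>2"
      unfolding N_def D_def by (simp add: algebra_simps power2_eq_square)
    have "(c has_real_derivative (1 - ((v1\<^sup>2 + v2\<^sup>2) * D l - N l * ((l - b1) + (l - b3))) / (D l * D l))) (at l)"
      unfolding c_def using D0 by (auto intro!: derivative_eq_intros dD dN)
    also have "1 - ((v1\<^sup>2 + v2\<^sup>2) * D l - N l * ((l - b1) + (l - b3))) / (D l * D l)
      = 1 + (N l * ((l - b1) + (l - b3)) - (v1\<^sup>2 + v2\<^sup>2) * D l) / (D l * D l)"
      by (simp add: diff_divide_distrib)
    also have "\<dots> = c' l"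
    proof -
      have "1 + (x\<^sup>2 + y\<^sup>2) / (d * d) = 1 + (x / d)\<^sup>2 + (y / d)\<^sup>2" for x y d :: real
        by (simp add: power_divide add_divide_distrib power2_eq_square)
      then show ?thesis unfolding id c'_def .
    qed
    finally show ?thesis .
  qed
  have contc': "continuous_on {\<beta><..} c'"
    unfolding c'_def D_def using Dpos by (intro continuous_intros) (auto simp: D_def less_imp_neq[symmetric])
  \<comment> \<open>The image is an interval by connectedness, unbounded above as l grows and
    unbounded below as l approaches \<beta> from the right.\<close>
  have img: "c ` {\<beta><..} = UNIV"
  proof -
    have contc: "continuous_on {\<beta><..} c"
      using deriv by (intro continuous_at_imp_continuous_on) (auto intro: DERIV_isCont)
    have "connected (c ` {\<beta><..})"
      by (intro connected_continuous_image contc) auto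
    then have int: "is_interval (c ` {\<beta><..})" by (simp add: is_interval_connected_1)
    have top: "filterlim c at_top at_top"
      unfolding c_def N_def D_def by real_asymp
    have bot: "filterlim (\<lambda>l. N l / D l) at_top (at_right \<beta>)"
    proof (rule LIM_at_top_divide)
      have "isCont N \<beta>" "isCont D \<beta>" unfolding N_def D_def by (intro continuous_intros)+
      then show "(N \<longlongrightarrow> N \<beta>) (at_right \<beta>)" "(D \<longlongrightarrow> 0) (at_right \<beta>)"
        by (auto simp: isCont_def D\<beta> intro: filterlim_mono[OF _ order_refl at_le])
      show "\<forall>\<^sub>F x in at_right \<beta>. 0 < D x"
        using Dpos by (auto simp: eventually_at_right_field intro!: exI[of _ "\<beta> + 1"])
    qed (fact N\<beta>)
    have "y \<in> c ` {\<beta><..}" for y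
    proof -
      have "\<forall>\<^sub>F l in at_top. y \<le> c l \<and> \<beta> < l"
        using top by (intro eventually_conj eventually_gt_at_top) (auto simp: filterlim_at_top)
      then obtain l2 where l2: "y \<le> c l2" "\<beta> < l2"
        by (auto dest: eventually_happens'[OF trivial_limit_at_top_linorder])
      have "\<forall>\<^sub>F l in at_right \<beta>. \<beta> + 1 - y \<le> N l / D l" using bot by (auto simp: filterlim_at_top)
      moreover have "\<forall>\<^sub>F l in at_right \<beta>. \<beta> < l \<and> l < \<beta> + 1"
        by (auto simp: eventually_at_right_field intro!: exI[of _ "\<beta> + 1"])
      ultimately have "\<forall>\<^sub>F l in at_right \<beta>. c l \<le> y \<and> \<beta> < l"
        by eventually_elim (auto simp: c_def)
      then obtain l1 where l1: "c l1 \<le> y" "\<beta> < l1"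
        by (auto dest: eventually_happens'[OF trivial_limit_at_right_real])
      show ?thesis
        using int l1 l2 unfolding is_interval_1 by (metis greaterThan_iff imageI)
    qed
    then show ?thesis by auto
  qed
  have "(\<integral>\<^sup>+f. F f \<partial>lborel) = (\<integral>\<^sup>+f. F f * indicator (c ` {\<beta><..}) f \<partial>lborel)"
    by (simp add: img)
  also have "\<dots> = (\<integral>\<^sup>+l. F (c l) * ennreal (c' l) * indicator {\<beta><..} l \<partial>lborel)"
    by (rule nn_integral_substitution_Ioi) (use deriv contc' in \<open>auto simp: c'_def\<close>)
  also have "\<dots> = (\<integral>\<^sup>+l. (if 0 < (l - b1) + (l - b3) \<and> 0 < D l then ennreal (c' l) * F (c l) else 0) \<partial>lborel)"
    unfolding dom by (intro nn_integral_cong) (simp add: mult.commute split: split_indicator)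
  finally show ?thesis unfolding c_def c'_def .
qed

section \<open>Reduction of the integral over symmetric matrices\<close>

text \<open>In \<open>k\<close> the variables t and \<delta> are trace and determinant of T, so the
  arguments of \<open>\<Psi>\<close> are the elementary symmetric functions of l and the spectrum of
  l - T, with l^2 - l t + \<delta> = det (l - T). The leading factor \<delta> is the accumulated
  Jacobian, and positivity of t and \<delta> says that l is strictly the largest eigenvalue. The
  constant is 2 pi for the eigenvector direction times 2 pi from the reduction of T.\<close>

lemma nn_integral_sym3_spectral:
  fixes \<Psi> :: "real \<times> real \<times> real \<Rightarrow> ennreal"
  assumes [measurable]: "\<Psi> \<in> borel_measurable borel"
  defines "k \<equiv> \<lambda>(l, t, \<delta>). if 0 < t \<and> 0 < \<delta>
    then ennreal \<delta> * \<Psi> (3 * l - t, l * (2 * l - t) + (l\<^sup>2 - l * t + \<delta>), l * (l\<^sup>2 - l * t + \<delta>)) else 0"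
  shows "(\<integral>\<^sup>+a. (\<integral>\<^sup>+b. (\<integral>\<^sup>+c. (\<integral>\<^sup>+d. (\<integral>\<^sup>+e. (\<integral>\<^sup>+f.
      \<Psi> (a + d + f, (a * d - b\<^sup>2) + (a * f - c\<^sup>2) + (d * f - e\<^sup>2),
         a * (d * f - e\<^sup>2) - b * (b * f - c * e) + c * (b * e - c * d))
      \<partial>lborel) \<partial>lborel) \<partial>lborel) \<partial>lborel) \<partial>lborel) \<partial>lborel)
    = ennreal (4 * pi\<^sup>2) * (\<integral>\<^sup>+l. (\<integral>\<^sup>+\<mu>. (\<integral>\<^sup>+\<tau>. k (l, 2 * \<mu>, \<mu>\<^sup>2 - \<tau>) * indicator {0<..} \<tau>
      \<partial>lborel) \<partial>lborel) \<partial>lborel)"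
proof -
  let ?F = "\<lambda>a b c d e f. \<Psi> (a + d + f, (a * d - b\<^sup>2) + (a * f - c\<^sup>2) + (d * f - e\<^sup>2),
         a * (d * f - e\<^sup>2) - b * (b * f - c * e) + c * (b * e - c * d))"
  let ?k = "\<lambda>l s1 s2 s3 x y. k (l, s1 * (1 + x\<^sup>2) + 2 * s2 * x * y + s3 * (1 + y\<^sup>2), (s1 * s3 - s2\<^sup>2) * (1 + x\<^sup>2 + y\<^sup>2))"
  have "k \<in> borel_measurable (borel \<Otimes>\<^sub>M (borel \<Otimes>\<^sub>M borel))"
    unfolding k_def by measurable
  then have km [measurable]: "k \<in> borel_measurable borel"
    by (simp only: borel_prod)
  \<comment> \<open>\<open>(w1, w2, 1)\<close> is an eigenvector for the largest eigenvalue \<open>l\<close>.\<close>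
  define w1 where "w1 = (\<lambda>(l::real, s1, s2, s3, v1, v2). (s3 * v1 - s2 * v2) / (s1 * s3 - s2\<^sup>2) :: real)"
  define w2 where "w2 = (\<lambda>(l::real, s1, s2, s3, v1, v2). (- s2 * v1 + s1 * v2) / (s1 * s3 - s2\<^sup>2) :: real)"
  \<comment> \<open>The integrand after f has been replaced by l, as a function of l, of S = l - B
    with entries s1, s2, s3, and of v; the first factor is the derivative of f with respect to
    l.\<close>
  define g where "g = (\<lambda>p. case p of (l, s1, s2, s3, v1, v2) \<Rightarrow>
    if 0 < s1 + s3 \<and> 0 < s1 * s3 - s2\<^sup>2
    then ennreal (1 + (w1 p)\<^sup>2 + (w2 p)\<^sup>2) *
      (let t = s1 * (1 + (w1 p)\<^sup>2) + 2 * s2 * w1 p * w2 p + s3 * (1 + (w2 p)\<^sup>2);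
           \<delta> = (s1 * s3 - s2\<^sup>2) * (1 + (w1 p)\<^sup>2 + (w2 p)\<^sup>2)
       in \<Psi> (3 * l - t, l * (2 * l - t) + (l\<^sup>2 - l * t + \<delta>), l * (l\<^sup>2 - l * t + \<delta>)))
    else 0)"
  have [measurable]: "w1 \<in> borel_measurable (borel \<Otimes>\<^sub>M (borel \<Otimes>\<^sub>M (borel \<Otimes>\<^sub>M (borel \<Otimes>\<^sub>M (borel \<Otimes>\<^sub>M borel)))))"
    unfolding w1_def by measurable
  have [measurable]: "w2 \<in> borel_measurable (borel \<Otimes>\<^sub>M (borel \<Otimes>\<^sub>M (borel \<Otimes>\<^sub>M (borel \<Otimes>\<^sub>M (borel \<Otimes>\<^sub>M borel)))))"
    unfolding w2_def by measurable
  have "g \<in> borel_measurable (borel \<Otimes>\<^sub>M (borel \<Otimes>\<^sub>M (borel \<Otimes>\<^sub>M (borel \<Otimes>\<^sub>M (borel \<Otimes>\<^sub>M borel)))))"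
    unfolding g_def Let_def by measurable
  then have gm [measurable]: "g \<in> borel_measurable borel"
    by (simp only: borel_prod)
  have "(\<integral>\<^sup>+a. (\<integral>\<^sup>+b. (\<integral>\<^sup>+c. (\<integral>\<^sup>+d. (\<integral>\<^sup>+e. (\<integral>\<^sup>+f.
      ?F a b c d e f
      \<partial>lborel) \<partial>lborel) \<partial>lborel) \<partial>lborel) \<partial>lborel) \<partial>lborel)
    = (\<integral>\<^sup>+a. (\<integral>\<^sup>+b. (\<integral>\<^sup>+c. (\<integral>\<^sup>+d. (\<integral>\<^sup>+e. (\<integral>\<^sup>+l.
        g (l, l - a, - b, l - d, c, e) \<partial>lborel) \<partial>lborel) \<partial>lborel) \<partial>lborel) \<partial>lborel) \<partial>lborel)"
  proof (rule nn_integral_cong)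
    fix a :: real
    show "(\<integral>\<^sup>+b. (\<integral>\<^sup>+c. (\<integral>\<^sup>+d. (\<integral>\<^sup>+e. (\<integral>\<^sup>+f.
      ?F a b c d e f
      \<partial>lborel) \<partial>lborel) \<partial>lborel) \<partial>lborel) \<partial>lborel)
     = (\<integral>\<^sup>+b. (\<integral>\<^sup>+c. (\<integral>\<^sup>+d. (\<integral>\<^sup>+e. (\<integral>\<^sup>+l.
        g (l, l - a, - b, l - d, c, e) \<partial>lborel) \<partial>lborel) \<partial>lborel) \<partial>lborel) \<partial>lborel)"
    proof (rule nn_integral_cong_AE, use AE_lborel_singleton[of 0] in eventually_elim)
      fix b :: real assume b: "b \<noteq> 0"
      show "(\<integral>\<^sup>+c. (\<integral>\<^sup>+d. (\<integral>\<^sup>+e. (\<integral>\<^sup>+f.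
      ?F a b c d e f
      \<partial>lborel) \<partial>lborel) \<partial>lborel) \<partial>lborel)
       = (\<integral>\<^sup>+c. (\<integral>\<^sup>+d. (\<integral>\<^sup>+e. (\<integral>\<^sup>+l.
        g (l, l - a, - b, l - d, c, e) \<partial>lborel) \<partial>lborel) \<partial>lborel) \<partial>lborel)"
      proof (rule nn_integral_cong, rule nn_integral_cong)
        fix c d :: real
        \<comment> \<open>The largest eigenvalue of the upper left block. The substitution of l
          requires b nonzero and \<open>c * (\<beta> - d) + e * b\<close> nonzero; for fixed b, c, d
          the second condition excludes a single e.\<close>
        define \<beta> where "\<beta> = (a + d) / 2 + sqrt (((a - d) / 2)\<^sup>2 + b\<^sup>2)"
        show "(\<integral>\<^sup>+e. (\<integral>\<^sup>+f. ?F a b c d e f \<partial>lborel) \<partial>lborel)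
          = (\<integral>\<^sup>+e. (\<integral>\<^sup>+l. g (l, l - a, - b, l - d, c, e) \<partial>lborel) \<partial>lborel)"
        proof (rule nn_integral_cong_AE, use AE_lborel_singleton[of "- c * (\<beta> - d) / b"] in eventually_elim)
          fix e :: real assume "e \<noteq> - c * (\<beta> - d) / b"
          then have gen: "c * (\<beta> - d) + e * b \<noteq> 0"
            using b by (auto simp: field_simps)
          define D where "D l = (l - a) * (l - d) - b\<^sup>2" for l
          define N where "N l = c\<^sup>2 * (l - d) + 2 * c * e * b + e\<^sup>2 * (l - a)" for l
          have "(\<integral>\<^sup>+f. ?F a b c d e f \<partial>lborel)
            = (\<integral>\<^sup>+l. (if 0 < (l - a) + (l - d) \<and> 0 < D l
                then ennreal (1 + (((l - d) * c + b * e) / D l)\<^sup>2 + ((b * c + (l - a) * e) / D l)\<^sup>2) *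
                  ?F a b c d e (l - N l / D l)
                else 0) \<partial>lborel)"
            unfolding D_def N_def
            by (rule nn_integral_top_eigenvalue[where F = "\<lambda>f. ?F a b c d e f"])
              (use b gen in \<open>auto simp: \<beta>_def\<close>)
          also have "\<dots> = (\<integral>\<^sup>+l. g (l, l - a, - b, l - d, c, e) \<partial>lborel)"
          proof (rule nn_integral_cong)
            fix l :: real
            define x where "x = w1 (l, l - a, - b, l - d, c, e)"
            define y where "y = w2 (l, l - a, - b, l - d, c, e)"
            have x: "x = ((l - d) * c + b * e) / D l"
              by (simp add: x_def w1_def D_def)
            have y: "y = (b * c + (l - a) * e) / D l"
              by (simp add: y_def w2_def D_def)
            define s1 s2 s3 where "s1 = l - a" and "s2 = - b" and "s3 = l - d"
            have D: "D l = s1 * s3 - s2\<^sup>2" by (simp add: D_def s1_def s2_def s3_def)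
            have abd: "a = l - s1" "b = - s2" "d = l - s3" by (simp_all add: s1_def s2_def s3_def)
            show "(if 0 < (l - a) + (l - d) \<and> 0 < D l
                then ennreal (1 + (((l - d) * c + b * e) / D l)\<^sup>2 + ((b * c + (l - a) * e) / D l)\<^sup>2) *
                  ?F a b c d e (l - N l / D l)
                else 0) = g (l, l - a, - b, l - d, c, e)"
            proof (cases "0 < (l - a) + (l - d) \<and> 0 < D l")
              case True
              then have D0: "D l \<noteq> 0" by simp
              have x': "x = (s3 * c - s2 * e) / D l" and y': "y = (- s2 * c + s1 * e) / D l"
                by (simp_all add: x y s1_def s2_def s3_def)
              have frac: "p * (u / d) + r * (v / d) = (p * u + r * v) / d" for p u r v d :: real
                by (simp add: add_divide_distrib)
              have c: "c = s1 * x + s2 * y"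
              proof -
                have "s1 * x + s2 * y = (s1 * (s3 * c - s2 * e) + s2 * (- s2 * c + s1 * e)) / D l"
                  unfolding x' y' by (rule frac)
                also have "\<dots> = c * D l / D l"
                  by (simp add: D algebra_simps power2_eq_square)
                finally show ?thesis using D0 by simp
              qed
              have e: "e = s2 * x + s3 * y"
              proof -
                have "s2 * x + s3 * y = (s2 * (s3 * c - s2 * e) + s3 * (- s2 * c + s1 * e)) / D l"
                  unfolding x' y' by (rule frac)
                also have "\<dots> = e * D l / D l"
                  by (simp add: D algebra_simps power2_eq_square)
                finally show ?thesis using D0 by simp
              qed
              have f: "l - N l / D l = l - (c * x + e * y)"
              proof -
                have "c * x + e * y = (c * (s3 * c - s2 * e) + e * (- s2 * c + s1 * e)) / D l"
                  unfolding x' y' by (rule frac)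
                also have "\<dots> = N l / D l"
                  by (simp add: N_def s1_def s2_def s3_def algebra_simps power2_eq_square)
                finally show ?thesis by simp
              qed
              define t where "t = s1 * (1 + x\<^sup>2) + 2 * s2 * x * y + s3 * (1 + y\<^sup>2)"
              define \<delta> where "\<delta> = (s1 * s3 - s2\<^sup>2) * (1 + x\<^sup>2 + y\<^sup>2)"
              define h where "h = l - (c * x + e * y)"
              \<comment> \<open>Once a, b, d are expressed by l and S and (c, e) = S (x, y), the
                three coefficients of the characteristic polynomial are polynomial identities in l,
                s1, s2, s3, x, y.\<close>
              have E1: "a + d + h = 3 * l - t"
                unfolding h_def t_def c e abd by (simp add: algebra_simps power2_eq_square)
              have E2: "(a * d - b\<^sup>2) + (a * h - c\<^sup>2) + (d * h - e\<^sup>2) = l * (2 * l - t) + (l\<^sup>2 - l * t + \<delta>)"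
                unfolding h_def t_def \<delta>_def c e abd by (simp add: algebra_simps power2_eq_square)
              have E3: "a * (d * h - e\<^sup>2) - b * (b * h - c * e) + c * (b * e - c * d) = l * (l\<^sup>2 - l * t + \<delta>)"
                unfolding h_def t_def \<delta>_def c e abd by (simp add: algebra_simps power2_eq_square)
              have "g (l, l - a, - b, l - d, c, e) = ennreal (1 + x\<^sup>2 + y\<^sup>2) *
                \<Psi> (3 * l - t, l * (2 * l - t) + (l\<^sup>2 - l * t + \<delta>), l * (l\<^sup>2 - l * t + \<delta>))"
                using True
                by (simp only: g_def prod.case if_True simp_thms D_def power2_minus Let_def x_def[symmetric] y_def[symmetric]
                    t_def \<delta>_def s1_def s2_def s3_def)
              then show ?thesis
                using True unfolding f h_def[symmetric] E1 E2 E3 x[symmetric] y[symmetric] by simp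
            next
              case False
              then show ?thesis by (simp only: g_def prod.case if_False simp_thms D_def power2_minus)
            qed
          qed
          finally show "(\<integral>\<^sup>+f. ?F a b c d e f \<partial>lborel)
            = (\<integral>\<^sup>+l. g (l, l - a, - b, l - d, c, e) \<partial>lborel)" .
        qed
      qed
    qed
  qed
  \<comment> \<open>The variable l is moved outermost, so that for fixed l the entries a, b, d can
    be reflected into s1 = l - a, s2 = - b, s3 = l - d.\<close>
  also have "\<dots> = (\<integral>\<^sup>+a. (\<integral>\<^sup>+b. (\<integral>\<^sup>+c. (\<integral>\<^sup>+d. (\<integral>\<^sup>+l. (\<integral>\<^sup>+e.
        g (l, l - a, - b, l - d, c, e) \<partial>lborel) \<partial>lborel) \<partial>lborel) \<partial>lborel) \<partial>lborel) \<partial>lborel)"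
    by (rule nn_integral_cong, rule nn_integral_cong, rule nn_integral_cong, rule nn_integral_cong,
        rule nn_integral_lborel_swap) measurable
  also have "\<dots> = (\<integral>\<^sup>+a. (\<integral>\<^sup>+b. (\<integral>\<^sup>+c. (\<integral>\<^sup>+l. (\<integral>\<^sup>+d. (\<integral>\<^sup>+e.
        g (l, l - a, - b, l - d, c, e) \<partial>lborel) \<partial>lborel) \<partial>lborel) \<partial>lborel) \<partial>lborel) \<partial>lborel)"
    by (rule nn_integral_cong, rule nn_integral_cong, rule nn_integral_cong, rule nn_integral_lborel_swap) measurable
  also have "\<dots> = (\<integral>\<^sup>+a. (\<integral>\<^sup>+b. (\<integral>\<^sup>+l. (\<integral>\<^sup>+c. (\<integral>\<^sup>+d. (\<integral>\<^sup>+e.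
        g (l, l - a, - b, l - d, c, e) \<partial>lborel) \<partial>lborel) \<partial>lborel) \<partial>lborel) \<partial>lborel) \<partial>lborel)"
    by (rule nn_integral_cong, rule nn_integral_cong, rule nn_integral_lborel_swap) measurable
  also have "\<dots> = (\<integral>\<^sup>+a. (\<integral>\<^sup>+l. (\<integral>\<^sup>+b. (\<integral>\<^sup>+c. (\<integral>\<^sup>+d. (\<integral>\<^sup>+e.
        g (l, l - a, - b, l - d, c, e) \<partial>lborel) \<partial>lborel) \<partial>lborel) \<partial>lborel) \<partial>lborel) \<partial>lborel)"
    by (rule nn_integral_cong, rule nn_integral_lborel_swap) measurable
  also have "\<dots> = (\<integral>\<^sup>+l. (\<integral>\<^sup>+a. (\<integral>\<^sup>+b. (\<integral>\<^sup>+c. (\<integral>\<^sup>+d. (\<integral>\<^sup>+e.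
        g (l, l - a, - b, l - d, c, e) \<partial>lborel) \<partial>lborel) \<partial>lborel) \<partial>lborel) \<partial>lborel) \<partial>lborel)"
    by (rule nn_integral_lborel_swap) measurable
  also have "\<dots> = (\<integral>\<^sup>+l. (\<integral>\<^sup>+s1. (\<integral>\<^sup>+b. (\<integral>\<^sup>+c. (\<integral>\<^sup>+d. (\<integral>\<^sup>+e.
        g (l, s1, - b, l - d, c, e) \<partial>lborel) \<partial>lborel) \<partial>lborel) \<partial>lborel) \<partial>lborel) \<partial>lborel)"
    by (rule nn_integral_cong, rule nn_integral_reflect) measurable
  also have "\<dots> = (\<integral>\<^sup>+l. (\<integral>\<^sup>+s1. (\<integral>\<^sup>+b. (\<integral>\<^sup>+c. (\<integral>\<^sup>+d. (\<integral>\<^sup>+e.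
        g (l, s1, 0 - b, l - d, c, e) \<partial>lborel) \<partial>lborel) \<partial>lborel) \<partial>lborel) \<partial>lborel) \<partial>lborel)"
    by (simp only: diff_0)
  also have "\<dots> = (\<integral>\<^sup>+l. (\<integral>\<^sup>+s1. (\<integral>\<^sup>+s2. (\<integral>\<^sup>+c. (\<integral>\<^sup>+d. (\<integral>\<^sup>+e.
        g (l, s1, s2, l - d, c, e) \<partial>lborel) \<partial>lborel) \<partial>lborel) \<partial>lborel) \<partial>lborel) \<partial>lborel)"
    by (rule nn_integral_cong, rule nn_integral_cong, rule nn_integral_reflect) measurable
  also have "\<dots> = (\<integral>\<^sup>+l. (\<integral>\<^sup>+s1. (\<integral>\<^sup>+s2. (\<integral>\<^sup>+c. (\<integral>\<^sup>+s3. (\<integral>\<^sup>+e.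
        g (l, s1, s2, s3, c, e) \<partial>lborel) \<partial>lborel) \<partial>lborel) \<partial>lborel) \<partial>lborel) \<partial>lborel)"
    by (rule nn_integral_cong, rule nn_integral_cong, rule nn_integral_cong, rule nn_integral_cong,
        rule nn_integral_reflect) measurable
  also have "\<dots> = (\<integral>\<^sup>+l. (\<integral>\<^sup>+s1. (\<integral>\<^sup>+s2. (\<integral>\<^sup>+s3. (\<integral>\<^sup>+c. (\<integral>\<^sup>+e.
        g (l, s1, s2, s3, c, e) \<partial>lborel) \<partial>lborel) \<partial>lborel) \<partial>lborel) \<partial>lborel) \<partial>lborel)"
    by (rule nn_integral_cong, rule nn_integral_cong, rule nn_integral_cong, rule nn_integral_lborel_swap) measurable
  \<comment> \<open>Here v = S w. Its Jacobian det S meets the factor 1 + x^2 + y^2 already present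
    in \<open>g\<close>, and together they are the determinant of T.\<close>
  also have "\<dots> = (\<integral>\<^sup>+l. (\<integral>\<^sup>+s1. (\<integral>\<^sup>+s2. (\<integral>\<^sup>+s3. (\<integral>\<^sup>+x. (\<integral>\<^sup>+y.
        ?k l s1 s2 s3 x y
      \<partial>lborel) \<partial>lborel) \<partial>lborel) \<partial>lborel) \<partial>lborel) \<partial>lborel)"
  proof (rule nn_integral_cong, rule nn_integral_cong, rule nn_integral_cong, rule nn_integral_cong)
    fix l s1 s2 s3 :: real
    let ?K = "\<integral>\<^sup>+x. (\<integral>\<^sup>+y. ?k l s1 s2 s3 x y
      \<partial>lborel) \<partial>lborel"
    define D where "D = s1 * s3 - s2\<^sup>2"
    have norm_pos: "1 + x\<^sup>2 + y\<^sup>2 > 0" for x y :: real by (simp add: add_pos_nonneg)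
    show "(\<integral>\<^sup>+c. (\<integral>\<^sup>+e. g (l, s1, s2, s3, c, e) \<partial>lborel) \<partial>lborel) = ?K"
    proof (cases "0 < s1 + s3 \<and> 0 < D")
      case True
      then have D: "D > 0" and "s1 + s3 > 0" by auto
      have "s1 * s3 > 0" using D zero_le_power2[of s2] unfolding D_def by linarith
      then have s: "s1 > 0" "s3 > 0" using \<open>s1 + s3 > 0\<close> by (auto simp: zero_less_mult_iff)
      have tpos: "s1 * (1 + x\<^sup>2) + 2 * s2 * x * y + s3 * (1 + y\<^sup>2) > 0" for x y
      proof -
        have "s1 * (s1 * x\<^sup>2 + 2 * s2 * x * y + s3 * y\<^sup>2) = (s1 * x + s2 * y)\<^sup>2 + D * y\<^sup>2"
          by (simp add: D_def algebra_simps power2_eq_square)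
        also have "\<dots> \<ge> 0" using D by simp
        finally have "s1 * x\<^sup>2 + 2 * s2 * x * y + s3 * y\<^sup>2 \<ge> 0" using s by (simp add: zero_le_mult_iff)
        then show ?thesis using s by (simp add: algebra_simps)
      qed
      have "(\<integral>\<^sup>+c. (\<integral>\<^sup>+e. g (l, s1, s2, s3, c, e) \<partial>lborel) \<partial>lborel) = ennreal D *
        (\<integral>\<^sup>+x. (\<integral>\<^sup>+y. g (l, s1, s2, s3, s1 * x + s2 * y, s2 * x + s3 * y) \<partial>lborel) \<partial>lborel)"
        using s D unfolding D_def
        by (intro nn_integral_linear_2x2[where f = "\<lambda>v. g (l, s1, s2, s3, v)", unfolded prod.case]) auto
      also have "\<dots> = (\<integral>\<^sup>+x. ennreal D * (\<integral>\<^sup>+y. g (l, s1, s2, s3, s1 * x + s2 * y, s2 * x + s3 * y) \<partial>lborel) \<partial>lborel)"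
        by (rule nn_integral_cmult[symmetric]) measurable
      also have "\<dots> = (\<integral>\<^sup>+x. (\<integral>\<^sup>+y. ennreal D * g (l, s1, s2, s3, s1 * x + s2 * y, s2 * x + s3 * y) \<partial>lborel) \<partial>lborel)"
        by (rule nn_integral_cong, rule nn_integral_cmult[symmetric]) measurable
      also have "\<dots> = ?K"
      proof (rule nn_integral_cong, rule nn_integral_cong)
        fix x y :: real
        define p where "p = (l, s1, s2, s3, s1 * x + s2 * y, s2 * x + s3 * y)"
        have "s3 * (s1 * x + s2 * y) - s2 * (s2 * x + s3 * y) = x * D"
          "- s2 * (s1 * x + s2 * y) + s1 * (s2 * x + s3 * y) = y * D"
          by (simp_all add: D_def algebra_simps power2_eq_square)
        then have w: "w1 p = x" "w2 p = y"
          using D by (simp_all only: w1_def w2_def p_def prod.case D_def[symmetric]) simp_all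
        define t where "t = s1 * (1 + x\<^sup>2) + 2 * s2 * x * y + s3 * (1 + y\<^sup>2)"
        define \<delta> where "\<delta> = D * (1 + x\<^sup>2 + y\<^sup>2)"
        have \<delta>: "\<delta> > 0" using D norm_pos by (simp add: \<delta>_def)
        have "g p = ennreal (1 + x\<^sup>2 + y\<^sup>2) *
            \<Psi> (3 * l - t, l * (2 * l - t) + (l\<^sup>2 - l * t + \<delta>), l * (l\<^sup>2 - l * t + \<delta>))"
          using True unfolding g_def w
          by (simp only: p_def prod.case if_True simp_thms D_def[symmetric] Let_def t_def \<delta>_def)
        then have "ennreal D * g p = ennreal \<delta> *
            \<Psi> (3 * l - t, l * (2 * l - t) + (l\<^sup>2 - l * t + \<delta>), l * (l\<^sup>2 - l * t + \<delta>))"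
          unfolding \<delta>_def using D norm_pos[of x y] by (simp add: ennreal_mult mult.assoc)
        also have "\<dots> = k (l, t, \<delta>)"
          unfolding k_def using \<delta> tpos[of x y] by (simp add: t_def)
        finally show "ennreal D * g (l, s1, s2, s3, s1 * x + s2 * y, s2 * x + s3 * y) =
          ?k l s1 s2 s3 x y"
          by (simp only: p_def t_def \<delta>_def D_def)
      qed
      finally show ?thesis .
    next
      case False
      \<comment> \<open>Congruence keeps the signature: if S is not positive definite, neither is T.
        Either the determinant is not positive, or S is negative definite and so the trace of T is
        not positive.\<close>
      have k0: "?k l s1 s2 s3 x y = 0" for x y
      proof (cases "D > 0")
        case True
        with False have "s1 + s3 \<le> 0" by simp
        have "s1 * s3 > 0" using True zero_le_power2[of s2] unfolding D_def by linarith
        then have s: "s1 < 0" "s3 < 0" using \<open>s1 + s3 \<le> 0\<close> by (auto simp: zero_less_mult_iff)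
        have "s1 * (s1 * x\<^sup>2 + 2 * s2 * x * y + s3 * y\<^sup>2) = (s1 * x + s2 * y)\<^sup>2 + D * y\<^sup>2"
          by (simp add: D_def algebra_simps power2_eq_square)
        also have "\<dots> \<ge> 0" using True by simp
        finally have "s1 * x\<^sup>2 + 2 * s2 * x * y + s3 * y\<^sup>2 \<le> 0" using s by (simp add: zero_le_mult_iff)
        then have "s1 * (1 + x\<^sup>2) + 2 * s2 * x * y + s3 * (1 + y\<^sup>2) \<le> 0" using s by (simp add: algebra_simps)
        then show ?thesis unfolding k_def by simp
      next
        case False
        then have "(s1 * s3 - s2\<^sup>2) * (1 + x\<^sup>2 + y\<^sup>2) \<le> 0"
          unfolding D_def[symmetric] using norm_pos[of x y] by (simp add: mult_le_0_iff)
        then show ?thesis unfolding k_def by simp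
      qed
      have g0: "g (l, s1, s2, s3, c, e) = 0" for c e
        using False by (simp only: g_def prod.case if_False simp_thms D_def)
      show ?thesis by (simp only: k0 g0)
    qed
  qed
  \<comment> \<open>The variables x and y go outermost because the congruence that turns S into T
    depends on them.\<close>
  also have "\<dots> = (\<integral>\<^sup>+l. (\<integral>\<^sup>+s1. (\<integral>\<^sup>+s2. (\<integral>\<^sup>+x. (\<integral>\<^sup>+s3. (\<integral>\<^sup>+y.
        ?k l s1 s2 s3 x y
      \<partial>lborel) \<partial>lborel) \<partial>lborel) \<partial>lborel) \<partial>lborel) \<partial>lborel)"
    by (rule nn_integral_cong, rule nn_integral_cong, rule nn_integral_cong, rule nn_integral_lborel_swap) measurable
  also have "\<dots> = (\<integral>\<^sup>+l. (\<integral>\<^sup>+s1. (\<integral>\<^sup>+x. (\<integral>\<^sup>+s2. (\<integral>\<^sup>+s3. (\<integral>\<^sup>+y.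
        ?k l s1 s2 s3 x y
      \<partial>lborel) \<partial>lborel) \<partial>lborel) \<partial>lborel) \<partial>lborel) \<partial>lborel)"
    by (rule nn_integral_cong, rule nn_integral_cong, rule nn_integral_lborel_swap) measurable
  also have "\<dots> = (\<integral>\<^sup>+l. (\<integral>\<^sup>+x. (\<integral>\<^sup>+s1. (\<integral>\<^sup>+s2. (\<integral>\<^sup>+s3. (\<integral>\<^sup>+y.
        ?k l s1 s2 s3 x y
      \<partial>lborel) \<partial>lborel) \<partial>lborel) \<partial>lborel) \<partial>lborel) \<partial>lborel)"
    by (rule nn_integral_cong, rule nn_integral_lborel_swap) measurable
  also have "\<dots> = (\<integral>\<^sup>+x. (\<integral>\<^sup>+l. (\<integral>\<^sup>+s1. (\<integral>\<^sup>+s2. (\<integral>\<^sup>+s3. (\<integral>\<^sup>+y.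
        ?k l s1 s2 s3 x y
      \<partial>lborel) \<partial>lborel) \<partial>lborel) \<partial>lborel) \<partial>lborel) \<partial>lborel)"
    by (rule nn_integral_lborel_swap) measurable
  also have "\<dots> = (\<integral>\<^sup>+x. (\<integral>\<^sup>+l. (\<integral>\<^sup>+s1. (\<integral>\<^sup>+s2. (\<integral>\<^sup>+y. (\<integral>\<^sup>+s3.
        ?k l s1 s2 s3 x y
      \<partial>lborel) \<partial>lborel) \<partial>lborel) \<partial>lborel) \<partial>lborel) \<partial>lborel)"
    by (rule nn_integral_cong, rule nn_integral_cong, rule nn_integral_cong, rule nn_integral_cong,
        rule nn_integral_lborel_swap) measurable
  also have "\<dots> = (\<integral>\<^sup>+x. (\<integral>\<^sup>+l. (\<integral>\<^sup>+s1. (\<integral>\<^sup>+y. (\<integral>\<^sup>+s2. (\<integral>\<^sup>+s3.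
        ?k l s1 s2 s3 x y
      \<partial>lborel) \<partial>lborel) \<partial>lborel) \<partial>lborel) \<partial>lborel) \<partial>lborel)"
    by (rule nn_integral_cong, rule nn_integral_cong, rule nn_integral_cong, rule nn_integral_lborel_swap) measurable
  also have "\<dots> = (\<integral>\<^sup>+x. (\<integral>\<^sup>+l. (\<integral>\<^sup>+y. (\<integral>\<^sup>+s1. (\<integral>\<^sup>+s2. (\<integral>\<^sup>+s3.
        ?k l s1 s2 s3 x y
      \<partial>lborel) \<partial>lborel) \<partial>lborel) \<partial>lborel) \<partial>lborel) \<partial>lborel)"
    by (rule nn_integral_cong, rule nn_integral_cong, rule nn_integral_lborel_swap) measurable
  also have "\<dots> = (\<integral>\<^sup>+x. (\<integral>\<^sup>+y. (\<integral>\<^sup>+l. (\<integral>\<^sup>+s1. (\<integral>\<^sup>+s2. (\<integral>\<^sup>+s3.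
        ?k l s1 s2 s3 x y
      \<partial>lborel) \<partial>lborel) \<partial>lborel) \<partial>lborel) \<partial>lborel) \<partial>lborel)"
    by (rule nn_integral_cong, rule nn_integral_lborel_swap) measurable
  also have "\<dots> = (\<integral>\<^sup>+x. (\<integral>\<^sup>+y. ennreal ((1 + x\<^sup>2 + y\<^sup>2) powr (-3/2)) *
      (\<integral>\<^sup>+l. (\<integral>\<^sup>+r. (\<integral>\<^sup>+s. (\<integral>\<^sup>+t. k (l, r + t, r * t - s\<^sup>2) \<partial>lborel) \<partial>lborel) \<partial>lborel) \<partial>lborel)
      \<partial>lborel) \<partial>lborel)"
  proof (rule nn_integral_cong, rule nn_integral_cong)
    fix x y :: real
    define \<rho> where "\<rho> = 1 + x\<^sup>2 + y\<^sup>2"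
    have \<rho>: "\<rho> > 0" by (simp add: \<rho>_def add_pos_nonneg)
    have y1: "1 + y\<^sup>2 > 0" by (simp add: add_pos_nonneg)
    \<comment> \<open>These are the entries of a triangular C with C C^T = 1 + w w^T, w = (x, y), so
      tr T = tr (S (1 + w w^T)) does not involve roots. As \<alpha> \<delta> is the square root of
      \<rho> = 1 + |w|^2, the Jacobian is \<rho> to the power 3/2, whose inverse becomes the weight
      of w.\<close>
    define \<alpha> where "\<alpha> = sqrt (1 + y\<^sup>2)"
    define \<delta> where "\<delta> = sqrt (\<rho> / (1 + y\<^sup>2))"
    define \<beta> where "\<beta> = x * y / \<alpha>"
    have pos: "\<alpha> > 0" "\<delta> > 0" using \<rho> y1 by (auto simp: \<alpha>_def \<delta>_def)
    have \<alpha>2: "\<alpha>\<^sup>2 = 1 + y\<^sup>2" and \<delta>2: "\<delta>\<^sup>2 = \<rho> / (1 + y\<^sup>2)"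
      using \<rho> y1 by (auto simp: \<alpha>_def \<delta>_def)
    have \<alpha>\<beta>: "\<alpha> * \<beta> = x * y" using pos by (simp add: \<beta>_def)
    have \<alpha>\<delta>2: "\<alpha>\<^sup>2 * \<delta>\<^sup>2 = \<rho>" unfolding \<alpha>2 \<delta>2 using y1 by simp
    have \<beta>\<delta>: "\<beta>\<^sup>2 + \<delta>\<^sup>2 = 1 + x\<^sup>2"
    proof -
      have "\<beta>\<^sup>2 + \<delta>\<^sup>2 = (x\<^sup>2 * y\<^sup>2 + \<rho>) / (1 + y\<^sup>2)"
        unfolding \<delta>2 \<beta>_def power_divide \<alpha>2 by (simp add: power_mult_distrib add_divide_distrib)
      also have "x\<^sup>2 * y\<^sup>2 + \<rho> = (1 + x\<^sup>2) * (1 + y\<^sup>2)" by (simp add: \<rho>_def algebra_simps)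
      finally show ?thesis using y1 by simp
    qed
    have powr: "\<rho> powr (-3/2) * (\<alpha> * \<delta>) ^ 3 = 1"
    proof -
      have ad: "\<alpha> * \<delta> = sqrt \<rho>"
        using \<alpha>\<delta>2 pos by (metis power_mult_distrib real_sqrt_unique mult_nonneg_nonneg less_imp_le)
      have "(\<alpha> * \<delta>) ^ 3 = \<rho> powr (3/2)"
        unfolding ad using \<rho> by (simp add: powr_half_sqrt[symmetric] powr_powr powr_realpow[symmetric])
      then show ?thesis using \<rho> by (simp add: powr_add[symmetric])
    qed
    have "(\<integral>\<^sup>+r. (\<integral>\<^sup>+s. (\<integral>\<^sup>+t. k (l, r + t, r * t - s\<^sup>2) \<partial>lborel) \<partial>lborel) \<partial>lborel) = ennreal ((\<alpha> * \<delta>) ^ 3) *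
       (\<integral>\<^sup>+s1. (\<integral>\<^sup>+s2. (\<integral>\<^sup>+s3. ?k l s1 s2 s3 x y
      \<partial>lborel) \<partial>lborel) \<partial>lborel)" for l
    proof -
      have tr: "\<delta>\<^sup>2 * r + (\<beta>\<^sup>2 * r + 2 * \<alpha> * \<beta> * s + \<alpha>\<^sup>2 * t) = r * (1 + x\<^sup>2) + 2 * s * x * y + t * (1 + y\<^sup>2)" for r s t
      proof -
        have "\<delta>\<^sup>2 * r + (\<beta>\<^sup>2 * r + 2 * \<alpha> * \<beta> * s + \<alpha>\<^sup>2 * t) = r * (\<beta>\<^sup>2 + \<delta>\<^sup>2) + 2 * s * (\<alpha> * \<beta>) + t * \<alpha>\<^sup>2"
          by (simp add: algebra_simps)
        then show ?thesis unfolding \<beta>\<delta> \<alpha>\<beta> \<alpha>2 by (simp add: mult.assoc)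
      qed
      have dt: "\<delta>\<^sup>2 * r * (\<beta>\<^sup>2 * r + 2 * \<alpha> * \<beta> * s + \<alpha>\<^sup>2 * t) - (\<delta> * \<beta> * r + \<delta> * \<alpha> * s)\<^sup>2
        = (r * t - s\<^sup>2) * (1 + x\<^sup>2 + y\<^sup>2)" for r s t
      proof -
        have "\<delta>\<^sup>2 * r * (\<beta>\<^sup>2 * r + 2 * \<alpha> * \<beta> * s + \<alpha>\<^sup>2 * t) - (\<delta> * \<beta> * r + \<delta> * \<alpha> * s)\<^sup>2
          = (r * t - s\<^sup>2) * (\<alpha>\<^sup>2 * \<delta>\<^sup>2)"
          by (simp add: algebra_simps power2_eq_square)
        then show ?thesis unfolding \<alpha>\<delta>2 \<rho>_def .
      qed
      have "(\<lambda>(r, s, t). k (l, r + t, r * t - s\<^sup>2)) \<in> borel_measurable (borel \<Otimes>\<^sub>M (borel \<Otimes>\<^sub>M borel))"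
        by measurable
      then have "(\<lambda>(r, s, t). k (l, r + t, r * t - s\<^sup>2)) \<in> borel_measurable borel"
        by (simp only: borel_prod)
      from nn_integral_triangular_congruence[OF this pos, of \<beta>]
      show ?thesis
        by (simp only: prod.case tr dt)
    qed
    then have "ennreal (\<rho> powr (-3/2)) * (\<integral>\<^sup>+l. (\<integral>\<^sup>+r. (\<integral>\<^sup>+s. (\<integral>\<^sup>+t. k (l, r + t, r * t - s\<^sup>2) \<partial>lborel) \<partial>lborel) \<partial>lborel) \<partial>lborel)
      = ennreal (\<rho> powr (-3/2)) * (\<integral>\<^sup>+l. ennreal ((\<alpha> * \<delta>) ^ 3) *
       (\<integral>\<^sup>+s1. (\<integral>\<^sup>+s2. (\<integral>\<^sup>+s3. ?k l s1 s2 s3 x y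
        \<partial>lborel) \<partial>lborel) \<partial>lborel) \<partial>lborel)"
      by (simp only:)
    also have "\<dots> = ennreal (\<rho> powr (-3/2)) * (ennreal ((\<alpha> * \<delta>) ^ 3) * (\<integral>\<^sup>+l.
       (\<integral>\<^sup>+s1. (\<integral>\<^sup>+s2. (\<integral>\<^sup>+s3. ?k l s1 s2 s3 x y
        \<partial>lborel) \<partial>lborel) \<partial>lborel) \<partial>lborel))"
      by (rule arg_cong[where f = "\<lambda>u. ennreal (\<rho> powr (-3/2)) * u"], rule nn_integral_cmult) measurable
    also have "\<dots> = (\<integral>\<^sup>+l. (\<integral>\<^sup>+s1. (\<integral>\<^sup>+s2. (\<integral>\<^sup>+s3. ?k l s1 s2 s3 x y \<partial>lborel) \<partial>lborel) \<partial>lborel) \<partial>lborel)"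
    proof -
      have "ennreal (\<rho> powr (-3/2)) * (ennreal ((\<alpha> * \<delta>) ^ 3) * X) = X" for X
        using powr pos by (simp only: mult.assoc[symmetric] ennreal_mult[symmetric] powr_ge_zero
            zero_le_power mult_nonneg_nonneg less_imp_le ennreal_1 mult_1_left)
      then show ?thesis .
    qed
    finally show "(\<integral>\<^sup>+l. (\<integral>\<^sup>+s1. (\<integral>\<^sup>+s2. (\<integral>\<^sup>+s3. ?k l s1 s2 s3 x y \<partial>lborel) \<partial>lborel) \<partial>lborel) \<partial>lborel) = ennreal ((1 + x\<^sup>2 + y\<^sup>2) powr (-3/2)) *
      (\<integral>\<^sup>+l. (\<integral>\<^sup>+r. (\<integral>\<^sup>+s. (\<integral>\<^sup>+t. k (l, r + t, r * t - s\<^sup>2) \<partial>lborel) \<partial>lborel) \<partial>lborel) \<partial>lborel)"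
      unfolding \<rho>_def ..
  qed
  also have "\<dots> = (\<integral>\<^sup>+x. (\<integral>\<^sup>+y. ennreal ((1 + x\<^sup>2 + y\<^sup>2) powr (-3/2)) \<partial>lborel) *
      (\<integral>\<^sup>+l. (\<integral>\<^sup>+r. (\<integral>\<^sup>+s. (\<integral>\<^sup>+t. k (l, r + t, r * t - s\<^sup>2) \<partial>lborel) \<partial>lborel) \<partial>lborel) \<partial>lborel) \<partial>lborel)"
    by (rule nn_integral_cong, rule nn_integral_multc) measurable
  also have "\<dots> = (\<integral>\<^sup>+x. (\<integral>\<^sup>+y. ennreal ((1 + x\<^sup>2 + y\<^sup>2) powr (-3/2)) \<partial>lborel) \<partial>lborel) *
      (\<integral>\<^sup>+l. (\<integral>\<^sup>+r. (\<integral>\<^sup>+s. (\<integral>\<^sup>+t. k (l, r + t, r * t - s\<^sup>2) \<partial>lborel) \<partial>lborel) \<partial>lborel) \<partial>lborel)"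
    by (rule nn_integral_multc) measurable
  also have "\<dots> = ennreal (2 * pi) * (\<integral>\<^sup>+l. ennreal (2 * pi) *
      (\<integral>\<^sup>+\<mu>. (\<integral>\<^sup>+\<tau>. k (l, 2 * \<mu>, \<mu>\<^sup>2 - \<tau>) * indicator {0<..} \<tau> \<partial>lborel) \<partial>lborel) \<partial>lborel)"
    unfolding nn_integral_one_plus_norm_square_powr
  proof (rule arg_cong[where f = "\<lambda>u. ennreal (2 * pi) * u"], rule nn_integral_cong)
    fix l
    show "(\<integral>\<^sup>+r. (\<integral>\<^sup>+s. (\<integral>\<^sup>+t. k (l, r + t, r * t - s\<^sup>2) \<partial>lborel) \<partial>lborel) \<partial>lborel) = ennreal (2 * pi) *
      (\<integral>\<^sup>+\<mu>. (\<integral>\<^sup>+\<tau>. k (l, 2 * \<mu>, \<mu>\<^sup>2 - \<tau>) * indicator {0<..} \<tau> \<partial>lborel) \<partial>lborel)"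
      by (rule nn_integral_sym2_trace_det[where f = "\<lambda>p. k (l, p)"]) measurable
  qed
  also have "\<dots> = ennreal (2 * pi) * (ennreal (2 * pi) * (\<integral>\<^sup>+l.
      (\<integral>\<^sup>+\<mu>. (\<integral>\<^sup>+\<tau>. k (l, 2 * \<mu>, \<mu>\<^sup>2 - \<tau>) * indicator {0<..} \<tau> \<partial>lborel) \<partial>lborel) \<partial>lborel))"
    by (rule arg_cong[where f = "\<lambda>u. ennreal (2 * pi) * u"], rule nn_integral_cmult) measurable
  also have "\<dots> = ennreal (4 * pi\<^sup>2) * (\<integral>\<^sup>+l.
      (\<integral>\<^sup>+\<mu>. (\<integral>\<^sup>+\<tau>. k (l, 2 * \<mu>, \<mu>\<^sup>2 - \<tau>) * indicator {0<..} \<tau> \<partial>lborel) \<partial>lborel) \<partial>lborel)"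
  proof -
    have "ennreal (2 * pi) * ennreal (2 * pi) = ennreal (4 * pi\<^sup>2)"
      by (subst ennreal_mult[symmetric]) (auto simp: power2_eq_square)
    then show ?thesis by (simp only: mult.assoc[symmetric])
  qed
  finally show ?thesis .
qed

section \<open>The function \<open>f\<close> as an integral\<close>

lemma has_real_derivative_erf: "(erf has_real_derivative 2 / sqrt pi * exp (- z\<^sup>2)) (at z)"
proof -
  \<comment> \<open>An interval that contains 0 and has z in its interior whatever the sign of
    z.\<close>
  let ?a = "- \<bar>z\<bar> - 1" and ?b = "\<bar>z\<bar> + 1"
  have "((\<lambda>u. LBINT t=ereal 0..ereal u. exp (- (t\<^sup>2))) has_vector_derivative exp (- z\<^sup>2)) (at z within {?a..?b})"
    by (rule interval_integral_FTC2) (auto intro!: continuous_intros)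
  then have "((\<lambda>u. LBINT t=ereal 0..ereal u. exp (- (t\<^sup>2))) has_real_derivative exp (- z\<^sup>2)) (at z within {?a..?b})"
    by (simp add: has_real_derivative_iff_has_vector_derivative)
  moreover have "at z within {?a..?b} = at z"
    by (rule at_within_interior) (auto simp: interior_atLeastAtMost_real)
  ultimately have "((\<lambda>u. LBINT t=ereal 0..ereal u. exp (- (t\<^sup>2))) has_real_derivative exp (- z\<^sup>2)) (at z)"
    by simp
  then show ?thesis
    unfolding erf_def[abs_def] zero_ereal_def by (rule DERIV_cmult)
qed

lemma erf_0 [simp]: "erf 0 = 0"
  by (simp add: erf_def zero_ereal_def[symmetric])

text \<open>The constant \<open>r\<close> normalises exp (- (5/2) u^2), the Gaussian of variance
  1/5. Keeping it as a symbol leaves identities between primitives polynomial in u, x, r and a few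
  exponentials.\<close>

context
  fixes r :: real
  defines "r \<equiv> sqrt (5 / (2 * pi))"
begin

lemma has_real_derivative_erf_1:
  "((\<lambda>u. erf (sqrt (5/2) * u)) has_real_derivative 2 * r * exp (- (5/2) * u\<^sup>2)) (at u)"
proof -
  have "((\<lambda>u. erf (sqrt (5/2) * u)) has_real_derivative 2 / sqrt pi * exp (- (sqrt (5/2) * u)\<^sup>2) * (sqrt (5/2) * 1)) (at u)"
    by (rule DERIV_chain2[OF has_real_derivative_erf]) (auto intro!: derivative_eq_intros)
  also have "2 / sqrt pi * exp (- (sqrt (5/2) * u)\<^sup>2) * (sqrt (5/2) * 1) = 2 * (sqrt (5/2) / sqrt pi) * exp (- (5/2) * u\<^sup>2)"
  proof -
    have "(sqrt (5/2) * u)\<^sup>2 = 5/2 * u\<^sup>2" by (subst power_mult_distrib) simp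
    then show ?thesis by (simp only: minus_mult_left) simp
  qed
  also have "sqrt (5/2) / sqrt pi = r" by (simp add: r_def real_sqrt_divide real_sqrt_mult)
  finally show ?thesis .
qed

lemma has_real_derivative_erf_2:
  "((\<lambda>u. erf (sqrt 10 * u)) has_real_derivative 4 * r * exp (- 10 * u\<^sup>2)) (at u)"
proof -
  have r: "sqrt 10 / sqrt pi = 2 * r"
  proof -
    have "2 * r = sqrt 4 * sqrt (5 / (2 * pi))" by (simp add: r_def)
    also have "\<dots> = sqrt (10 / pi)" by (subst real_sqrt_mult[symmetric]) simp
    finally show ?thesis by (simp add: real_sqrt_divide)
  qed
  have "((\<lambda>u. erf (sqrt 10 * u)) has_real_derivative 2 / sqrt pi * exp (- (sqrt 10 * u)\<^sup>2) * (sqrt 10 * 1)) (at u)"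
    by (rule DERIV_chain2[OF has_real_derivative_erf]) (auto intro!: derivative_eq_intros)
  also have "2 / sqrt pi * exp (- (sqrt 10 * u)\<^sup>2) * (sqrt 10 * 1) = 2 * (sqrt 10 / sqrt pi) * exp (- 10 * u\<^sup>2)"
    by (simp add: power_mult_distrib)
  finally show ?thesis by (simp add: r)
qed

text \<open>Repeated integration by parts: for a quadratic p and rate a = 15/2, a primitive of p exp
  (- a t) is - exp (- a t) (p / a + p' / a^2 + p'' / a^3). This explains 2/15, 4/225 and 16/3375 = 2
  / a^3.\<close>

definition gamma_primitive :: "real \<Rightarrow> real \<Rightarrow> real \<Rightarrow> real" where
  "gamma_primitive A B t =
    - exp (- (15/2) * t) * ((A - t) * (B - t) * (2/15) + (2 * t - A - B) * (4/225) + 16/3375)"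

lemma nn_integral_gamma_primitive:
  assumes T: "0 \<le> T" "T \<le> A" "T \<le> B"
  shows "(\<integral>\<^sup>+t. (if 0 < t \<and> t < T then ennreal ((A - t) * (B - t) * exp (- (15/2) * t)) else 0) \<partial>lborel)
      = ennreal (gamma_primitive A B T - gamma_primitive A B 0)" (is "?L = _")
    and "gamma_primitive A B 0 \<le> gamma_primitive A B T"
proof -
  let ?g = "\<lambda>t. (A - t) * (B - t) * exp (- (15/2) * t)"
  have deriv: "(gamma_primitive A B has_real_derivative ?g t) (at t)" for t
    unfolding gamma_primitive_def[abs_def]
    by (rule derivative_eq_intros refl)+ (simp add: field_simps)
  have nonneg: "0 \<le> ?g t" if "0 \<le> t" "t \<le> T" for t
    using that T by (intro mult_nonneg_nonneg) auto
  have "?L = (\<integral>\<^sup>+t. ennreal (?g t) * indicator {0..T} t \<partial>lborel)"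
    by (rule nn_integral_cong_AE, use AE_lborel_singleton[of "0::real"] AE_lborel_singleton[of T] in eventually_elim)
      (auto simp: indicator_def)
  also have "\<dots> = ennreal (gamma_primitive A B T - gamma_primitive A B 0)"
    by (rule nn_integral_FTC_Icc) (use deriv nonneg T in auto)
  finally show "?L = \<dots>" .
  show "gamma_primitive A B 0 \<le> gamma_primitive A B T"
    using DERIV_nonneg_imp_nondecreasing[OF T(1), of "gamma_primitive A B"] deriv nonneg by blast
qed

text \<open>The bound on \<open>t\<close> is \<open>u\<^sup>2\<close> for \<open>u \<le> x / 4\<close> and \<open>((x - u) / 3)\<^sup>2\<close> beyond; \<open>A1\<close> and \<open>A2\<close> are the
  primitives on the two pieces.\<close>

lemma nn_integral_peak_f:
  assumes x: "0 < x"
  shows "(\<integral>\<^sup>+u. (\<integral>\<^sup>+t. (if 0 < u \<and> u < x \<and> 0 < t \<and> t < u\<^sup>2 \<and> t < ((x - u) / 3)\<^sup>2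
      then ennreal (2025 / 2 * r * ((u\<^sup>2 - t) * (x + 2 * u) * (((x - u) / 3)\<^sup>2 - t) * exp (- (5/2) * (u\<^sup>2 + 3 * t))))
      else 0) \<partial>lborel) \<partial>lborel) = ennreal (peak_f x)" (is "?L = _")
    and "0 \<le> peak_f x"
proof -
  let ?h = "\<lambda>u t. 2025 / 2 * r * ((u\<^sup>2 - t) * (x + 2 * u) * (((x - u) / 3)\<^sup>2 - t) * exp (- (5/2) * (u\<^sup>2 + 3 * t)))"
  let ?dom = "\<lambda>u t. 0 < u \<and> u < x \<and> 0 < t \<and> t < u\<^sup>2 \<and> t < ((x - u) / 3)\<^sup>2"
  define m where "m u = (x - u) / 3" for u
  \<comment> \<open>The part of the integrand that does not depend on t; the rest is the integrand
    of \<open>gamma_primitive\<close> at u^2 and (m u)^2.\<close>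
  define c where "c u = 2025 / 2 * r * (x + 2 * u) * exp (- (5/2) * u\<^sup>2)" for u
  define P where "P u = gamma_primitive (u\<^sup>2) ((m u)\<^sup>2)" for u
  have r0: "r > 0" by (simp add: r_def)
  have c0: "0 \<le> c u" if "0 \<le> u" for u
    using that x r0 by (auto simp: c_def intro!: mult_nonneg_nonneg)
  have inner: "(\<integral>\<^sup>+t. (if ?dom u t then ennreal (?h u t) else 0) \<partial>lborel) = (if 0 < u \<and> u < x then ennreal (c u * (P u (min (u\<^sup>2) ((m u)\<^sup>2)) - P u 0)) else 0)" for u
  proof (cases "0 < u \<and> u < x")
    case True
    define T where "T = min (u\<^sup>2) ((m u)\<^sup>2)"
    have T: "0 \<le> T" "T \<le> u\<^sup>2" "T \<le> (m u)\<^sup>2" by (auto simp: T_def)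
    have e: "?h u t
      = c u * ((u\<^sup>2 - t) * ((m u)\<^sup>2 - t) * exp (- (15/2) * t))" for t
    proof -
      have "exp (- (5/2) * (u\<^sup>2 + 3 * t)) = exp (- (5/2) * u\<^sup>2) * exp (- (15/2) * t)"
        by (simp add: exp_add[symmetric] algebra_simps)
      then show ?thesis by (simp only: c_def m_def) (simp only: ac_simps)
    qed
    have "(\<integral>\<^sup>+t. (if ?dom u t then ennreal (?h u t) else 0) \<partial>lborel)
      = (\<integral>\<^sup>+t. ennreal (c u) * (if 0 < t \<and> t < T then ennreal ((u\<^sup>2 - t) * ((m u)\<^sup>2 - t) * exp (- (15/2) * t)) else 0) \<partial>lborel)"
      unfolding e using True c0[of u]
      by (intro nn_integral_cong) (auto simp: T_def m_def[symmetric] ennreal_mult')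
    also have "\<dots> = ennreal (c u) * (\<integral>\<^sup>+t. (if 0 < t \<and> t < T then ennreal ((u\<^sup>2 - t) * ((m u)\<^sup>2 - t) * exp (- (15/2) * t)) else 0) \<partial>lborel)"
      by (rule nn_integral_cmult) measurable
    also have "\<dots> = ennreal (c u) * ennreal (P u T - P u 0)"
      unfolding P_def by (subst nn_integral_gamma_primitive[OF T]) simp
    also have "\<dots> = ennreal (c u * (P u T - P u 0))"
      using True c0[of u] nn_integral_gamma_primitive(2)[OF T] by (subst ennreal_mult) (auto simp: P_def)
    finally show ?thesis using True by (simp add: T_def)
  next
    case False
    then consider "\<not> 0 < u" | "\<not> u < x" by blast
    then show ?thesis by cases simp_all
  qed
  \<comment> \<open>The coefficients match the integrand after differentiation of polynomials times
    exponentials plus error functions. The end t = 0 yields exp (- (5/2) u^2) on both pieces, hence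
    the shared \<open>p1\<close>. The upper end t = u^2 yields exp (- 10 u^2), as 5/2 + 15/2 = 10,
    and t = ((x - u)/3)^2 yields exp (- (5/2) u^2 - (5/6) (x - u)^2), whose part integrates without
    an error function.\<close>
  define p1 where "p1 u = -16/25 + (39/5 * x - 3 * x^3) * u + 16/5 * u^2 + 9 * x * u^3 - 6 * u^4" for u
  define A1 where "A1 u = r * (p1 u * exp (- (5/2) * u\<^sup>2) - (-16/25 - 6/5 * x * u - 8/5 * u^2) * exp (- 10 * u\<^sup>2))
    + (x^3 - 3 * x) / 2 * (erf (sqrt (5/2) * u) + erf (sqrt 10 * u))" for u
  define A2 where "A2 u = r * (p1 u * exp (- (5/2) * u\<^sup>2) - 6/5 * (x + 2 * u)^2 * exp (- (5/2) * u\<^sup>2 - 5/6 * (x - u)\<^sup>2))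
    + (x^3 - 3 * x) / 2 * erf (sqrt (5/2) * u)" for u
  note DERIV = has_real_derivative_erf_1 has_real_derivative_erf_2
  have dp1: "(p1 has_real_derivative (39/5 * x - 3 * x^3) + 32/5 * u + 27 * x * u^2 - 24 * u^3) (at u)" for u
    unfolding p1_def[abs_def] by (auto intro!: derivative_eq_intros)
  have dA1: "(A1 has_real_derivative c u * (P u (u\<^sup>2) - P u 0)) (at u)" for u
  proof -
    define E1 where "E1 = exp (- (5/2) * u\<^sup>2)"
    define E2 where "E2 = exp (- 10 * u\<^sup>2)"
    have EE: "E1 * exp (- (15/2) * u\<^sup>2) = E2"
      unfolding E1_def E2_def by (simp add: exp_add[symmetric])
    have "(A1 has_real_derivative r * (((39/5 * x - 3 * x^3) + 32/5 * u + 27 * x * u^2 - 24 * u^3) * E1 + p1 u * (E1 * (- 5 * u))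
        - ((- 6/5 * x - 16/5 * u) * E2 + (-16/25 - 6/5 * x * u - 8/5 * u^2) * (E2 * (- 20 * u))))
        + (x^3 - 3 * x) / 2 * (2 * r * E1 + 4 * r * E2)) (at u)"
      unfolding A1_def[abs_def] E1_def E2_def
      by (auto intro!: derivative_eq_intros DERIV dp1)
    also have "r * (((39/5 * x - 3 * x^3) + 32/5 * u + 27 * x * u^2 - 24 * u^3) * E1 + p1 u * (E1 * (- 5 * u))
        - ((- 6/5 * x - 16/5 * u) * E2 + (-16/25 - 6/5 * x * u - 8/5 * u^2) * (E2 * (- 20 * u))))
        + (x^3 - 3 * x) / 2 * (2 * r * E1 + 4 * r * E2)
      = 2025 / 2 * r * (x + 2 * u) * (- E2 * ((u\<^sup>2 - (m u)\<^sup>2) * (4/225) + 16/3375)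
         + E1 * (u\<^sup>2 * (m u)\<^sup>2 * (2/15) + (- u\<^sup>2 - (m u)\<^sup>2) * (4/225) + 16/3375))"
      unfolding p1_def m_def by (simp add: field_simps power2_eq_square power3_eq_cube power4_eq_xxxx)
    also have "\<dots> = c u * (P u (u\<^sup>2) - P u 0)"
      unfolding c_def P_def gamma_primitive_def E1_def[symmetric] EE[symmetric]
      by (simp add: field_simps)
    finally show ?thesis .
  qed
  have dA2: "(A2 has_real_derivative c u * (P u ((m u)\<^sup>2) - P u 0)) (at u)" for u
  proof -
    define E1 where "E1 = exp (- (5/2) * u\<^sup>2)"
    define E3 where "E3 = exp (- (5/2) * u\<^sup>2 - 5/6 * (x - u)\<^sup>2)"
    have EE: "E1 * exp (- (15/2) * (m u)\<^sup>2) = E3"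
      unfolding E1_def E3_def m_def by (simp add: exp_add[symmetric] power_divide)
    have "(A2 has_real_derivative r * (((39/5 * x - 3 * x^3) + 32/5 * u + 27 * x * u^2 - 24 * u^3) * E1 + p1 u * (E1 * (- 5 * u))
        - (24/5 * (x + 2 * u) * E3 + 6/5 * (x + 2 * u)^2 * (E3 * (- 5 * u + 5/3 * (x - u)))))
        + (x^3 - 3 * x) / 2 * (2 * r * E1)) (at u)"
      unfolding A2_def[abs_def] E1_def E3_def
      by (auto intro!: derivative_eq_intros DERIV dp1) (simp add: field_simps)
    also have "r * (((39/5 * x - 3 * x^3) + 32/5 * u + 27 * x * u^2 - 24 * u^3) * E1 + p1 u * (E1 * (- 5 * u))
        - (24/5 * (x + 2 * u) * E3 + 6/5 * (x + 2 * u)^2 * (E3 * (- 5 * u + 5/3 * (x - u)))))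
        + (x^3 - 3 * x) / 2 * (2 * r * E1)
      = 2025 / 2 * r * (x + 2 * u) * (- E3 * (((m u)\<^sup>2 - u\<^sup>2) * (4/225) + 16/3375)
         + E1 * (u\<^sup>2 * (m u)\<^sup>2 * (2/15) + (- u\<^sup>2 - (m u)\<^sup>2) * (4/225) + 16/3375))"
      unfolding p1_def m_def by (simp add: field_simps power2_eq_square power3_eq_cube power4_eq_xxxx)
    also have "\<dots> = c u * (P u ((m u)\<^sup>2) - P u 0)"
      unfolding c_def P_def gamma_primitive_def E1_def[symmetric] EE[symmetric]
      by (simp add: field_simps)
    finally show ?thesis .
  qed
  have mu1: "min (u\<^sup>2) ((m u)\<^sup>2) = u\<^sup>2" if "0 \<le> u" "u \<le> x / 4" for u
    using that by (intro min_absorb1 power_mono) (auto simp: m_def)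
  have mu2: "min (u\<^sup>2) ((m u)\<^sup>2) = (m u)\<^sup>2" if "x / 4 \<le> u" "u \<le> x" for u
    using that by (intro min_absorb2 power_mono) (auto simp: m_def)
  have nn1: "0 \<le> c u * (P u (u\<^sup>2) - P u 0)" if "0 \<le> u" "u \<le> x / 4" for u
    using nn_integral_gamma_primitive(2)[of "u\<^sup>2" "u\<^sup>2" "(m u)\<^sup>2"] mu1[OF that] c0[OF that(1)]
    by (auto simp: P_def min_def split: if_splits intro!: mult_nonneg_nonneg)
  have nn2: "0 \<le> c u * (P u ((m u)\<^sup>2) - P u 0)" if "x / 4 \<le> u" "u \<le> x" for u
    using nn_integral_gamma_primitive(2)[of "(m u)\<^sup>2" "u\<^sup>2" "(m u)\<^sup>2"] mu2[OF that] c0[of u] that x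
    by (auto simp: P_def min_def split: if_splits intro!: mult_nonneg_nonneg)
  have [measurable]: "(\<lambda>u. c u * (P u (u\<^sup>2) - P u 0)) \<in> borel_measurable borel"
    "(\<lambda>u. c u * (P u ((m u)\<^sup>2) - P u 0)) \<in> borel_measurable borel"
    unfolding c_def P_def m_def gamma_primitive_def by measurable
  have "?L = (\<integral>\<^sup>+u. (if 0 < u \<and> u < x then ennreal (c u * (P u (min (u\<^sup>2) ((m u)\<^sup>2)) - P u 0)) else 0) \<partial>lborel)"
    unfolding inner ..
  also have "\<dots> = (\<integral>\<^sup>+u. ennreal (c u * (P u (u\<^sup>2) - P u 0)) * indicator {0..x/4} u +
      ennreal (c u * (P u ((m u)\<^sup>2) - P u 0)) * indicator {x/4..x} u \<partial>lborel)"
    by (rule nn_integral_cong_AE, use AE_lborel_singleton[of "0::real"] AE_lborel_singleton[of "x/4"]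
        AE_lborel_singleton[of x] in eventually_elim)
      (use x mu1 mu2 in \<open>auto simp: indicator_def\<close>)
  also have "\<dots> = (\<integral>\<^sup>+u. ennreal (c u * (P u (u\<^sup>2) - P u 0)) * indicator {0..x/4} u \<partial>lborel) +
      (\<integral>\<^sup>+u. ennreal (c u * (P u ((m u)\<^sup>2) - P u 0)) * indicator {x/4..x} u \<partial>lborel)"
    by (rule nn_integral_add) auto
  also have "(\<integral>\<^sup>+u. ennreal (c u * (P u (u\<^sup>2) - P u 0)) * indicator {0..x/4} u \<partial>lborel) = ennreal (A1 (x/4) - A1 0)"
    by (rule nn_integral_FTC_Icc) (use dA1 nn1 x in auto)
  also have "(\<integral>\<^sup>+u. ennreal (c u * (P u ((m u)\<^sup>2) - P u 0)) * indicator {x/4..x} u \<partial>lborel) = ennreal (A2 x - A2 (x/4))"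
    by (rule nn_integral_FTC_Icc) (use dA2 nn2 x in auto)
  finally have L: "?L = ennreal (A1 (x/4) - A1 0) + ennreal (A2 x - A2 (x/4))" .
  \<comment> \<open>Nonnegative increments allow the two extended terms to be added as reals. They
    also give \<open>0 \<le> peak_f x\<close>, which the closed form does not reveal.\<close>
  have "A1 0 \<le> A1 (x/4)"
  proof (rule DERIV_nonneg_imp_nondecreasing[of 0 "x/4" A1])
    show "\<exists>d. (A1 has_real_derivative d) (at u) \<and> 0 \<le> d" if "0 \<le> u" "u \<le> x/4" for u
      using dA1 nn1[OF that] by blast
  qed (use x in simp)
  moreover have "A2 (x/4) \<le> A2 x"
  proof (rule DERIV_nonneg_imp_nondecreasing[of "x/4" x A2])
    show "\<exists>d. (A2 has_real_derivative d) (at u) \<and> 0 \<le> d" if "x/4 \<le> u" "u \<le> x" for u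
      using dA2 nn2[OF that] by blast
  qed (use x in simp)
  moreover have "A1 (x/4) - A1 0 + (A2 x - A2 (x/4)) = peak_f x"
  proof -
    have s: "sqrt (2 / (5 * pi)) = 2/5 * r"
    proof -
      have "2/5 * r = sqrt (4/25) * sqrt (5 / (2 * pi))" by (simp add: r_def real_sqrt_divide)
      also have "\<dots> = sqrt (2 / (5 * pi))" by (subst real_sqrt_mult[symmetric]) (simp add: field_simps)
      finally show ?thesis ..
    qed
    have e10: "sqrt 10 * (x / 4) = sqrt (5/2) * (x / 2)"
    proof -
      have "sqrt 10 = sqrt 4 * sqrt (5/2)" by (subst real_sqrt_mult[symmetric]) simp
      then show ?thesis by simp
    qed
    define F1 where "F1 = exp (- 5 * x\<^sup>2 / 8)"
    define F2 where "F2 = exp (- 5 * x\<^sup>2 / 2)"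
    have ex1: "exp (- 10 * (x/4)\<^sup>2) = F1" "exp (- (5/2) * (x/4)\<^sup>2 - 5/6 * (x - x/4)\<^sup>2) = F1"
      by (simp_all add: F1_def field_simps power2_eq_square)
    have ex2: "exp (- (5/2) * x\<^sup>2) = F2" "exp (- (5/2) * x\<^sup>2 - 5/6 * (x - x)\<^sup>2) = F2"
      by (simp_all add: F2_def)
    have A10: "A1 0 = 0" by (simp add: A1_def p1_def)
    \<comment> \<open>At the break point \<open>p1\<close> and the error function common to
      \<open>A1\<close> and \<open>A2\<close> cancel, and the other two exponentials agree. What is
      left are the terms of \<open>peak_f\<close> with exp (- 5 x^2 / 8) and with x / 2 inside the
      error function.\<close>
    have "A1 (x/4) - A2 (x/4) = r * ((31/10 * x\<^sup>2 + 16/25) * F1) + (x^3 - 3 * x) / 2 * erf (sqrt (5/2) * (x / 2))"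
      unfolding A1_def A2_def ex1 e10 by (simp add: field_simps power2_eq_square)
    moreover have "A2 x = r * ((x\<^sup>2 / 5 - 16/25) * F2) + (x^3 - 3 * x) / 2 * erf (sqrt (5/2) * x)"
      unfolding A2_def ex2 p1_def by (simp add: field_simps power2_eq_square power3_eq_cube power4_eq_xxxx)
    moreover have "peak_f x = (x ^ 3 - 3 * x) / 2 * (erf (sqrt (5 / 2) * x) + erf (sqrt (5 / 2) * (x / 2)))
     + 2/5 * r * ((31 * x ^ 2 / 4 + 8 / 5) * F1 + (x ^ 2 / 2 - 8 / 5) * F2)"
      unfolding peak_f_def s F1_def F2_def ..
    ultimately show ?thesis using A10 by (simp add: algebra_simps)
  qed
  ultimately show "?L = ennreal (peak_f x)" "0 \<le> peak_f x"
    unfolding L by (auto simp: ennreal_plus[symmetric] simp del: ennreal_plus)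
qed

end

section \<open>Positive definiteness\<close>

lemma det_sym_matrix:
  "det (sym_matrix (a, b, c, d, e, f)) = a * (d * f - e\<^sup>2) - b * (b * f - c * e) + c * (b * e - c * d)"
  by (simp add: det_3 vector_3 algebra_simps power2_eq_square)

lemma sym_matrix_quadratic_form:
  "v \<bullet> (sym_matrix (a, b, c, d, e, f) *v v) = a * (v$1)\<^sup>2 + d * (v$2)\<^sup>2 + f * (v$3)\<^sup>2
    + 2 * b * v$1 * v$2 + 2 * c * v$1 * v$3 + 2 * e * v$2 * v$3"
  by (simp add: inner_vec_def sum_3 matrix_vector_mult_def vector_3 algebra_simps power2_eq_square)

lemma transpose_sym_matrix: "transpose (sym_matrix h) = sym_matrix h"
  by (cases h) (simp add: transpose_def vec_eq_iff forall_3 vector_3)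

text \<open>A criterion through e1, e2, e3 rather than leading minors keeps the domain of
  integration a function of the spectrum alone, as the reduction requires. The proof stays
  elementary: test vectors in one direction, the upper left 2x2 block and completed squares in the
  other.\<close>

lemma sym_matrix_pos_def_iff:
  defines "e3 \<equiv> \<lambda>a b c d e f. a * (d * f - e\<^sup>2) - b * (b * f - c * e) + c * (b * e - c * d) :: real"
  shows "sym_matrix (a, b, c, d, e, f) \<in> pos_def_matrices \<longleftrightarrow>
    0 < a + d + f \<and> 0 < (a * d - b\<^sup>2) + (a * f - c\<^sup>2) + (d * f - e\<^sup>2) \<and> 0 < e3 a b c d e f"
    (is "?L \<longleftrightarrow> ?R")
proof
  define Q where "Q x y z = a * x\<^sup>2 + d * y\<^sup>2 + f * z\<^sup>2 + 2 * b * x * y + 2 * c * x * z + 2 * e * y * z" for x y z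
  define D where "D = a * d - b\<^sup>2"
  {
    assume L: ?L
    have Q: "0 < Q x y z" if "x \<noteq> 0 \<or> y \<noteq> 0 \<or> z \<noteq> 0" for x y z
    proof -
      have "(vector [x, y, z] :: real^3) \<noteq> 0"
        using that by (auto simp: vec_eq_iff forall_3 vector_3)
      then show ?thesis
        using L unfolding pos_def_matrices_def Q_def
        by (auto simp only: mem_Collect_eq sym_matrix_quadratic_form vector_3 dest!: spec[of _ "vector [x, y, z] :: real^3"])
    qed
    have diag: "a > 0" "d > 0" "f > 0" using Q[of 1 0 0] Q[of 0 1 0] Q[of 0 0 1] by (auto simp: Q_def)
    \<comment> \<open>The test vectors are, up to sign, last columns of adjugates: here of the three
      principal 2x2 blocks, and below of the whole matrix, which maps that column to e3 times the
      third unit vector.\<close>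
    have "Q b (-a) 0 = a * D" "Q c 0 (-a) = a * (a * f - c\<^sup>2)" "Q 0 e (-d) = d * (d * f - e\<^sup>2)"
      by (simp_all add: Q_def D_def algebra_simps power2_eq_square)
    then have minors: "D > 0" "a * f - c\<^sup>2 > 0" "d * f - e\<^sup>2 > 0"
      using Q[of b "-a" 0] Q[of c 0 "-a"] Q[of 0 e "-d"] diag by (auto simp: zero_less_mult_iff)
    have "Q (b * e - c * d) (b * c - a * e) D = D * e3 a b c d e f"
      unfolding Q_def D_def e3_def by (simp add: algebra_simps power2_eq_square)
    then have "e3 a b c d e f > 0"
      using Q[of "b * e - c * d" "b * c - a * e" D] minors by (auto simp: zero_less_mult_iff)
    then show ?R using diag minors by (auto simp: D_def)
  }
  {
    assume R: ?R
    \<comment> \<open>\<open>-t\<close> is the smaller eigenvalue of the upper left 2x2 block; if it were nonpositive, then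
      \<open>det (H + t)\<close> would be positive by its expansion in \<open>t\<close> and nonpositive since that block of
      \<open>H + t\<close> is singular and positive semidefinite.\<close>
    define r where "r = sqrt (((a - d) / 2)\<^sup>2 + b\<^sup>2)"
    define t where "t = r - (a + d) / 2"
    have r2: "r\<^sup>2 = ((a - d) / 2)\<^sup>2 + b\<^sup>2" by (simp add: r_def)
    have r0: "r \<ge> 0" by (simp add: r_def)
    have "r \<ge> \<bar>(a - d) / 2\<bar>" unfolding r_def by (rule real_le_rsqrt) (simp only: power2_abs, simp)
    then have at: "a + t \<ge> 0" "d + t \<ge> 0" by (auto simp: t_def abs_if field_simps split: if_splits)
    have atdt: "(a + t) * (d + t) = b\<^sup>2"
    proof -
      have "(a + t) * (d + t) = r\<^sup>2 - ((a - d) / 2)\<^sup>2"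
        by (simp add: t_def field_simps power2_eq_square)
      then show ?thesis by (simp add: r2)
    qed
    have "t < 0"
    proof (rule ccontr)
      assume "\<not> t < 0"
      have "t ^ 3 + (a + d + f) * t\<^sup>2 + ((a * d - b\<^sup>2) + (a * f - c\<^sup>2) + (d * f - e\<^sup>2)) * t + e3 a b c d e f > 0"
      proof -
        define e1 e2 where "e1 = a + d + f" and "e2 = (a * d - b\<^sup>2) + (a * f - c\<^sup>2) + (d * f - e\<^sup>2)"
        have "e1 > 0" "e2 > 0" using R by (auto simp: e1_def e2_def)
        then have "t ^ 3 \<ge> 0" "e1 * t\<^sup>2 \<ge> 0" "e2 * t \<ge> 0" using \<open>\<not> t < 0\<close> by simp_all
        then show ?thesis using R unfolding e1_def e2_def by linarith
      qed
      also have "t ^ 3 + (a + d + f) * t\<^sup>2 + ((a * d - b\<^sup>2) + (a * f - c\<^sup>2) + (d * f - e\<^sup>2)) * t + e3 a b c d e f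
        = (f + t) * ((a + t) * (d + t) - b\<^sup>2) - ((a + t) * e\<^sup>2 - 2 * b * c * e + (d + t) * c\<^sup>2)"
        unfolding e3_def by (simp add: algebra_simps power2_eq_square power3_eq_cube)
      finally have neg: "(a + t) * e\<^sup>2 - 2 * b * c * e + (d + t) * c\<^sup>2 < 0" by (simp add: atdt)
      have "(a + t) * ((a + t) * e\<^sup>2 - 2 * b * c * e + (d + t) * c\<^sup>2) = ((a + t) * e)\<^sup>2 - 2 * ((a + t) * e) * (b * c) + ((a + t) * (d + t)) * c\<^sup>2"
        by (simp add: algebra_simps power2_eq_square)
      also have "\<dots> = ((a + t) * e - b * c)\<^sup>2"
        unfolding atdt by (simp add: power2_diff power_mult_distrib)
      finally have "(a + t) * ((a + t) * e\<^sup>2 - 2 * b * c * e + (d + t) * c\<^sup>2) \<ge> 0" by simp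
      then have "a + t = 0" using neg at by (auto simp: zero_le_mult_iff)
      then have "b = 0" using atdt by simp
      then show False using neg at \<open>a + t = 0\<close> by (simp add: mult_less_0_iff)
    qed
    then have "r < (a + d) / 2" by (simp add: t_def)
    then have ad: "a + d > 0" using r0 by simp
    have "r\<^sup>2 < ((a + d) / 2)\<^sup>2" using \<open>r < (a + d) / 2\<close> r0 by (intro power_strict_mono) auto
    then have D: "D > 0" unfolding r2 D_def by (simp add: field_simps power2_eq_square)
    have "a * d > 0" using D zero_le_power2[of b] unfolding D_def by linarith
    then have a: "a > 0" using ad by (auto simp: zero_less_mult_iff)
    have Q: "0 < Q x y z" if nz: "x \<noteq> 0 \<or> y \<noteq> 0 \<or> z \<noteq> 0" for x y z
    proof -
      \<comment> \<open>Completion of squares along the leading minors a, D, e3, multiplied by a D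
        to avoid quotients.\<close>
      have id: "a * D * Q x y z = D * (a * x + b * y + c * z)\<^sup>2 + (D * y + (a * e - b * c) * z)\<^sup>2 + a * e3 a b c d e f * z\<^sup>2"
        unfolding Q_def D_def e3_def by (simp add: algebra_simps power2_eq_square)
      have nonneg: "0 \<le> D * (a * x + b * y + c * z)\<^sup>2" "0 \<le> (D * y + (a * e - b * c) * z)\<^sup>2"
        "0 \<le> a * e3 a b c d e f * z\<^sup>2"
        using a D R by auto
      have "a * D * Q x y z \<noteq> 0"
      proof
        assume "a * D * Q x y z = 0"
        then have "D * (a * x + b * y + c * z)\<^sup>2 = 0" "(D * y + (a * e - b * c) * z)\<^sup>2 = 0" "a * e3 a b c d e f * z\<^sup>2 = 0"
          using nonneg unfolding id by linarith+
        then show False using nz a D R by auto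
      qed
      moreover have "a * D * Q x y z \<ge> 0" unfolding id using nonneg by linarith
      ultimately have "a * D * Q x y z > 0" by linarith
      then show ?thesis using zero_less_mult_pos[of "a * D" "Q x y z"] a D by simp
    qed
    have "0 < v \<bullet> (sym_matrix (a, b, c, d, e, f) *v v)" if "v \<noteq> 0" for v
    proof -
      have "v$1 \<noteq> 0 \<or> v$2 \<noteq> 0 \<or> v$3 \<noteq> 0" using that by (auto simp: vec_eq_iff forall_3)
      from Q[OF this] show ?thesis unfolding sym_matrix_quadratic_form Q_def .
    qed
    then show ?L unfolding pos_def_matrices_def using transpose_sym_matrix by blast
  }
qed

section \<open>Rescaled variables and the integral over positive definite matrices\<close>

lemma nn_integral_affine_3:
  fixes K :: "real \<times> real \<times> real \<Rightarrow> ennreal"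
  assumes [measurable]: "K \<in> borel_measurable borel" and s: "0 < (s::real)"
  shows "(\<integral>\<^sup>+l. (\<integral>\<^sup>+\<mu>. (\<integral>\<^sup>+\<tau>. K (l, \<mu>, \<tau>) \<partial>lborel) \<partial>lborel) \<partial>lborel) = ennreal (s ^ 4 / 3) *
    (\<integral>\<^sup>+x. (\<integral>\<^sup>+u. (\<integral>\<^sup>+t. K (s * (x + 2 * u) / 3, s * u, s\<^sup>2 * t) \<partial>lborel) \<partial>lborel) \<partial>lborel)"
proof -
  \<comment> \<open>The trace is 3 l - 2 \<mu>. Measuring \<mu> and the trace in units of s and
    \<tau> in units of s^2 gives l = s (x + 2 u) / 3, so \<mu> is rescaled first and l is
    substituted for fixed u. The Jacobian is s (s/3) s^2.\<close>
  have "(\<integral>\<^sup>+l. (\<integral>\<^sup>+\<mu>. (\<integral>\<^sup>+\<tau>. K (l, \<mu>, \<tau>) \<partial>lborel) \<partial>lborel) \<partial>lborel)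
    = (\<integral>\<^sup>+\<mu>. (\<integral>\<^sup>+l. (\<integral>\<^sup>+\<tau>. K (l, \<mu>, \<tau>) \<partial>lborel) \<partial>lborel) \<partial>lborel)"
    by (rule nn_integral_lborel_swap) measurable
  also have "\<dots> = ennreal \<bar>s\<bar> * (\<integral>\<^sup>+u. (\<integral>\<^sup>+l. (\<integral>\<^sup>+\<tau>. K (l, 0 + s * u, \<tau>) \<partial>lborel) \<partial>lborel) \<partial>lborel)"
    using s by (intro nn_integral_real_affine) auto
  also have "(\<integral>\<^sup>+u. (\<integral>\<^sup>+l. (\<integral>\<^sup>+\<tau>. K (l, 0 + s * u, \<tau>) \<partial>lborel) \<partial>lborel) \<partial>lborel)
    = (\<integral>\<^sup>+u. ennreal \<bar>s / 3\<bar> * (\<integral>\<^sup>+x. (\<integral>\<^sup>+\<tau>. K (s * 2 * u / 3 + s / 3 * x, 0 + s * u, \<tau>) \<partial>lborel) \<partial>lborel) \<partial>lborel)"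
    by (rule nn_integral_cong, rule nn_integral_real_affine) (use s in auto)
  also have "\<dots> = ennreal \<bar>s / 3\<bar> * (\<integral>\<^sup>+u. (\<integral>\<^sup>+x. (\<integral>\<^sup>+\<tau>. K (s * 2 * u / 3 + s / 3 * x, 0 + s * u, \<tau>) \<partial>lborel) \<partial>lborel) \<partial>lborel)"
    by (rule nn_integral_cmult) measurable
  also have "(\<integral>\<^sup>+u. (\<integral>\<^sup>+x. (\<integral>\<^sup>+\<tau>. K (s * 2 * u / 3 + s / 3 * x, 0 + s * u, \<tau>) \<partial>lborel) \<partial>lborel) \<partial>lborel)
    = (\<integral>\<^sup>+u. (\<integral>\<^sup>+x. ennreal \<bar>s\<^sup>2\<bar> * (\<integral>\<^sup>+t. K (s * 2 * u / 3 + s / 3 * x, 0 + s * u, 0 + s\<^sup>2 * t) \<partial>lborel) \<partial>lborel) \<partial>lborel)"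
    by (rule nn_integral_cong, rule nn_integral_cong, rule nn_integral_real_affine) (use s in auto)
  also have "\<dots> = (\<integral>\<^sup>+u. ennreal \<bar>s\<^sup>2\<bar> * (\<integral>\<^sup>+x. (\<integral>\<^sup>+t. K (s * 2 * u / 3 + s / 3 * x, 0 + s * u, 0 + s\<^sup>2 * t) \<partial>lborel) \<partial>lborel) \<partial>lborel)"
    by (rule nn_integral_cong, rule nn_integral_cmult) measurable
  also have "\<dots> = ennreal \<bar>s\<^sup>2\<bar> * (\<integral>\<^sup>+u. (\<integral>\<^sup>+x. (\<integral>\<^sup>+t. K (s * 2 * u / 3 + s / 3 * x, 0 + s * u, 0 + s\<^sup>2 * t) \<partial>lborel) \<partial>lborel) \<partial>lborel)"
    by (rule nn_integral_cmult) measurable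
  also have "(\<integral>\<^sup>+u. (\<integral>\<^sup>+x. (\<integral>\<^sup>+t. K (s * 2 * u / 3 + s / 3 * x, 0 + s * u, 0 + s\<^sup>2 * t) \<partial>lborel) \<partial>lborel) \<partial>lborel)
    = (\<integral>\<^sup>+x. (\<integral>\<^sup>+u. (\<integral>\<^sup>+t. K (s * 2 * u / 3 + s / 3 * x, 0 + s * u, 0 + s\<^sup>2 * t) \<partial>lborel) \<partial>lborel) \<partial>lborel)"
    by (rule nn_integral_lborel_swap) measurable
  finally have "(\<integral>\<^sup>+l. (\<integral>\<^sup>+\<mu>. (\<integral>\<^sup>+\<tau>. K (l, \<mu>, \<tau>) \<partial>lborel) \<partial>lborel) \<partial>lborel)
    = (ennreal \<bar>s\<bar> * (ennreal \<bar>s / 3\<bar> * ennreal \<bar>s\<^sup>2\<bar>)) *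
      (\<integral>\<^sup>+x. (\<integral>\<^sup>+u. (\<integral>\<^sup>+t. K (s * 2 * u / 3 + s / 3 * x, 0 + s * u, 0 + s\<^sup>2 * t) \<partial>lborel) \<partial>lborel) \<partial>lborel)"
    by (simp only: mult.assoc)
  also have "ennreal \<bar>s\<bar> * (ennreal \<bar>s / 3\<bar> * ennreal \<bar>s\<^sup>2\<bar>) = ennreal (s ^ 4 / 3)"
    using s by (simp add: ennreal_mult[symmetric]) (simp add: power2_eq_square power4_eq_xxxx)
  finally have "(\<integral>\<^sup>+l. (\<integral>\<^sup>+\<mu>. (\<integral>\<^sup>+\<tau>. K (l, \<mu>, \<tau>) \<partial>lborel) \<partial>lborel) \<partial>lborel) = ennreal (s ^ 4 / 3) *
      (\<integral>\<^sup>+x. (\<integral>\<^sup>+u. (\<integral>\<^sup>+t. K (s * 2 * u / 3 + s / 3 * x, 0 + s * u, 0 + s\<^sup>2 * t) \<partial>lborel) \<partial>lborel) \<partial>lborel)" .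
  moreover have "s * 2 * u / 3 + s / 3 * x = s * (x + 2 * u) / 3" for u x
    by (simp add: field_simps)
  ultimately show ?thesis by (simp only: add_0)
qed

text \<open>The lower eigenvalues are m plus and minus the root of \<tau>, and the assumptions place
  l above both. Positivity of all three therefore reduces to that of the smallest one.\<close>

lemma eigenvalues_positive_iff:
  fixes l m \<mu> \<tau> :: real
  assumes "m = l - \<mu>" "0 < \<mu>" "0 < \<tau>" "\<tau> < \<mu>\<^sup>2"
  shows "0 < l + 2 * m \<and> 0 < 2 * l * m + (m\<^sup>2 - \<tau>) \<and> 0 < l * (m\<^sup>2 - \<tau>) \<longleftrightarrow> 0 < m \<and> \<tau> < m\<^sup>2" (is "?L \<longleftrightarrow> ?R")
proof
  assume R: ?R
  then have "l > 0" using assms by simp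
  then show ?L using R by (auto intro!: add_pos_pos mult_pos_pos)
next
  assume L: ?L
  \<comment> \<open>A positive product l (m^2 - \<tau>) could also come from two negative factors.
    Then m = l - \<mu> < - \<mu>, so m^2 exceeds \<mu>^2 and hence \<tau>, a contradiction.\<close>
  have l: "l > 0 \<and> \<tau> < m\<^sup>2"
  proof (rule ccontr)
    assume "\<not> (l > 0 \<and> \<tau> < m\<^sup>2)"
    with L have "l < 0" "m\<^sup>2 < \<tau>" by (auto simp: zero_less_mult_iff)
    then have "\<mu>\<^sup>2 < (- m)\<^sup>2" using assms by (intro power_strict_mono) auto
    then have "\<mu>\<^sup>2 < m\<^sup>2" by (simp only: power2_minus)
    then show False using \<open>m\<^sup>2 < \<tau>\<close> assms(4) by linarith
  qed
  moreover have "m > 0"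
  proof (rule ccontr)
    assume "\<not> m > 0"
    then have m: "m \<le> 0" by simp
    have "2 * l * m + m\<^sup>2 = m * (2 * l + m)" by (simp add: algebra_simps power2_eq_square)
    also have "\<dots> \<le> 0" using m L l by (intro mult_nonpos_nonneg) auto
    finally show False using L assms by auto
  qed
  ultimately show ?R by simp
qed

text \<open>The weight \<open>w\<close> depends on the trace only, so it leaves the inner integrals
  over u and t, and these are exactly \<open>peak_f\<close>. It stays arbitrary here; the law of the
  height enters later through a choice of \<open>w\<close>. The constant collects 4 pi^2, the
  scaling s^4 / 3 and the constant \<open>c\<close> of the proof.\<close>

lemma nn_integral_pos_def_det_gaussian:
  fixes w :: "real \<Rightarrow> real" and s :: real
  assumes [measurable]: "w \<in> borel_measurable borel" and w: "\<And>x. 0 \<le> w x" and s: "0 < s"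
  defines "\<Psi> \<equiv> \<lambda>(e1, e2, e3). if 0 < e1 \<and> 0 < e2 \<and> 0 < e3
    then ennreal (e3 * (exp (- (5/2) * (e1\<^sup>2 - 3 * e2) / s\<^sup>2) * w (e1 / s))) else 0"
  shows "(\<integral>\<^sup>+a. (\<integral>\<^sup>+b. (\<integral>\<^sup>+c. (\<integral>\<^sup>+d. (\<integral>\<^sup>+e. (\<integral>\<^sup>+f.
      \<Psi> (a + d + f, (a * d - b\<^sup>2) + (a * f - c\<^sup>2) + (d * f - e\<^sup>2),
         a * (d * f - e\<^sup>2) - b * (b * f - c * e) + c * (b * e - c * d))
      \<partial>lborel) \<partial>lborel) \<partial>lborel) \<partial>lborel) \<partial>lborel) \<partial>lborel)
    = ennreal (8 * pi\<^sup>2 * s ^ 9 / (18225 * sqrt (5 / (2 * pi)))) *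
      (\<integral>\<^sup>+x. (if 0 < x then ennreal (peak_f x * w x) else 0) \<partial>lborel)"
proof -
  define r where "r = sqrt (5 / (2 * pi))"
  have r: "r > 0" by (simp add: r_def)
  have "\<Psi> \<in> borel_measurable (borel \<Otimes>\<^sub>M (borel \<Otimes>\<^sub>M borel))"
    unfolding \<Psi>_def by measurable
  then have \<Psi> [measurable]: "\<Psi> \<in> borel_measurable borel"
    by (simp only: borel_prod)
  define k where "k = (\<lambda>(l, t, \<delta>). if 0 < t \<and> 0 < \<delta>
    then ennreal \<delta> * \<Psi> (3 * l - t, l * (2 * l - t) + (l\<^sup>2 - l * t + \<delta>), l * (l\<^sup>2 - l * t + \<delta>)) else 0)"
  have "k \<in> borel_measurable (borel \<Otimes>\<^sub>M (borel \<Otimes>\<^sub>M borel))"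
    unfolding k_def by measurable
  then have km [measurable]: "k \<in> borel_measurable borel"
    by (simp only: borel_prod)
  define K where "K = (\<lambda>(l, \<mu>, \<tau>). k (l, 2 * \<mu>, \<mu>\<^sup>2 - \<tau>) * indicator {0<..} \<tau> :: ennreal)"
  have "K \<in> borel_measurable (borel \<Otimes>\<^sub>M (borel \<Otimes>\<^sub>M borel))"
    unfolding K_def by measurable
  then have Km [measurable]: "K \<in> borel_measurable borel"
    by (simp only: borel_prod)
  define g where "g x u t = (if 0 < u \<and> u < x \<and> 0 < t \<and> t < u\<^sup>2 \<and> t < ((x - u) / 3)\<^sup>2
      then ennreal (2025 / 2 * r * ((u\<^sup>2 - t) * (x + 2 * u) * (((x - u) / 3)\<^sup>2 - t) * exp (- (5/2) * (u\<^sup>2 + 3 * t))))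
      else 0)" for x u t
  \<comment> \<open>The powers of s come from det T (s^2), from l (s / 3) and from m^2 - \<tau>
    (s^2); the divisor is the normalisation under which the integral over u and t equals
    \<open>peak_f\<close>.\<close>
  define c where "c = s ^ 5 / 3 / (2025 / 2 * r)"
  have c0: "c > 0" using s r by (simp add: c_def)
  have K_eq: "K (s * (x + 2 * u) / 3, s * u, s\<^sup>2 * t) = ennreal (c * w x) * g x u t" for x u t
  proof (cases "0 < u \<and> 0 < t \<and> t < u\<^sup>2")
    case True
    define l where "l = s * (x + 2 * u) / 3"
    define m where "m = s * (x - u) / 3"
    have m: "m = l - s * u" by (simp add: m_def l_def field_simps)
    define \<tau> where "\<tau> = s\<^sup>2 * t"
    have pos: "0 < s * u" "0 < \<tau>" "\<tau> < (s * u)\<^sup>2" using True s by (auto simp: \<tau>_def power_mult_distrib)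
    have iff: "0 < l + 2 * m \<and> 0 < 2 * l * m + (m\<^sup>2 - \<tau>) \<and> 0 < l * (m\<^sup>2 - \<tau>) \<longleftrightarrow> 0 < m \<and> \<tau> < m\<^sup>2"
      by (rule eigenvalues_positive_iff[OF m pos])
    have E1: "3 * l - 2 * (s * u) = l + 2 * m" by (simp add: m)
    have E2: "l * (2 * l - 2 * (s * u)) + (l\<^sup>2 - l * (2 * (s * u)) + ((s * u)\<^sup>2 - \<tau>)) = 2 * l * m + (m\<^sup>2 - \<tau>)"
      unfolding m by (simp add: algebra_simps power2_eq_square)
    have E3: "l * (l\<^sup>2 - l * (2 * (s * u)) + ((s * u)\<^sup>2 - \<tau>)) = l * (m\<^sup>2 - \<tau>)"
      unfolding m by (simp add: algebra_simps power2_eq_square)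
    have "K (l, s * u, \<tau>) = ennreal ((s * u)\<^sup>2 - \<tau>) * \<Psi> (l + 2 * m, 2 * l * m + (m\<^sup>2 - \<tau>), l * (m\<^sup>2 - \<tau>))"
      using pos unfolding K_def k_def prod.case E1 E2 E3 by simp
    also have "\<dots> = ennreal (c * w x) * g x u t"
    proof (cases "0 < m \<and> \<tau> < m\<^sup>2")
      case m_pos: True
      then have l0: "l > 0" using pos by (simp add: m)
      have xu: "u < x" using m_pos s by (simp add: m_def zero_less_divide_iff zero_less_mult_iff)
      have tm: "t < ((x - u) / 3)\<^sup>2"
      proof -
        have "s\<^sup>2 * t < s\<^sup>2 * ((x - u) / 3)\<^sup>2" using m_pos by (simp add: \<tau>_def m_def power_mult_distrib power_divide)
        then show ?thesis using s by simp
      qed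
      have ex: "- (5/2) * ((l + 2 * m)\<^sup>2 - 3 * (2 * l * m + (m\<^sup>2 - \<tau>))) / s\<^sup>2 = - (5/2) * (u\<^sup>2 + 3 * t)"
      proof -
        \<comment> \<open>The combination e1^2 - 3 e2 ignores a common shift of the eigenvalues, so
          only the gap l - m = s u and \<tau> = s^2 t survive.\<close>
        have "(l + 2 * m)\<^sup>2 - 3 * (2 * l * m + (m\<^sup>2 - \<tau>)) = (l - m)\<^sup>2 + 3 * \<tau>"
          by (simp add: algebra_simps power2_eq_square)
        also have "\<dots> = s\<^sup>2 * (u\<^sup>2 + 3 * t)" by (simp add: m \<tau>_def algebra_simps power_mult_distrib)
        finally show ?thesis using s by simp
      qed
      have lx: "(l + 2 * m) / s = x" using s by (simp add: l_def m_def field_simps)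
      have "ennreal ((s * u)\<^sup>2 - \<tau>) * \<Psi> (l + 2 * m, 2 * l * m + (m\<^sup>2 - \<tau>), l * (m\<^sup>2 - \<tau>))
        = ennreal ((s * u)\<^sup>2 - \<tau>) * ennreal (l * (m\<^sup>2 - \<tau>) * (exp (- (5/2) * (u\<^sup>2 + 3 * t)) * w x))"
        using m_pos iff by (simp only: \<Psi>_def prod.case ex lx if_True simp_thms)
      also have "\<dots> = ennreal (((s * u)\<^sup>2 - \<tau>) * (l * (m\<^sup>2 - \<tau>) * (exp (- (5/2) * (u\<^sup>2 + 3 * t)) * w x)))"
        using pos l0 m_pos w by (intro ennreal_mult[symmetric]) (auto intro!: mult_nonneg_nonneg)
      also have "((s * u)\<^sup>2 - \<tau>) * (l * (m\<^sup>2 - \<tau>) * (exp (- (5/2) * (u\<^sup>2 + 3 * t)) * w x))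
        = (c * w x) * (2025 / 2 * r * ((u\<^sup>2 - t) * (x + 2 * u) * (((x - u) / 3)\<^sup>2 - t) * exp (- (5/2) * (u\<^sup>2 + 3 * t))))"
      proof -
        have mm: "m\<^sup>2 = s\<^sup>2 * ((x - u) / 3)\<^sup>2"
          by (simp only: m_def power_mult_distrib power_divide times_divide_eq_right)
        have pq: "(s * u)\<^sup>2 - \<tau> = s\<^sup>2 * (u\<^sup>2 - t)" "m\<^sup>2 - \<tau> = s\<^sup>2 * (((x - u) / 3)\<^sup>2 - t)"
          by (simp_all only: \<tau>_def mm power_mult_distrib right_diff_distrib)
        have l: "l = s / 3 * (x + 2 * u)" by (simp add: l_def)
        have "c * (2025 / 2 * r) = s ^ 5 / 3" using r by (simp add: c_def)
        also have "\<dots> = s\<^sup>2 * (s / 3 * s\<^sup>2)" by (simp add: eval_nat_numeral)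
        finally have cs: "s\<^sup>2 * (s / 3 * s\<^sup>2) = c * (2025 / 2 * r)" ..
        have shuffle: "(s\<^sup>2 * p) * ((s / 3 * y) * ((s\<^sup>2 * q) * (e * v))) = (s\<^sup>2 * (s / 3 * s\<^sup>2)) * (v * (p * y * q * e))" for p y q e v :: real
          by (simp only: ac_simps)
        have "((s * u)\<^sup>2 - \<tau>) * (l * (m\<^sup>2 - \<tau>) * (exp (- (5/2) * (u\<^sup>2 + 3 * t)) * w x))
          = c * (2025 / 2 * r) * (w x * ((u\<^sup>2 - t) * (x + 2 * u) * (((x - u) / 3)\<^sup>2 - t) * exp (- (5/2) * (u\<^sup>2 + 3 * t))))"
          unfolding pq l mult.assoc[of "s / 3 * (x + 2 * u)"] shuffle cs ..
        then show ?thesis by (simp only: ac_simps)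
      qed
      also have "ennreal ((c * w x) * (2025 / 2 * r * ((u\<^sup>2 - t) * (x + 2 * u) * (((x - u) / 3)\<^sup>2 - t) * exp (- (5/2) * (u\<^sup>2 + 3 * t)))))
        = ennreal (c * w x) * g x u t"
        using c0 w[of x] r True xu tm unfolding g_def by (subst ennreal_mult) (auto intro!: mult_nonneg_nonneg)
      finally show ?thesis .
    next
      case False
      have "\<not> (u < x \<and> t < ((x - u) / 3)\<^sup>2)"
      proof
        assume *: "u < x \<and> t < ((x - u) / 3)\<^sup>2"
        then have "m > 0" using s by (simp add: m_def)
        moreover have "s\<^sup>2 * t < s\<^sup>2 * ((x - u) / 3)\<^sup>2" using * s by simp
        ultimately show False using False by (simp add: \<tau>_def m_def power_mult_distrib power_divide)
      qed
      then have "g x u t = 0" by (auto simp: g_def)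
      moreover have "\<Psi> (l + 2 * m, 2 * l * m + (m\<^sup>2 - \<tau>), l * (m\<^sup>2 - \<tau>)) = 0"
        using False iff by (simp only: \<Psi>_def prod.case if_False simp_thms)
      ultimately show ?thesis by simp
    qed
    finally show ?thesis by (simp add: l_def \<tau>_def)
  next
    case False
    then have g: "g x u t = 0" by (auto simp: g_def)
    from False have "\<not> 0 < 2 * (s * u) \<or> \<not> 0 < s\<^sup>2 * t \<or> \<not> 0 < (s * u)\<^sup>2 - s\<^sup>2 * t"
      using s by (auto simp: zero_less_mult_iff power_mult_distrib)
    then have "K (s * (x + 2 * u) / 3, s * u, s\<^sup>2 * t) = 0"
      unfolding K_def k_def prod.case by (auto simp: indicator_def)
    then show ?thesis using g by simp
  qed
  have [measurable]: "(\<lambda>t. g x u t) \<in> borel_measurable borel" for x u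
    unfolding g_def by measurable
  have [measurable]: "(\<lambda>u. \<integral>\<^sup>+t. g x u t \<partial>lborel) \<in> borel_measurable borel" for x
    unfolding g_def by measurable
  have inner: "(\<integral>\<^sup>+u. (\<integral>\<^sup>+t. ennreal (c * w x) * g x u t \<partial>lborel) \<partial>lborel)
    = ennreal c * (if 0 < x then ennreal (peak_f x * w x) else 0)" for x
  proof -
    have "(\<integral>\<^sup>+u. (\<integral>\<^sup>+t. ennreal (c * w x) * g x u t \<partial>lborel) \<partial>lborel)
      = (\<integral>\<^sup>+u. ennreal (c * w x) * (\<integral>\<^sup>+t. g x u t \<partial>lborel) \<partial>lborel)"
      by (rule nn_integral_cong, rule nn_integral_cmult) measurable
    also have "\<dots> = ennreal (c * w x) * (\<integral>\<^sup>+u. (\<integral>\<^sup>+t. g x u t \<partial>lborel) \<partial>lborel)"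
      by (rule nn_integral_cmult) measurable
    also have "\<dots> = ennreal c * (if 0 < x then ennreal (peak_f x * w x) else 0)"
    proof (cases "0 < x")
      case True
      have "(\<integral>\<^sup>+u. (\<integral>\<^sup>+t. g x u t \<partial>lborel) \<partial>lborel) = ennreal (peak_f x)"
        unfolding g_def r_def by (rule nn_integral_peak_f(1)[OF True])
      then show ?thesis
        using True c0 w[of x] nn_integral_peak_f(2)[OF True]
        by (simp add: ennreal_mult mult_ac)
    next
      case False
      then have "g x u t = 0" for u t by (auto simp: g_def)
      then show ?thesis using False by simp
    qed
    finally show ?thesis .
  qed
  have "(\<integral>\<^sup>+a. (\<integral>\<^sup>+b. (\<integral>\<^sup>+c. (\<integral>\<^sup>+d. (\<integral>\<^sup>+e. (\<integral>\<^sup>+f.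
      \<Psi> (a + d + f, (a * d - b\<^sup>2) + (a * f - c\<^sup>2) + (d * f - e\<^sup>2),
         a * (d * f - e\<^sup>2) - b * (b * f - c * e) + c * (b * e - c * d))
      \<partial>lborel) \<partial>lborel) \<partial>lborel) \<partial>lborel) \<partial>lborel) \<partial>lborel)
    = ennreal (4 * pi\<^sup>2) * (\<integral>\<^sup>+l. (\<integral>\<^sup>+\<mu>. (\<integral>\<^sup>+\<tau>. K (l, \<mu>, \<tau>) \<partial>lborel) \<partial>lborel) \<partial>lborel)"
    unfolding K_def k_def prod.case[of _ _ "(_, _)"] prod.case
    by (rule nn_integral_sym3_spectral[OF \<Psi>, unfolded prod.case])
  also have "(\<integral>\<^sup>+l. (\<integral>\<^sup>+\<mu>. (\<integral>\<^sup>+\<tau>. K (l, \<mu>, \<tau>) \<partial>lborel) \<partial>lborel) \<partial>lborel) = ennreal (s ^ 4 / 3) *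
      (\<integral>\<^sup>+x. (\<integral>\<^sup>+u. (\<integral>\<^sup>+t. ennreal (c * w x) * g x u t \<partial>lborel) \<partial>lborel) \<partial>lborel)"
    unfolding K_eq[symmetric] by (rule nn_integral_affine_3[OF Km s])
  also have "\<dots> = ennreal (s ^ 4 / 3) * (\<integral>\<^sup>+x. ennreal c * (if 0 < x then ennreal (peak_f x * w x) else 0) \<partial>lborel)"
    unfolding inner ..
  also have "(\<integral>\<^sup>+x. ennreal c * (if 0 < x then ennreal (peak_f x * w x) else 0) \<partial>lborel)
    = ennreal c * (\<integral>\<^sup>+x. (if 0 < x then ennreal (peak_f x * w x) else 0) \<partial>lborel)"
  proof (rule nn_integral_cmult)
    have "continuous_on UNIV erf"
      using has_real_derivative_erf by (intro continuous_at_imp_continuous_on) (auto intro: DERIV_isCont)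
    then have [measurable]: "erf \<in> borel_measurable borel" by (rule borel_measurable_continuous_onI)
    show "(\<lambda>x. if 0 < x then ennreal (peak_f x * w x) else 0) \<in> borel_measurable lborel"
      unfolding peak_f_def by measurable
  qed
  also have "ennreal (4 * pi\<^sup>2) * (ennreal (s ^ 4 / 3) * (ennreal c * X)) = ennreal (8 * pi\<^sup>2 * s ^ 9 / (18225 * r)) * X" for X
  proof -
    have gen: "ennreal p * (ennreal q * (ennreal c * X)) = ennreal (p * (q * c)) * X" if "0 \<le> p" "0 \<le> q" for p q
      using that c0 by (simp only: ennreal_mult mult_nonneg_nonneg less_imp_le mult.assoc)
    have "ennreal (4 * pi\<^sup>2) * (ennreal (s ^ 4 / 3) * (ennreal c * X)) = ennreal (4 * pi\<^sup>2 * (s ^ 4 / 3 * c)) * X"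
      using s by (intro gen) auto
    also have "4 * pi\<^sup>2 * (s ^ 4 / 3 * c) = 8 * pi\<^sup>2 * s ^ 9 / (18225 * r)"
      using r by (simp add: c_def field_simps eval_nat_numeral)
    finally show ?thesis .
  qed
  finally show ?thesis unfolding r_def .
qed

section \<open>Characteristic functions of densities\<close>

lemma integral_cis_normal_density:
  assumes s: "0 < s"
  shows "(\<integral>x. cis (w * x) * complex_of_real (normal_density m s x) \<partial>lborel) =
    cis (w * m) * complex_of_real (exp (- (s * w)\<^sup>2 / 2))"
proof -
  have "(\<integral>x. cis (w * x) * complex_of_real (normal_density m s x) \<partial>lborel)
    = \<bar>s\<bar> *\<^sub>R (\<integral>z. cis (w * (m + s * z)) * complex_of_real (normal_density m s (m + s * z)) \<partial>lborel)"
    using s by (intro lborel_integral_real_affine) auto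
  also have "\<dots> = (\<integral>z. s *\<^sub>R (cis (w * (m + s * z)) * complex_of_real (normal_density m s (m + s * z))) \<partial>lborel)"
    using s by simp
  also have "\<dots> = (\<integral>z. cis (w * m) * (std_normal_density z *\<^sub>R iexp (s * w * z)) \<partial>lborel)"
  proof (rule Bochner_Integration.integral_cong[OF refl])
    fix z
    have "normal_density m s (m + s * z) = std_normal_density z / s"
      using s by (simp add: normal_density_def power_mult_distrib real_sqrt_mult)
    moreover have "cis (w * (m + s * z)) = cis (w * m) * iexp (s * w * z)"
      unfolding cis_conv_exp[symmetric] cis_mult by (simp add: algebra_simps)
    ultimately show "s *\<^sub>R (cis (w * (m + s * z)) * complex_of_real (normal_density m s (m + s * z)))
      = cis (w * m) * (std_normal_density z *\<^sub>R iexp (s * w * z))"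
      using s by (simp add: scaleR_conv_of_real)
  qed
  also have "\<dots> = cis (w * m) * (\<integral>z. std_normal_density z *\<^sub>R iexp (s * w * z) \<partial>lborel)"
    by (rule integral_mult_right_zero)
  also have "(\<integral>z. std_normal_density z *\<^sub>R iexp (s * w * z) \<partial>lborel) = char std_normal_distribution (s * w)"
    unfolding char_def by (rule integral_density[symmetric]) auto
  also have "\<dots> = complex_of_real (exp (- (s * w)\<^sup>2 / 2))"
    by (simp add: char_std_normal_distribution)
  finally show ?thesis .
qed

lemma integrable_cis_mult:
  fixes g :: "'a::euclidean_space \<Rightarrow> real"
  assumes g: "integrable lborel g" and [measurable]: "h \<in> borel_measurable borel"
  shows "integrable lborel (\<lambda>p. cis (h p) * complex_of_real (g p))"
proof (rule Bochner_Integration.integrable_bound[OF g])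
  show "(\<lambda>p. cis (h p) * complex_of_real (g p)) \<in> borel_measurable lborel"
    using borel_measurable_integrable[OF g] by (simp add: cis_conv_exp)
qed (simp add: norm_mult)

text \<open>Lebesgue measure is the image of the product measure under the coordinate expansion,
  which makes an integrand that is a product over coordinates factorise.\<close>

lemma integral_prod_Basis:
  fixes f :: "'a::euclidean_space \<Rightarrow> real \<Rightarrow> 'c::{real_normed_field,banach,second_countable_topology}"
  assumes f: "\<And>b. b \<in> Basis \<Longrightarrow> integrable lborel (f b)"
  shows "(\<integral>x. (\<Prod>b\<in>Basis. f b (x \<bullet> b)) \<partial>lborel) = (\<Prod>b\<in>Basis. (\<integral>t. f b t \<partial>lborel))"
    and "integrable lborel (\<lambda>x. \<Prod>b\<in>Basis. f b (x \<bullet> b))"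
proof -
  interpret product_sigma_finite "\<lambda>_::'a. lborel :: real measure" ..
  have m: "f b \<in> borel_measurable borel" if "b \<in> Basis" for b
    using f[OF that] by (auto dest: borel_measurable_integrable)
  then have m': "(\<lambda>x. \<Prod>b\<in>Basis. f b (x \<bullet> b)) \<in> borel_measurable borel"
    by (intro borel_measurable_prod measurable_compose[OF _ m]) auto
  have coord: "(\<Sum>b\<in>Basis. x b *\<^sub>R b) \<bullet> b' = x b'" if "b' \<in> Basis" for x :: "'a \<Rightarrow> real" and b'
    using that by simp
  have meas: "(\<lambda>x. \<Sum>b\<in>Basis. x b *\<^sub>R b) \<in> (\<Pi>\<^sub>M b\<in>Basis. lborel :: real measure) \<rightarrow>\<^sub>M (borel :: 'a measure)"
    by measurable
  have eq: "(\<Prod>b\<in>Basis. f b ((\<Sum>b\<in>Basis. x b *\<^sub>R b) \<bullet> b)) = (\<Prod>b\<in>Basis. f b (x b))" for x :: "'a \<Rightarrow> real"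
    by (rule prod.cong) (simp_all add: coord)
  have "(\<integral>x. (\<Prod>b\<in>Basis. f b (x \<bullet> b)) \<partial>lborel) = (\<integral>x. (\<Prod>b\<in>Basis. f b (x b)) \<partial>(\<Pi>\<^sub>M b\<in>Basis. lborel))"
    by (subst lborel_eq, subst integral_distr[OF meas m']) (simp only: eq)
  also have "\<dots> = (\<Prod>b\<in>Basis. (\<integral>t. f b t \<partial>lborel))"
    by (rule product_integral_prod) (use f in auto)
  finally show "(\<integral>x. (\<Prod>b\<in>Basis. f b (x \<bullet> b)) \<partial>lborel) = (\<Prod>b\<in>Basis. (\<integral>t. f b t \<partial>lborel))" .
  have "integrable (\<Pi>\<^sub>M b\<in>Basis. lborel) (\<lambda>x. \<Prod>b\<in>Basis. f b (x b))"
    by (rule product_integrable_prod) (use f in auto)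
  then show "integrable lborel (\<lambda>x. \<Prod>b\<in>Basis. f b (x \<bullet> b))"
    by (subst lborel_eq, subst integrable_distr_eq[OF meas m']) (simp only: eq)
qed

definition iso_normal_density :: "real \<Rightarrow> 'a::euclidean_space \<Rightarrow> real" where
  "iso_normal_density s x = (\<Prod>b\<in>Basis. normal_density 0 s (x \<bullet> b))"

lemma integrable_iso_normal_density:
  "0 < s \<Longrightarrow> integrable lborel (iso_normal_density s :: 'a::euclidean_space \<Rightarrow> real)"
  unfolding iso_normal_density_def[abs_def] by (rule integral_prod_Basis(2)) simp

lemma integral_cis_iso_normal_density:
  fixes y :: "'a::euclidean_space"
  assumes s: "0 < s"
  shows "(\<integral>u. cis (y \<bullet> u) * complex_of_real (iso_normal_density s u) \<partial>lborel) =
    complex_of_real (exp (- (s * norm y)\<^sup>2 / 2))"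
proof -
  define f where "f b t = cis ((y \<bullet> b) * t) * complex_of_real (normal_density 0 s t)" for b t
  have f_int: "integrable lborel (f b)" for b
    unfolding f_def[abs_def] using s by (intro integrable_cis_mult) auto
  have "cis (y \<bullet> u) = (\<Prod>b\<in>Basis. cis ((y \<bullet> b) * (u \<bullet> b)))" for u
    by (subst euclidean_inner) (simp add: cis_conv_exp exp_sum sum_distrib_left)
  then have "(\<integral>u. cis (y \<bullet> u) * complex_of_real (iso_normal_density s u) \<partial>lborel)
    = (\<integral>u. (\<Prod>b\<in>Basis. f b (u \<bullet> b)) \<partial>lborel)"
    by (simp add: iso_normal_density_def f_def prod.distrib)
  also have "\<dots> = (\<Prod>b\<in>Basis. (\<integral>t. f b t \<partial>lborel))"
    using f_int by (rule integral_prod_Basis(1))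
  also have "\<dots> = (\<Prod>b\<in>Basis. complex_of_real (exp (- (s * (y \<bullet> b))\<^sup>2 / 2)))"
    unfolding f_def integral_cis_normal_density[OF s] by simp
  also have "\<dots> = complex_of_real (exp (\<Sum>b\<in>Basis. - (s * (y \<bullet> b))\<^sup>2 / 2))"
    by (simp add: exp_sum)
  also have "(\<Sum>b\<in>Basis. - (s * (y \<bullet> b))\<^sup>2 / 2) = - (s * norm y)\<^sup>2 / 2"
    unfolding power_mult_distrib power2_norm_eq_inner euclidean_inner[of y y]
    by (simp add: sum_distrib_left sum_negf sum_divide_distrib power2_eq_square[of "y \<bullet> _"])
  finally show ?thesis .
qed

text \<open>The Fourier transform of an arbitrary real function rather than of a probability
  measure, so that it applies to the difference of two densities.\<close>

definition char_density :: "('a::euclidean_space \<Rightarrow> real) \<Rightarrow> 'a \<Rightarrow> complex" where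
  "char_density g u = (\<integral>p. cis (u \<bullet> p) * complex_of_real (g p) \<partial>lborel)"

text \<open>Given p, the new coordinate is normal with mean m . p. Integrating it out first leaves
  cis (w (m . p)), which merely shifts u by w m. Iteration evaluates the transform of a chain of
  conditional laws without inverting a covariance matrix.\<close>

lemma char_density_normal_step:
  fixes g :: "'a::euclidean_space \<Rightarrow> real" and m :: 'a
  assumes g: "integrable lborel g" and s: "0 < s"
  defines "G \<equiv> \<lambda>(x, p). normal_density (m \<bullet> p) s x * g p"
  shows "integrable lborel G"
    and "char_density G (w, u) = complex_of_real (exp (- (s * w)\<^sup>2 / 2)) * char_density g (u + w *\<^sub>R m)"
proof -
  have gm [measurable]: "g \<in> borel_measurable borel" using borel_measurable_integrable[OF g] by simp
  have "G \<in> borel_measurable (borel \<Otimes>\<^sub>M borel)"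
    unfolding G_def normal_density_def by measurable
  then have Gm: "G \<in> borel_measurable borel" by (simp only: borel_prod)
  have one: "(\<integral>\<^sup>+x. ennreal (normal_density c s x) \<partial>lborel) = 1" for c
    using s by (simp add: nn_integral_eq_integral)
  have "(\<integral>\<^sup>+z. ennreal (norm (G z)) \<partial>lborel) = (\<integral>\<^sup>+x. (\<integral>\<^sup>+p. ennreal (norm (G (x, p))) \<partial>lborel) \<partial>lborel)"
    unfolding lborel_prod[symmetric]
    by (rule lborel.nn_integral_fst[symmetric]) (use Gm in \<open>simp add: lborel_prod\<close>)
  also have "\<dots> = (\<integral>\<^sup>+p. (\<integral>\<^sup>+x. ennreal (norm (G (x, p))) \<partial>lborel) \<partial>lborel)"
    by (rule nn_integral_lborel_swap[symmetric]) (use Gm in \<open>simp add: borel_prod case_prod_beta'\<close>)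
  also have "\<dots> = (\<integral>\<^sup>+p. ennreal \<bar>g p\<bar> * (\<integral>\<^sup>+x. ennreal (normal_density (m \<bullet> p) s x) \<partial>lborel) \<partial>lborel)"
    by (rule nn_integral_cong, subst nn_integral_cmult[symmetric])
      (auto simp: G_def abs_mult ennreal_mult mult.commute)
  also have "\<dots> = (\<integral>\<^sup>+p. ennreal (norm (g p)) \<partial>lborel)"
    by (simp add: one)
  also have "\<dots> < \<infinity>" using g by (simp add: integrable_iff_bounded)
  finally show G: "integrable lborel G"
    using Gm by (simp add: integrable_iff_bounded)
  have "char_density G (w, u) = (\<integral>z. cis (w * fst z + u \<bullet> snd z) * complex_of_real (G z) \<partial>(lborel \<Otimes>\<^sub>M lborel))"
    unfolding char_density_def lborel_prod by (simp add: inner_prod_def)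
  also have "\<dots> = (\<integral>p. (\<integral>x. cis (w * x + u \<bullet> p) * complex_of_real (G (x, p)) \<partial>lborel) \<partial>lborel)"
  proof -
    have "integrable (lborel \<Otimes>\<^sub>M lborel) (\<lambda>z. cis (w * fst z + u \<bullet> snd z) * complex_of_real (G z))"
      unfolding lborel_prod using G by (rule integrable_cis_mult) (auto intro!: borel_measurable_continuous_onI continuous_intros)
    then show ?thesis
      using lborel_pair.integral_snd[of "\<lambda>x p. cis (w * x + u \<bullet> p) * complex_of_real (G (x, p))"]
      by (simp add: case_prod_beta')
  qed
  also have "\<dots> = (\<integral>p. complex_of_real (exp (- (s * w)\<^sup>2 / 2)) * (cis ((u + w *\<^sub>R m) \<bullet> p) * complex_of_real (g p)) \<partial>lborel)"
  proof (rule Bochner_Integration.integral_cong[OF refl])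
    fix p
    have "(\<integral>x. cis (w * x + u \<bullet> p) * complex_of_real (G (x, p)) \<partial>lborel)
      = (\<integral>x. (cis (u \<bullet> p) * complex_of_real (g p)) * (cis (w * x) * complex_of_real (normal_density (m \<bullet> p) s x)) \<partial>lborel)"
      by (intro Bochner_Integration.integral_cong[OF refl]) (simp add: G_def cis_mult[symmetric])
    also have "\<dots> = (cis (u \<bullet> p) * complex_of_real (g p)) * (cis (w * (m \<bullet> p)) * complex_of_real (exp (- (s * w)\<^sup>2 / 2)))"
      by (subst integral_mult_right_zero) (simp only: integral_cis_normal_density[OF s])
    also have "\<dots> = complex_of_real (exp (- (s * w)\<^sup>2 / 2)) * (cis ((u + w *\<^sub>R m) \<bullet> p) * complex_of_real (g p))"
      by (simp add: inner_add_left cis_mult[symmetric])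
    finally show "(\<integral>x. cis (w * x + u \<bullet> p) * complex_of_real (G (x, p)) \<partial>lborel) = \<dots>" .
  qed
  also have "\<dots> = complex_of_real (exp (- (s * w)\<^sup>2 / 2)) * char_density g (u + w *\<^sub>R m)"
    unfolding char_density_def by (rule integral_mult_right_zero)
  finally show "char_density G (w, u) = \<dots>" .
qed

lemma char_density_product:
  fixes f :: "'a::euclidean_space \<Rightarrow> real" and g :: "'b::euclidean_space \<Rightarrow> real"
  assumes f: "integrable lborel f" and g: "integrable lborel g"
  defines "G \<equiv> \<lambda>(x, p). f x * g p"
  shows "integrable lborel G"
    and "char_density G (v, u) = char_density f v * char_density g u"
proof -
  have [measurable]: "f \<in> borel_measurable borel" "g \<in> borel_measurable borel"
    using borel_measurable_integrable[OF f] borel_measurable_integrable[OF g] by simp_all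
  have "G \<in> borel_measurable (borel \<Otimes>\<^sub>M borel)"
    unfolding G_def by measurable
  then have Gm: "G \<in> borel_measurable borel" by (simp only: borel_prod)
  have "(\<integral>\<^sup>+z. ennreal (norm (G z)) \<partial>lborel) = (\<integral>\<^sup>+x. (\<integral>\<^sup>+p. ennreal (norm (G (x, p))) \<partial>lborel) \<partial>lborel)"
    unfolding lborel_prod[symmetric]
    by (rule lborel.nn_integral_fst[symmetric]) (use Gm in \<open>simp add: lborel_prod\<close>)
  also have "\<dots> = (\<integral>\<^sup>+x. ennreal (norm (f x)) * (\<integral>\<^sup>+p. ennreal (norm (g p)) \<partial>lborel) \<partial>lborel)"
    by (rule nn_integral_cong, subst nn_integral_cmult[symmetric]) (auto simp: G_def abs_mult ennreal_mult)
  also have "\<dots> = (\<integral>\<^sup>+x. ennreal (norm (f x)) \<partial>lborel) * (\<integral>\<^sup>+p. ennreal (norm (g p)) \<partial>lborel)"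
    by (rule nn_integral_multc) measurable
  also have "\<dots> < \<infinity>" using f g by (simp add: integrable_iff_bounded ennreal_mult_less_top)
  finally show G: "integrable lborel G"
    using Gm by (simp add: integrable_iff_bounded)
  have "char_density G (v, u) = (\<integral>z. cis (v \<bullet> fst z + u \<bullet> snd z) * complex_of_real (G z) \<partial>(lborel \<Otimes>\<^sub>M lborel))"
    unfolding char_density_def lborel_prod by (simp add: inner_prod_def)
  also have "\<dots> = (\<integral>x. (\<integral>p. cis (v \<bullet> x + u \<bullet> p) * complex_of_real (G (x, p)) \<partial>lborel) \<partial>lborel)"
  proof -
    have "integrable (lborel \<Otimes>\<^sub>M lborel) (\<lambda>z. cis (v \<bullet> fst z + u \<bullet> snd z) * complex_of_real (G z))"
      unfolding lborel_prod using G by (rule integrable_cis_mult) (auto intro!: borel_measurable_continuous_onI continuous_intros)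
    then show ?thesis
      by (subst lborel_pair.integral_fst'[symmetric]) auto
  qed
  also have "\<dots> = (\<integral>x. (cis (v \<bullet> x) * complex_of_real (f x)) * char_density g u \<partial>lborel)"
  proof (rule Bochner_Integration.integral_cong[OF refl])
    fix x
    have "(\<integral>p. cis (v \<bullet> x + u \<bullet> p) * complex_of_real (G (x, p)) \<partial>lborel)
      = (\<integral>p. (cis (v \<bullet> x) * complex_of_real (f x)) * (cis (u \<bullet> p) * complex_of_real (g p)) \<partial>lborel)"
      by (intro Bochner_Integration.integral_cong[OF refl]) (simp add: G_def cis_mult[symmetric])
    then show "(\<integral>p. cis (v \<bullet> x + u \<bullet> p) * complex_of_real (G (x, p)) \<partial>lborel)
      = (cis (v \<bullet> x) * complex_of_real (f x)) * char_density g u"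
      unfolding char_density_def by (simp only: integral_mult_right_zero)
  qed
  also have "\<dots> = char_density f v * char_density g u"
    unfolding char_density_def by (rule integral_mult_left_zero)
  finally show "char_density G (v, u) = \<dots>" .
qed

section \<open>Uniqueness of continuous densities\<close>

text \<open>The Gaussian window is itself a Fourier transform, so Fubini moves the transform onto \<open>D\<close>.\<close>

lemma integral_gaussian_window_eq_0:
  fixes D :: "'a::euclidean_space \<Rightarrow> real"
  assumes D: "integrable lborel D" and char0: "\<And>u. char_density D u = 0" and s: "0 < s"
  shows "(\<integral>y. D y * exp (- (s * norm (y - p))\<^sup>2 / 2) \<partial>lborel) = 0"
proof -
  let ?N = "iso_normal_density s :: 'a \<Rightarrow> real"
  have [measurable]: "D \<in> borel_measurable borel" using borel_measurable_integrable[OF D] by simp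
  define G where "G = (\<lambda>(y, u). D y * ?N u)"
  have G: "integrable (lborel \<Otimes>\<^sub>M lborel) G"
    unfolding G_def lborel_prod by (rule char_density_product(1)[OF D integrable_iso_normal_density[OF s]])
  define h where "h z = cis ((fst z - p) \<bullet> snd z) * complex_of_real (G z)" for z
  have h: "integrable (lborel \<Otimes>\<^sub>M lborel) h"
    using G unfolding h_def[abs_def] lborel_prod
    by (rule integrable_cis_mult) (auto intro!: borel_measurable_continuous_onI continuous_intros)
  have "complex_of_real (\<integral>y. D y * exp (- (s * norm (y - p))\<^sup>2 / 2) \<partial>lborel)
    = (\<integral>y. complex_of_real (D y) * complex_of_real (exp (- (s * norm (y - p))\<^sup>2 / 2)) \<partial>lborel)"
    by (simp only: integral_complex_of_real[symmetric] of_real_mult)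
  also have "\<dots> = (\<integral>y. (\<integral>u. h (y, u) \<partial>lborel) \<partial>lborel)"
  proof (rule Bochner_Integration.integral_cong[OF refl])
    fix y
    have "(\<integral>u. h (y, u) \<partial>lborel) = (\<integral>u. complex_of_real (D y) * (cis ((y - p) \<bullet> u) * complex_of_real (?N u)) \<partial>lborel)"
      by (intro Bochner_Integration.integral_cong[OF refl]) (simp add: h_def G_def)
    then show "complex_of_real (D y) * complex_of_real (exp (- (s * norm (y - p))\<^sup>2 / 2)) = (\<integral>u. h (y, u) \<partial>lborel)"
      by (simp only: integral_mult_right_zero integral_cis_iso_normal_density[OF s])
  qed
  also have "\<dots> = (\<integral>u. (\<integral>y. h (y, u) \<partial>lborel) \<partial>lborel)"
    using h by (intro lborel_pair.Fubini_integral[symmetric]) (simp add: case_prod_beta')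
  also have "\<dots> = (\<integral>(u::'a). 0 \<partial>lborel)"
  proof (rule Bochner_Integration.integral_cong[OF refl])
    fix u
    have "(\<integral>y. h (y, u) \<partial>lborel) = (\<integral>y. (cis (- (p \<bullet> u)) * complex_of_real (?N u)) * (cis (u \<bullet> y) * complex_of_real (D y)) \<partial>lborel)"
    proof (rule Bochner_Integration.integral_cong[OF refl])
      fix y
      have "(y - p) \<bullet> u = - (p \<bullet> u) + u \<bullet> y"
        by (simp add: inner_diff_left inner_commute[of y u])
      then have "cis ((y - p) \<bullet> u) = cis (- (p \<bullet> u)) * cis (u \<bullet> y)"
        by (simp only: cis_mult)
      then show "h (y, u) = (cis (- (p \<bullet> u)) * complex_of_real (?N u)) * (cis (u \<bullet> y) * complex_of_real (D y))"
        by (simp add: h_def G_def)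
    qed
    also have "\<dots> = (cis (- (p \<bullet> u)) * complex_of_real (?N u)) * char_density D u"
      unfolding char_density_def by (rule integral_mult_right_zero)
    finally show "(\<integral>y. h (y, u) \<partial>lborel) = 0" by (simp add: char0)
  qed
  finally show ?thesis by simp
qed

text \<open>If D were positive at p, a Gaussian window of width 1/s around p would collect at least
  a constant times s^-n from the ball of radius 1/s, and lose at most exp (- (s d)^2 / 2) times the
  L1 norm outside radius d. The total is zero for every s, which fails for large s. The one-sided
  form suffices because it can be applied to D and - D.\<close>

lemma nonpos_if_char_density_eq_0:
  fixes D :: "'a::euclidean_space \<Rightarrow> real"
  assumes D: "integrable lborel D" and char0: "\<And>u. char_density D u = 0" and cont: "continuous_on UNIV D"
  shows "D p \<le> 0"
proof (rule ccontr)
  assume "\<not> D p \<le> 0"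
  define \<eta> where "\<eta> = D p / 2"
  have \<eta>: "\<eta> > 0" using \<open>\<not> D p \<le> 0\<close> by (simp add: \<eta>_def)
  have "isCont D p" using cont by (simp add: continuous_on_eq_continuous_at)
  then obtain d where d: "d > 0" and near: "\<And>y. dist y p < d \<Longrightarrow> dist (D y) (D p) < \<eta>"
    using \<eta> unfolding continuous_at_eps_delta by (metis dist_norm)
  have D_near: "D y \<ge> \<eta>" if "dist y p < d" for y
    using near[OF that] by (simp add: \<eta>_def dist_real_def abs_if split: if_splits)
  define n where "n = DIM('a)"
  define V where "V = unit_ball_vol (real n)"
  have V: "V > 0" by (simp add: V_def)
  define L where "L = (\<integral>y. \<bar>D y\<bar> \<partial>lborel)"
  have L: "L \<ge> 0" by (simp add: L_def)
  have bound: "\<eta> * exp (-1/2) * V \<le> L * (s ^ n * exp (- (s * d)\<^sup>2 / 2))" if s: "s > 0" "1 \<le> s * d" for s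
  proof -
    let ?e = "\<lambda>y. exp (- (s * norm (y - p))\<^sup>2 / 2)"
    let ?B = "ball p (1 / s)"
    have int1: "integrable lborel (\<lambda>y. D y * ?e y)"
    proof (rule Bochner_Integration.integrable_bound[OF D])
      show "AE y in lborel. norm (D y * ?e y) \<le> norm (D y)"
        by (auto simp: abs_mult intro!: mult_left_le)
    qed (use borel_measurable_integrable[OF D] in simp)
    have fB: "emeasure lborel ?B < \<infinity>" by (rule emeasure_bounded_finite) simp
    then have int2: "integrable lborel (\<lambda>y. \<eta> * exp (-1/2) * indicator ?B y)"
      by (intro integrable_mult_right integrable_real_indicator) auto
    have int3: "integrable lborel (\<lambda>y. exp (- (s * d)\<^sup>2 / 2) * \<bar>D y\<bar>)"
      using D by (intro integrable_mult_right integrable_abs)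
    \<comment> \<open>Pointwise lower bound: on the small ball the window is at least exp (-1/2),
      elsewhere within distance d the integrand is nonnegative, and beyond d only the tail bound is
      used.\<close>
    have pw: "\<eta> * exp (-1/2) * indicator ?B y - exp (- (s * d)\<^sup>2 / 2) * \<bar>D y\<bar> \<le> D y * ?e y" for y
    proof (cases "dist y p < d")
      case True
      have Dy: "D y \<ge> \<eta>" by (rule D_near[OF True])
      have "\<eta> * exp (-1/2) * indicator ?B y \<le> D y * ?e y"
      proof (cases "y \<in> ?B")
        case True
        then have "s * norm (y - p) \<le> 1" using s by (simp add: dist_norm norm_minus_commute field_simps)
        then have "(s * norm (y - p))\<^sup>2 \<le> 1" using s by (intro power_le_one) auto
        then have "exp (-1/2) \<le> ?e y" by simp
        then show ?thesis using Dy \<eta> True by (auto intro!: mult_mono)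
      next
        case False
        then show ?thesis using Dy \<eta> by simp
      qed
      moreover have "0 \<le> exp (- (s * d)\<^sup>2 / 2) * \<bar>D y\<bar>" by simp
      ultimately show ?thesis by linarith
    next
      case False
      have "1 / s \<le> d" using s by (simp add: field_simps)
      with False have "y \<notin> ?B" by (auto simp: dist_commute)
      moreover have "?e y * \<bar>D y\<bar> \<le> exp (- (s * d)\<^sup>2 / 2) * \<bar>D y\<bar>"
        using False d s by (intro mult_right_mono) (auto simp: dist_norm intro!: power_mono)
      moreover have "- (?e y * \<bar>D y\<bar>) \<le> D y * ?e y"
        by (simp add: abs_if mult.commute)
      ultimately show ?thesis by simp
    qed
    have "(\<integral>y. \<eta> * exp (-1/2) * indicator ?B y - exp (- (s * d)\<^sup>2 / 2) * \<bar>D y\<bar> \<partial>lborel) \<le> (\<integral>y. D y * ?e y \<partial>lborel)"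
      by (rule integral_mono[OF _ int1 pw]) (intro Bochner_Integration.integrable_diff int2 int3)
    also have "\<dots> = 0" by (rule integral_gaussian_window_eq_0[OF D char0 s(1)])
    also have "(\<integral>y. \<eta> * exp (-1/2) * indicator ?B y - exp (- (s * d)\<^sup>2 / 2) * \<bar>D y\<bar> \<partial>lborel)
      = \<eta> * exp (-1/2) * measure lborel ?B - exp (- (s * d)\<^sup>2 / 2) * L"
      unfolding L_def by (subst Bochner_Integration.integral_diff[OF int2 int3]) simp
    also have "measure lborel ?B = V * (1 / s) ^ n"
      using s content_ball[of "1 / s" p] by (simp add: V_def n_def)
    finally have "\<eta> * exp (-1/2) * V * (1 / s) ^ n \<le> exp (- (s * d)\<^sup>2 / 2) * L" by (simp add: mult.assoc)
    then show ?thesis using s by (simp add: field_simps power_divide)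
  qed
  have "((\<lambda>s. L * (s ^ n / exp s)) \<longlongrightarrow> L * 0) at_top"
    by (intro tendsto_intros tendsto_power_div_exp_0)
  moreover have "0 < \<eta> * exp (-1/2) * V" using \<eta> V by simp
  ultimately have "\<forall>\<^sub>F s in at_top. L * (s ^ n / exp s) < \<eta> * exp (-1/2) * V"
    by (intro order_tendstoD(2)[of _ "L * 0"]) auto
  \<comment> \<open>The first bound puts the ball of radius 1/s inside the neighbourhood of radius
    d; the second gives s \<le> (s d)^2 / 2, which reduces the tail to the limit of s^n / exp
    s.\<close>
  moreover have "\<forall>\<^sub>F s in at_top. s \<ge> 1 / d \<and> s \<ge> 2 / d\<^sup>2 \<and> s > 0"
    by (intro eventually_conj eventually_ge_at_top eventually_gt_at_top)
  ultimately have "\<forall>\<^sub>F s in at_top. L * (s ^ n / exp s) < \<eta> * exp (-1/2) * V \<and> s \<ge> 1 / d \<and> s \<ge> 2 / d\<^sup>2 \<and> s > 0"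
    by (rule eventually_conj)
  then obtain s where elim: "L * (s ^ n / exp s) < \<eta> * exp (-1/2) * V" "s \<ge> 1 / d" "s \<ge> 2 / d\<^sup>2" "s > 0"
    by (auto dest: eventually_happens'[OF trivial_limit_at_top_linorder])
  have "s * d \<ge> 1" using elim d by (simp add: field_simps)
  have "s * 2 \<le> s * (s * d\<^sup>2)" using elim d by (intro mult_left_mono) (auto simp: field_simps)
  then have "s \<le> (s * d)\<^sup>2 / 2" by (simp add: power_mult_distrib power2_eq_square mult_ac)
  then have "s ^ n * exp (- (s * d)\<^sup>2 / 2) \<le> s ^ n * exp (- s)"
    using elim by (intro mult_left_mono) auto
  then have "L * (s ^ n * exp (- (s * d)\<^sup>2 / 2)) \<le> L * (s ^ n / exp s)"
    using L by (intro mult_left_mono) (auto simp: exp_minus field_simps)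
  then show False using bound[of s] elim \<open>s * d \<ge> 1\<close> by simp
qed

text \<open>Continuity makes the densities agree at every point, not just almost everywhere; only
  this allows evaluation on the null set where the gradient vanishes.\<close>

lemma continuous_density_eqI:
  fixes f g :: "'a::euclidean_space \<Rightarrow> real"
  assumes f: "integrable lborel f" "continuous_on UNIV f" and g: "integrable lborel g" "continuous_on UNIV g"
    and eq: "\<And>u. char_density f u = char_density g u"
  shows "f = g"
proof
  fix p
  have diff: "char_density (\<lambda>p. f p - g p) u = char_density f u - char_density g u"
    if "integrable lborel f" "integrable lborel g" for f g :: "'a \<Rightarrow> real" and u
    unfolding char_density_def
    by (subst Bochner_Integration.integral_diff[symmetric])
      (auto intro!: integrable_cis_mult that borel_measurable_continuous_onI continuous_intros simp: right_diff_distrib)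
  have "f p - g p \<le> 0" and "g p - f p \<le> 0"
    using f g eq by (auto intro!: nonpos_if_char_density_eq_0[where D = "\<lambda>p. f p - g p"]
        nonpos_if_char_density_eq_0[where D = "\<lambda>p. g p - f p"] continuous_intros
        Bochner_Integration.integrable_diff simp: diff simp del: diff_le_0_iff_le)
  then show "f p = g p" by simp
qed

section \<open>The one-point density of the field\<close>

definition cond_normal :: "'a::euclidean_space \<Rightarrow> real \<Rightarrow> ('a \<Rightarrow> real) \<Rightarrow> real \<times> 'a \<Rightarrow> real" where
  "cond_normal m s g = (\<lambda>(x, p). normal_density (m \<bullet> p) s x * g p)"

lemma cond_normal_apply [simp]: "cond_normal m s g (x, p) = normal_density (m \<bullet> p) s x * g p"
  by (simp add: cond_normal_def)

lemma integrable_cond_normal: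
  "integrable lborel g \<Longrightarrow> 0 < s \<Longrightarrow> integrable lborel (cond_normal m s g)"
  unfolding cond_normal_def by (rule char_density_normal_step(1))

lemma char_density_cond_normal:
  "integrable lborel g \<Longrightarrow> 0 < s \<Longrightarrow> char_density (cond_normal m s g) (w, u) =
    complex_of_real (exp (- (s * w)\<^sup>2 / 2)) * char_density g (u + w *\<^sub>R m)"
  unfolding cond_normal_def by (rule char_density_normal_step(2))

lemma continuous_on_cond_normal:
  assumes "continuous_on UNIV g" "0 < s"
  shows "continuous_on UNIV (cond_normal m s g)"
proof -
  have "continuous_on UNIV (\<lambda>z. g (snd z))"
    by (rule continuous_on_compose2[OF assms(1)]) (auto intro: continuous_intros)
  then show ?thesis
    using assms(2) unfolding cond_normal_def case_prod_beta' normal_density_def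
    by (intro continuous_intros) auto
qed

text \<open>A chain of conditional laws, innermost first: the entries 33, 23, 22, 13, 12, 11 of \<open>H\<close>,
  each given the preceding ones.\<close>

definition hess_density :: "real \<Rightarrow> sym3 \<Rightarrow> real" where
  "hess_density s =
    cond_normal (0, 0, 1/4, 0, 1/4) (s / sqrt 6)
      (cond_normal 0 (s / sqrt 15)
        (cond_normal 0 (s / sqrt 15)
          (cond_normal (0, 1/3) (s * sqrt (8/45))
            (cond_normal 0 (s / sqrt 15)
              (normal_density 0 (s / sqrt 5))))))"

text \<open>With s for \<sigma>_2, the height has covariance \<gamma> s / 3 with each diagonal entry
  of H, while tr H has variance s^2 and carries all of the correlation. So the height given the rest
  has mean \<gamma> tr H / s and variance 1 - \<gamma>^2.\<close>

definition field_density :: "real \<Rightarrow> real \<Rightarrow> real \<Rightarrow> real \<times> (real ^ 3) \<times> sym3 \<Rightarrow> real" where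
  "field_density \<gamma> s1 s =
    cond_normal (0, (\<gamma> / s) *\<^sub>R (1, 0, 0, 1, 0, 1)) (sqrt (1 - \<gamma>\<^sup>2))
      (\<lambda>(v, h). iso_normal_density (s1 / sqrt 3) v * hess_density s h)"

lemma integrable_hess_density: "0 < s \<Longrightarrow> integrable lborel (hess_density s)"
  unfolding hess_density_def by (intro integrable_cond_normal integrable_normal_density) auto

lemma continuous_on_hess_density:
  assumes "0 < s" shows "continuous_on UNIV (hess_density s)"
proof -
  have "continuous_on UNIV (normal_density 0 (s / sqrt 5))"
    unfolding normal_density_def[abs_def] using assms by (intro continuous_intros) auto
  then show ?thesis
    unfolding hess_density_def using assms by (intro continuous_on_cond_normal) auto
qed

lemma char_density_normal:
  "0 < s \<Longrightarrow> char_density (normal_density 0 s) u = complex_of_real (exp (- (s * u)\<^sup>2 / 2))"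
  using integral_cis_normal_density[of s u 0] by (simp add: char_density_def)

text \<open>The chain of \<open>hess_density\<close> diagonalises the covariance form. For diagonal
  entries of variance 3/15 and covariance 1/15 the regression coefficients are 1/3 on one
  predecessor and 1/4 on each of two, and the conditional variances are 1/5 - 1/45 = 8/45 and 1/5 -
  1/30 = 1/6, all in units of s^2. Off-diagonal entries are independent of everything else, with
  variance 1/15.\<close>

lemma char_density_hess_density:
  assumes s: "0 < s"
  shows "char_density (hess_density s) (u1, u2, u3, u4, u5, u6) = complex_of_real (exp (- (s\<^sup>2 / 15 *
    (3 * u1\<^sup>2 + 3 * u4\<^sup>2 + 3 * u6\<^sup>2 + 2 * u1 * u4 + 2 * u1 * u6 + 2 * u4 * u6 + u2\<^sup>2 + u3\<^sup>2 + u5\<^sup>2)) / 2))"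
proof -
  note int = integrable_cond_normal integrable_normal_density
  \<comment> \<open>The arguments of the entries 22 and 33 after the shifts caused by the entries
    already integrated out.\<close>
  define v4 where "v4 = u4 + u1 / 4"
  define v6 where "v6 = u6 + u1 / 4 + v4 / 3"
  have "char_density (hess_density s) (u1, u2, u3, u4, u5, u6) =
    complex_of_real (exp (- (s / sqrt 6 * u1)\<^sup>2 / 2)) * (complex_of_real (exp (- (s / sqrt 15 * u2)\<^sup>2 / 2)) *
    (complex_of_real (exp (- (s / sqrt 15 * u3)\<^sup>2 / 2)) * (complex_of_real (exp (- (s * sqrt (8/45) * v4)\<^sup>2 / 2)) *
    (complex_of_real (exp (- (s / sqrt 15 * u5)\<^sup>2 / 2)) * complex_of_real (exp (- (s / sqrt 5 * v6)\<^sup>2 / 2))))))"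
    unfolding hess_density_def v6_def v4_def using s
    by (simp add: char_density_cond_normal int char_density_normal zero_prod_def)
  also have "\<dots> = complex_of_real (exp (- (s / sqrt 6 * u1)\<^sup>2 / 2 + (- (s / sqrt 15 * u2)\<^sup>2 / 2 +
    (- (s / sqrt 15 * u3)\<^sup>2 / 2 + (- (s * sqrt (8/45) * v4)\<^sup>2 / 2 + (- (s / sqrt 15 * u5)\<^sup>2 / 2 - (s / sqrt 5 * v6)\<^sup>2 / 2))))))"
    by (simp add: exp_add[symmetric] of_real_mult[symmetric] del: of_real_mult)
  also have "- (s / sqrt 6 * u1)\<^sup>2 / 2 + (- (s / sqrt 15 * u2)\<^sup>2 / 2 +
    (- (s / sqrt 15 * u3)\<^sup>2 / 2 + (- (s * sqrt (8/45) * v4)\<^sup>2 / 2 + (- (s / sqrt 15 * u5)\<^sup>2 / 2 - (s / sqrt 5 * v6)\<^sup>2 / 2))))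
    = - (s\<^sup>2 / 6 * u1\<^sup>2 + s\<^sup>2 / 15 * u2\<^sup>2 + s\<^sup>2 / 15 * u3\<^sup>2 + s\<^sup>2 * (8/45) * v4\<^sup>2 + s\<^sup>2 / 15 * u5\<^sup>2 + s\<^sup>2 / 5 * v6\<^sup>2) / 2"
    unfolding power_mult_distrib power_divide real_sqrt_pow2_iff by simp
  also have "s\<^sup>2 / 6 * u1\<^sup>2 + s\<^sup>2 / 15 * u2\<^sup>2 + s\<^sup>2 / 15 * u3\<^sup>2 + s\<^sup>2 * (8/45) * v4\<^sup>2 + s\<^sup>2 / 15 * u5\<^sup>2 + s\<^sup>2 / 5 * v6\<^sup>2
    = s\<^sup>2 / 15 * (3 * u1\<^sup>2 + 3 * u4\<^sup>2 + 3 * u6\<^sup>2 + 2 * u1 * u4 + 2 * u1 * u6 + 2 * u4 * u6 + u2\<^sup>2 + u3\<^sup>2 + u5\<^sup>2)"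
    unfolding v6_def v4_def by (simp add: field_simps power2_eq_square)
  finally show ?thesis .
qed

lemma field_density_properties:
  assumes s1: "0 < s1" and s: "0 < s" and \<gamma>: "\<bar>\<gamma>\<bar> < 1"
  shows "integrable lborel (field_density \<gamma> s1 s)"
    and "continuous_on UNIV (field_density \<gamma> s1 s)"
    and "char_density (field_density \<gamma> s1 s) (w, v, u1, u2, u3, u4, u5, u6) = complex_of_real (exp (-
      (w\<^sup>2 + 2 / 3 * \<gamma> * s * w * (u1 + u4 + u6) + s1\<^sup>2 / 3 * (v \<bullet> v) + s\<^sup>2 / 15 *
      (3 * u1\<^sup>2 + 3 * u4\<^sup>2 + 3 * u6\<^sup>2 + 2 * u1 * u4 + 2 * u1 * u6 + 2 * u4 * u6 + u2\<^sup>2 + u3\<^sup>2 + u5\<^sup>2)) / 2))"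
proof -
  let ?V = "\<lambda>a d f. 3 * a\<^sup>2 + 3 * d\<^sup>2 + 3 * f\<^sup>2 + 2 * a * d + 2 * a * f + 2 * d * f + u2\<^sup>2 + u3\<^sup>2 + u5\<^sup>2"
  have \<gamma>2: "1 - \<gamma>\<^sup>2 > 0" using \<gamma> by (simp add: abs_square_less_1)
  let ?g = "\<lambda>(v :: real^3, h). iso_normal_density (s1 / sqrt 3) v * hess_density s h"
  have iso: "integrable lborel (iso_normal_density (s1 / sqrt 3) :: real^3 \<Rightarrow> real)"
    using s1 by (intro integrable_iso_normal_density) auto
  note hess = integrable_hess_density[OF s]
  have g: "integrable lborel ?g" by (rule char_density_product(1)[OF iso hess])
  show "integrable lborel (field_density \<gamma> s1 s)"
    unfolding field_density_def using g \<gamma>2 by (intro integrable_cond_normal) auto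
  have "continuous_on UNIV ?g"
  proof -
    have "continuous_on UNIV (iso_normal_density (s1 / sqrt 3) :: real^3 \<Rightarrow> real)"
      unfolding iso_normal_density_def[abs_def] normal_density_def using s1 by (intro continuous_intros) auto
    then have 1: "continuous_on UNIV (\<lambda>z. iso_normal_density (s1 / sqrt 3) (fst z :: real^3))"
      by (rule continuous_on_compose2) (auto intro: continuous_intros)
    have 2: "continuous_on UNIV (\<lambda>z. hess_density s (snd z))"
      by (rule continuous_on_compose2[OF continuous_on_hess_density[OF s]]) (auto intro: continuous_intros)
    show ?thesis unfolding case_prod_beta' by (rule continuous_on_mult[OF 1 2])
  qed
  then show "continuous_on UNIV (field_density \<gamma> s1 s)"
    unfolding field_density_def using \<gamma>2 by (intro continuous_on_cond_normal) auto
  \<comment> \<open>The shift of each diagonal argument. The covariance form at (c, c, c) is s^2 c^2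
    = \<gamma>^2 w^2, which completes (1 - \<gamma>^2) w^2 to w^2; its cross terms give the
    covariance of height and trace.\<close>
  define c where "c = w * \<gamma> / s"
  have "char_density (field_density \<gamma> s1 s) (w, v, u1, u2, u3, u4, u5, u6) =
    complex_of_real (exp (- (sqrt (1 - \<gamma>\<^sup>2) * w)\<^sup>2 / 2)) * char_density ?g (v, u1 + c, u2, u3, u4 + c, u5, u6 + c)"
    unfolding field_density_def using g \<gamma>2 by (subst char_density_cond_normal) (auto simp: c_def)
  also have "char_density ?g (v, u1 + c, u2, u3, u4 + c, u5, u6 + c) =
    char_density (iso_normal_density (s1 / sqrt 3)) v * char_density (hess_density s) (u1 + c, u2, u3, u4 + c, u5, u6 + c)"
    by (rule char_density_product(2)[OF iso hess])
  also have "char_density (iso_normal_density (s1 / sqrt 3)) v = complex_of_real (exp (- (s1 / sqrt 3 * norm v)\<^sup>2 / 2))"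
    unfolding char_density_def using s1 by (intro integral_cis_iso_normal_density) auto
  also have "(s1 / sqrt 3 * norm v)\<^sup>2 = s1\<^sup>2 / 3 * (v \<bullet> v)"
    by (simp add: power_mult_distrib power_divide power2_norm_eq_inner)
  also have "(sqrt (1 - \<gamma>\<^sup>2) * w)\<^sup>2 = (1 - \<gamma>\<^sup>2) * w\<^sup>2"
    using \<gamma>2 by (simp add: power_mult_distrib)
  also note char_density_hess_density[OF s]
  also have "complex_of_real (exp (- ((1 - \<gamma>\<^sup>2) * w\<^sup>2) / 2)) * (complex_of_real (exp (- (s1\<^sup>2 / 3 * (v \<bullet> v)) / 2)) *
     complex_of_real (exp (- (s\<^sup>2 / 15 * (?V (u1 + c) (u4 + c) (u6 + c))) / 2)))
    = complex_of_real (exp (- ((1 - \<gamma>\<^sup>2) * w\<^sup>2) / 2 + (- (s1\<^sup>2 / 3 * (v \<bullet> v)) / 2 +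
       - (s\<^sup>2 / 15 * (?V (u1 + c) (u4 + c) (u6 + c))) / 2)))"
    by (simp only: exp_add of_real_mult)
  also have "- ((1 - \<gamma>\<^sup>2) * w\<^sup>2) / 2 + (- (s1\<^sup>2 / 3 * (v \<bullet> v)) / 2 +
       - (s\<^sup>2 / 15 * (?V (u1 + c) (u4 + c) (u6 + c))) / 2)
    = - (w\<^sup>2 + 2 / 3 * \<gamma> * s * w * (u1 + u4 + u6) + s1\<^sup>2 / 3 * (v \<bullet> v) + s\<^sup>2 / 15 *
      (?V u1 u4 u6)) / 2"
    using s unfolding c_def by (simp add: field_simps power2_eq_square)
  finally show "char_density (field_density \<gamma> s1 s) (w, v, u1, u2, u3, u4, u5, u6) = complex_of_real (exp (-
      (w\<^sup>2 + 2 / 3 * \<gamma> * s * w * (u1 + u4 + u6) + s1\<^sup>2 / 3 * (v \<bullet> v) + s\<^sup>2 / 15 *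
      (?V u1 u4 u6)) / 2))" .
qed

text \<open>Stating the variance as a second moment removes the standard deviation hidden in
  \<open>centered_gaussian\<close> and treats the point mass at 0 on the same footing.\<close>

lemma centered_gaussian_char:
  assumes "centered_gaussian M Y"
  shows "integrable M (\<lambda>\<omega>. (Y \<omega>)\<^sup>2)"
    and "(\<integral>\<omega>. cis (Y \<omega>) \<partial>M) = complex_of_real (exp (- (\<integral>\<omega>. (Y \<omega>)\<^sup>2 \<partial>M) / 2))"
proof -
  from assms obtain s where Y [measurable]: "Y \<in> borel_measurable M" and s: "s \<ge> 0"
    and d: "distr M borel Y = (if s = 0 then return borel 0 else density lborel (\<lambda>x. ennreal (normal_density 0 s x)))"
    unfolding centered_gaussian_def by blast
  have "(\<lambda>x. iexp x) \<in> borel_measurable borel" by measurable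
  moreover have "cis = (\<lambda>x. iexp x)" by (simp add: fun_eq_iff cis_conv_exp)
  ultimately have [measurable]: "cis \<in> borel_measurable borel" by simp
  have cis: "(\<integral>\<omega>. cis (Y \<omega>) \<partial>M) = (\<integral>x. cis x \<partial>distr M borel Y)"
    by (subst integral_distr) (auto simp: cis_conv_exp)
  have sq: "(\<integral>\<omega>. (Y \<omega>)\<^sup>2 \<partial>M) = (\<integral>x. x\<^sup>2 \<partial>distr M borel Y)"
    by (subst integral_distr) auto
  have sqi: "integrable M (\<lambda>\<omega>. (Y \<omega>)\<^sup>2) \<longleftrightarrow> integrable (distr M borel Y) (\<lambda>x. x\<^sup>2)"
    by (subst integrable_distr_eq) auto
  have "integrable (distr M borel Y) (\<lambda>x. x\<^sup>2) \<and> (\<integral>x. x\<^sup>2 \<partial>distr M borel Y) = s\<^sup>2 \<and>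
    (\<integral>x. cis x \<partial>distr M borel Y) = complex_of_real (exp (- s\<^sup>2 / 2))"
  proof (cases "s = 0")
    case True
    have "integrable (return borel (0::real)) (\<lambda>x. x\<^sup>2)"
      by (simp add: integrable_iff_bounded nn_integral_return)
    moreover have "(\<integral>x. cis x \<partial>return borel (0::real)) = 1"
      by (subst integral_return) (auto simp: cis_conv_exp)
    ultimately show ?thesis using True d by (simp add: integral_return)
  next
    case False
    with s have s: "s > 0" by simp
    have mom: "has_bochner_integral lborel (\<lambda>x. normal_density 0 s x * x\<^sup>2) (s\<^sup>2)"
      using normal_moment_even[OF s, of 0 1] by (simp add: power2_eq_square)
    have "(\<integral>x. cis x \<partial>density lborel (\<lambda>x. ennreal (normal_density 0 s x))) = (\<integral>x. normal_density 0 s x *\<^sub>R cis x \<partial>lborel)"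
      by (subst integral_density) (auto simp: cis_conv_exp)
    also have "\<dots> = char_density (normal_density 0 s) 1"
      unfolding char_density_def by (simp add: scaleR_conv_of_real mult.commute)
    finally have "(\<integral>x. cis x \<partial>density lborel (\<lambda>x. ennreal (normal_density 0 s x))) = complex_of_real (exp (- s\<^sup>2 / 2))"
      by (simp add: char_density_normal[OF s])
    then show ?thesis
      using mom s d by (simp add: integrable_density integral_density has_bochner_integral_iff)
  qed
  then show "integrable M (\<lambda>\<omega>. (Y \<omega>)\<^sup>2)"
    and "(\<integral>\<omega>. cis (Y \<omega>) \<partial>M) = complex_of_real (exp (- (\<integral>\<omega>. (Y \<omega>)\<^sup>2 \<partial>M) / 2))"
    unfolding cis sq sqi by auto
qed

lemma second_moment_sum:
  fixes X :: "'i \<Rightarrow> 'a \<Rightarrow> real"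
  assumes [measurable]: "\<And>i. i \<in> I \<Longrightarrow> X i \<in> borel_measurable M"
    and sq: "\<And>i. i \<in> I \<Longrightarrow> integrable M (\<lambda>\<omega>. (X i \<omega>)\<^sup>2)"
  shows "(\<integral>\<omega>. (\<Sum>i\<in>I. c i * X i \<omega>)\<^sup>2 \<partial>M) = (\<Sum>i\<in>I. \<Sum>j\<in>I. c i * c j * (\<integral>\<omega>. X i \<omega> * X j \<omega> \<partial>M))"
proof -
  have int: "integrable M (\<lambda>\<omega>. X i \<omega> * X j \<omega>)" if "i \<in> I" "j \<in> I" for i j
  proof (rule Bochner_Integration.integrable_bound)
    show "integrable M (\<lambda>\<omega>. (X i \<omega>)\<^sup>2 + (X j \<omega>)\<^sup>2)" using sq that by simp
    \<comment> \<open>Domination of products by squares: integrability of the X i squared makes all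
      mixed moments integrable.\<close>
    have "\<bar>x * y\<bar> \<le> \<bar>x\<^sup>2 + y\<^sup>2\<bar>" for x y :: real
    proof -
      have "2 * (\<bar>x\<bar> * \<bar>y\<bar>) \<le> x\<^sup>2 + y\<^sup>2"
        using sum_squares_bound[of "\<bar>x\<bar>" "\<bar>y\<bar>"] by (simp add: mult.assoc)
      moreover have "0 \<le> \<bar>x\<bar> * \<bar>y\<bar>" by simp
      ultimately show ?thesis unfolding abs_mult by linarith
    qed
    then show "AE \<omega> in M. norm (X i \<omega> * X j \<omega>) \<le> norm ((X i \<omega>)\<^sup>2 + (X j \<omega>)\<^sup>2)" by simp
  qed (use that in measurable)
  have "(\<Sum>i\<in>I. c i * X i \<omega>)\<^sup>2 = (\<Sum>i\<in>I. \<Sum>j\<in>I. c i * c j * (X i \<omega> * X j \<omega>))" for \<omega>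
    by (simp add: power2_eq_square sum_product mult_ac)
  then show ?thesis using int by simp
qed

section \<open>The peak density\<close>

lemma normal_density_eq:
  "0 < s \<Longrightarrow> normal_density m s x = 1 / (sqrt (2 * pi) * s) * exp (- ((x - m)\<^sup>2 / s\<^sup>2 / 2))"
  by (simp add: normal_density_def real_sqrt_mult)

text \<open>The entrywise chain hides the isotropy. Its squares add up to the trace part (e1 / s)^2
  and a multiple of e1^2 - 3 e2, the squared norm of the traceless part up to a factor. The constant
  is the product of the reciprocal conditional deviations, and 6 * 15^3 * 5 * 45/8 = (675/2)^2 *
  5.\<close>

lemma hess_density_eq:
  assumes s: "0 < s"
  shows "hess_density s (a, b, c, d, e, f) = 675 / 2 * sqrt 5 / (sqrt (2 * pi) ^ 6 * s ^ 6) *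
    exp (- ((a + d + f)\<^sup>2 / s\<^sup>2 / 2 + 5/2 * ((a + d + f)\<^sup>2 - 3 * ((a * d - b\<^sup>2) + (a * f - c\<^sup>2) + (d * f - e\<^sup>2))) / s\<^sup>2))"
proof -
  define T where "T = sqrt (2 * pi)"
  have T: "T > 0" by (simp add: T_def)
  have q: "(s / sqrt 6)\<^sup>2 = s\<^sup>2 / 6" "(s / sqrt 15)\<^sup>2 = s\<^sup>2 / 15" "(s * sqrt (8/45))\<^sup>2 = s\<^sup>2 * (8/45)" "(s / sqrt 5)\<^sup>2 = s\<^sup>2 / 5"
    by (simp_all add: power_divide power_mult_distrib)
  have pos: "0 < s / sqrt 6" "0 < s / sqrt 15" "0 < s * sqrt (8/45)" "0 < s / sqrt 5"
    using s by simp_all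
  have "hess_density s (a, b, c, d, e, f) =
    (1 / (T * (s / sqrt 6)) * (1 / (T * (s / sqrt 15)) * (1 / (T * (s / sqrt 15)) * (1 / (T * (s * sqrt (8/45))) *
      (1 / (T * (s / sqrt 15)) * (1 / (T * (s / sqrt 5)))))))) *
    (exp (- ((a - (d / 4 + f / 4))\<^sup>2 / (s\<^sup>2 / 6) / 2)) * (exp (- (b\<^sup>2 / (s\<^sup>2 / 15) / 2)) * (exp (- (c\<^sup>2 / (s\<^sup>2 / 15) / 2)) *
     (exp (- ((d - f / 3)\<^sup>2 / (s\<^sup>2 * (8/45)) / 2)) * (exp (- (e\<^sup>2 / (s\<^sup>2 / 15) / 2)) * exp (- (f\<^sup>2 / (s\<^sup>2 / 5) / 2)))))))"
    unfolding hess_density_def cond_normal_apply normal_density_eq[OF pos(1)] normal_density_eq[OF pos(2)]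
      normal_density_eq[OF pos(3)] normal_density_eq[OF pos(4)] q T_def[symmetric]
    by simp
  also have "exp (- ((a - (d / 4 + f / 4))\<^sup>2 / (s\<^sup>2 / 6) / 2)) * (exp (- (b\<^sup>2 / (s\<^sup>2 / 15) / 2)) * (exp (- (c\<^sup>2 / (s\<^sup>2 / 15) / 2)) *
     (exp (- ((d - f / 3)\<^sup>2 / (s\<^sup>2 * (8/45)) / 2)) * (exp (- (e\<^sup>2 / (s\<^sup>2 / 15) / 2)) * exp (- (f\<^sup>2 / (s\<^sup>2 / 5) / 2))))))
    = exp (- ((a - (d / 4 + f / 4))\<^sup>2 / (s\<^sup>2 / 6) / 2) + (- (b\<^sup>2 / (s\<^sup>2 / 15) / 2) + (- (c\<^sup>2 / (s\<^sup>2 / 15) / 2) +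
     (- ((d - f / 3)\<^sup>2 / (s\<^sup>2 * (8/45)) / 2) + (- (e\<^sup>2 / (s\<^sup>2 / 15) / 2) + - (f\<^sup>2 / (s\<^sup>2 / 5) / 2))))))"
    by (simp only: exp_add)
  also have "- ((a - (d / 4 + f / 4))\<^sup>2 / (s\<^sup>2 / 6) / 2) + (- (b\<^sup>2 / (s\<^sup>2 / 15) / 2) + (- (c\<^sup>2 / (s\<^sup>2 / 15) / 2) +
     (- ((d - f / 3)\<^sup>2 / (s\<^sup>2 * (8/45)) / 2) + (- (e\<^sup>2 / (s\<^sup>2 / 15) / 2) + - (f\<^sup>2 / (s\<^sup>2 / 5) / 2)))))
    = - ((a + d + f)\<^sup>2 / s\<^sup>2 / 2 + 5/2 * ((a + d + f)\<^sup>2 - 3 * ((a * d - b\<^sup>2) + (a * f - c\<^sup>2) + (d * f - e\<^sup>2))) / s\<^sup>2)"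
    using s by (simp add: field_simps power2_eq_square)
  also have "1 / (T * (s / sqrt 6)) * (1 / (T * (s / sqrt 15)) * (1 / (T * (s / sqrt 15)) * (1 / (T * (s * sqrt (8/45))) *
      (1 / (T * (s / sqrt 15)) * (1 / (T * (s / sqrt 5)))))))
    = (sqrt 6 * sqrt 15 * sqrt 15 * (1 / sqrt (8/45)) * sqrt 15 * sqrt 5) / (T ^ 6 * s ^ 6)"
    using s T by (simp add: field_simps eval_nat_numeral)
  also have "sqrt 6 * sqrt 15 * sqrt 15 * (1 / sqrt (8/45)) * sqrt 15 * sqrt 5 = 675 / 2 * sqrt 5"
  proof -
    have "sqrt 6 * sqrt 15 * sqrt 15 * (1 / sqrt (8/45)) * sqrt 15 * sqrt 5 = sqrt (6 * 15 * 15 * (45/8) * 15 * 5)"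
      by (simp only: real_sqrt_mult real_sqrt_divide) simp
    also have "6 * 15 * 15 * (45/8) * 15 * 5 = (675 / 2)\<^sup>2 * (5::real)"
      by (simp add: power2_eq_square)
    finally show ?thesis by (simp add: real_sqrt_mult)
  qed
  finally show ?thesis unfolding T_def .
qed

lemma field_density_at_critical_point:
  fixes \<gamma> s1 s \<nu> :: real
  assumes s1: "0 < s1" and s: "0 < s" and \<gamma>: "\<bar>\<gamma>\<bar> < 1"
  defines "w \<equiv> \<lambda>x. exp (- ((x - \<gamma> * \<nu>)\<^sup>2 / (2 * (1 - \<gamma>\<^sup>2))))"
  defines "C \<equiv> 1 / sqrt (2 * pi * (1 - \<gamma>\<^sup>2)) * (sqrt 3 / (sqrt (2 * pi) * s1)) ^ 3 * (675 / 2 * sqrt 5 / (sqrt (2 * pi) ^ 6 * s ^ 6))"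
  shows "field_density \<gamma> s1 s (\<nu>, 0, a, b, c, d, e, f) = C * exp (- (\<nu>\<^sup>2) / 2) *
    (exp (- (5/2) * ((a + d + f)\<^sup>2 - 3 * ((a * d - b\<^sup>2) + (a * f - c\<^sup>2) + (d * f - e\<^sup>2))) / s\<^sup>2) * w ((a + d + f) / s))"
proof -
  have \<gamma>2: "1 - \<gamma>\<^sup>2 > 0" using \<gamma> by (simp add: abs_square_less_1)
  define x where "x = (a + d + f) / s"
  define E where "E = ((a + d + f)\<^sup>2 - 3 * ((a * d - b\<^sup>2) + (a * f - c\<^sup>2) + (d * f - e\<^sup>2))) / s\<^sup>2"
  have iso: "iso_normal_density (s1 / sqrt 3) (0 :: real^3) = (sqrt 3 / (sqrt (2 * pi) * s1)) ^ 3"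
    unfolding iso_normal_density_def using s1 by (simp add: normal_density_eq)
  have "field_density \<gamma> s1 s (\<nu>, 0, a, b, c, d, e, f) =
    normal_density (\<gamma> * x) (sqrt (1 - \<gamma>\<^sup>2)) \<nu> * ((sqrt 3 / (sqrt (2 * pi) * s1)) ^ 3 * hess_density s (a, b, c, d, e, f))"
    unfolding field_density_def cond_normal_apply prod.case iso
    by (simp add: x_def inner_Pair distrib_left add_divide_distrib add.assoc)
  also have "normal_density (\<gamma> * x) (sqrt (1 - \<gamma>\<^sup>2)) \<nu> = 1 / sqrt (2 * pi * (1 - \<gamma>\<^sup>2)) * exp (- ((\<nu> - \<gamma> * x)\<^sup>2 / (1 - \<gamma>\<^sup>2) / 2))"
    using \<gamma>2 by (simp add: normal_density_eq real_sqrt_mult)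
  also have "hess_density s (a, b, c, d, e, f) = 675 / 2 * sqrt 5 / (sqrt (2 * pi) ^ 6 * s ^ 6) * exp (- (x\<^sup>2 / 2 + 5/2 * E))"
    unfolding hess_density_eq[OF s] x_def E_def by (simp add: power_divide)
  also have "1 / sqrt (2 * pi * (1 - \<gamma>\<^sup>2)) * exp (- ((\<nu> - \<gamma> * x)\<^sup>2 / (1 - \<gamma>\<^sup>2) / 2)) * ((sqrt 3 / (sqrt (2 * pi) * s1)) ^ 3 *
      (675 / 2 * sqrt 5 / (sqrt (2 * pi) ^ 6 * s ^ 6) * exp (- (x\<^sup>2 / 2 + 5/2 * E))))
    = C * exp (- ((\<nu> - \<gamma> * x)\<^sup>2 / (1 - \<gamma>\<^sup>2) / 2) + - (x\<^sup>2 / 2 + 5/2 * E))"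
    unfolding C_def exp_add by (simp only: ac_simps)
  also have "- ((\<nu> - \<gamma> * x)\<^sup>2 / (1 - \<gamma>\<^sup>2) / 2) + - (x\<^sup>2 / 2 + 5/2 * E)
    = - (\<nu>\<^sup>2) / 2 + (- (5/2) * E + - ((x - \<gamma> * \<nu>)\<^sup>2 / (2 * (1 - \<gamma>\<^sup>2))))"
  proof -
    \<comment> \<open>For a standard normal pair with correlation \<gamma>, the law of \<nu> given x
      times that of x is the law of x given \<nu> times that of \<nu>. Exchanging the roles yields
      exp (- \<nu>^2 / 2) and the Gaussian kernel of \<open>peak_G\<close>.\<close>
    have "(\<nu> - \<gamma> * x)\<^sup>2 + x\<^sup>2 * (1 - \<gamma>\<^sup>2) = (x - \<gamma> * \<nu>)\<^sup>2 + \<nu>\<^sup>2 * (1 - \<gamma>\<^sup>2)"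
      by (simp add: algebra_simps power2_eq_square)
    then have "((\<nu> - \<gamma> * x)\<^sup>2 + x\<^sup>2 * (1 - \<gamma>\<^sup>2)) / (1 - \<gamma>\<^sup>2) = ((x - \<gamma> * \<nu>)\<^sup>2 + \<nu>\<^sup>2 * (1 - \<gamma>\<^sup>2)) / (1 - \<gamma>\<^sup>2)"
      by simp
    then have "(\<nu> - \<gamma> * x)\<^sup>2 / (1 - \<gamma>\<^sup>2) + x\<^sup>2 = (x - \<gamma> * \<nu>)\<^sup>2 / (1 - \<gamma>\<^sup>2) + \<nu>\<^sup>2"
      unfolding add_divide_distrib using \<gamma>2 by simp
    then have "- ((\<nu> - \<gamma> * x)\<^sup>2 / (1 - \<gamma>\<^sup>2) / 2) + - (x\<^sup>2 / 2 + 5/2 * E)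
      = - (\<nu>\<^sup>2) / 2 + (- (5/2) * E + - ((x - \<gamma> * \<nu>)\<^sup>2 / (1 - \<gamma>\<^sup>2) / 2))"
    proof -
      have "- (p / 2) + - (y / 2 + 5/2 * E) = - n / 2 + (- (5/2) * E + - (q / 2))" if "p + y = q + n" for p q y n :: real
        using that by linarith
      from this[OF \<open>(\<nu> - \<gamma> * x)\<^sup>2 / (1 - \<gamma>\<^sup>2) + x\<^sup>2 = (x - \<gamma> * \<nu>)\<^sup>2 / (1 - \<gamma>\<^sup>2) + \<nu>\<^sup>2\<close>]
      show ?thesis .
    qed
    moreover have "(x - \<gamma> * \<nu>)\<^sup>2 / (2 * (1 - \<gamma>\<^sup>2)) = (x - \<gamma> * \<nu>)\<^sup>2 / (1 - \<gamma>\<^sup>2) / 2"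
      by (simp only: divide_divide_eq_left mult.commute)
    ultimately show ?thesis by (simp only:)
  qed
  also have "C * exp (- (\<nu>\<^sup>2) / 2 + (- (5/2) * E + - ((x - \<gamma> * \<nu>)\<^sup>2 / (2 * (1 - \<gamma>\<^sup>2)))))
    = C * exp (- (\<nu>\<^sup>2) / 2) * (exp (- (5/2) * E) * w x)"
    unfolding w_def exp_add by (simp only: mult.assoc)
  finally show ?thesis unfolding x_def E_def by simp
qed

lemma nn_integral_lborel_pair:
  fixes f :: "'a::euclidean_space \<times> 'b::euclidean_space \<Rightarrow> ennreal"
  assumes "f \<in> borel_measurable borel"
  shows "(\<integral>\<^sup>+z. f z \<partial>lborel) = (\<integral>\<^sup>+x. (\<integral>\<^sup>+y. f (x, y) \<partial>lborel) \<partial>lborel)"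
  unfolding lborel_prod[symmetric]
  by (rule lborel.nn_integral_fst[symmetric]) (use assms in \<open>simp add: lborel_prod\<close>)

lemma nn_integral_lborel_sym3:
  fixes f :: "sym3 \<Rightarrow> ennreal"
  assumes [measurable]: "f \<in> borel_measurable borel"
  shows "(\<integral>\<^sup>+h. f h \<partial>lborel) = (\<integral>\<^sup>+a. (\<integral>\<^sup>+b. (\<integral>\<^sup>+c. (\<integral>\<^sup>+d. (\<integral>\<^sup>+e. (\<integral>\<^sup>+g. f (a, b, c, d, e, g)
    \<partial>lborel) \<partial>lborel) \<partial>lborel) \<partial>lborel) \<partial>lborel) \<partial>lborel)"
  by (subst nn_integral_lborel_pair, measurable, rule nn_integral_cong)+
    (subst nn_integral_lborel_pair, measurable)

lemma peak_density_field_density: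
  fixes \<gamma> s1 s \<nu> :: real
  assumes s1: "0 < s1" and s: "0 < s" and \<gamma>: "\<bar>\<gamma>\<bar> < 1"
  defines "R \<equiv> sqrt 3 * s1 / s"
  shows "peak_density (field_density \<gamma> s1 s) \<nu> =
    1 / ((2 * pi) ^ 2 * R ^ 3) * exp (- (\<nu> ^ 2) / 2) * peak_G \<gamma> (\<gamma> * \<nu>)"
proof -
  have \<gamma>2: "1 - \<gamma>\<^sup>2 > 0" using \<gamma> by (simp add: abs_square_less_1)
  define w where "w x = exp (- ((x - \<gamma> * \<nu>)\<^sup>2 / (2 * (1 - \<gamma>\<^sup>2))))" for x
  define B where "B = 1 / sqrt (2 * pi * (1 - \<gamma>\<^sup>2))"
  define C where "C = B * (sqrt 3 / (sqrt (2 * pi) * s1)) ^ 3 * (675 / 2 * sqrt 5 / (sqrt (2 * pi) ^ 6 * s ^ 6))"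
  define r where "r = sqrt (5 / (2 * pi))"
  have pos: "B > 0" "C > 0" "r > 0" using s s1 \<gamma>2 by (auto simp: B_def C_def r_def)
  have wm [measurable]: "w \<in> borel_measurable borel" unfolding w_def[abs_def] by measurable
  define I where "I = (\<integral>\<^sup>+x. (if 0 < x then ennreal (peak_f x * w x) else 0) \<partial>lborel)"
  define \<Psi> where "\<Psi> = (\<lambda>(e1, e2, e3). if 0 < e1 \<and> 0 < e2 \<and> 0 < e3
    then ennreal (e3 * (exp (- (5/2) * (e1\<^sup>2 - 3 * e2) / s\<^sup>2) * w (e1 / s))) else 0)"
  define H where "H = (\<lambda>h. indicator {h. sym_matrix h \<in> pos_def_matrices} h *
    (\<bar>det (sym_matrix h)\<bar> * field_density \<gamma> s1 s (\<nu>, 0, h)))"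
  have q: "field_density \<gamma> s1 s (\<nu>, 0, a, b, c, d, e, f) = C * exp (- (\<nu>\<^sup>2) / 2) *
    (exp (- (5/2) * ((a + d + f)\<^sup>2 - 3 * ((a * d - b\<^sup>2) + (a * f - c\<^sup>2) + (d * f - e\<^sup>2))) / s\<^sup>2) * w ((a + d + f) / s))"
    for a b c d e f
    unfolding w_def C_def B_def by (rule field_density_at_critical_point[OF s1 s \<gamma>])
  have H_eq: "H (a, b, c, d, e, f) = (if 0 < a + d + f \<and> 0 < (a * d - b\<^sup>2) + (a * f - c\<^sup>2) + (d * f - e\<^sup>2) \<and>
      0 < a * (d * f - e\<^sup>2) - b * (b * f - c * e) + c * (b * e - c * d)
    then C * exp (- (\<nu>\<^sup>2) / 2) * ((a * (d * f - e\<^sup>2) - b * (b * f - c * e) + c * (b * e - c * d)) *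
      (exp (- (5/2) * ((a + d + f)\<^sup>2 - 3 * ((a * d - b\<^sup>2) + (a * f - c\<^sup>2) + (d * f - e\<^sup>2))) / s\<^sup>2) * w ((a + d + f) / s)))
    else 0)" for a b c d e f
    unfolding H_def indicator_def mem_Collect_eq sym_matrix_pos_def_iff det_sym_matrix q
    by (simp del: sym_matrix.simps)
  have H0: "0 \<le> H h" for h
    by (cases h) (use pos in \<open>auto simp: H_eq w_def intro!: mult_nonneg_nonneg\<close>)
  have "(\<lambda>(a, b, c, d, e, f). H (a, b, c, d, e, f)) \<in> borel_measurable
    (borel \<Otimes>\<^sub>M (borel \<Otimes>\<^sub>M (borel \<Otimes>\<^sub>M (borel \<Otimes>\<^sub>M (borel \<Otimes>\<^sub>M borel)))))"
    unfolding H_eq by measurable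
  then have Hm [measurable]: "H \<in> borel_measurable borel"
    by (simp add: borel_prod case_prod_beta')
  let ?F = "\<lambda>a b c d e f. \<Psi> (a + d + f, (a * d - b\<^sup>2) + (a * f - c\<^sup>2) + (d * f - e\<^sup>2),
      a * (d * f - e\<^sup>2) - b * (b * f - c * e) + c * (b * e - c * d))"
  have H\<Psi>: "ennreal (H (a, b, c, d, e, f)) = ennreal (C * exp (- (\<nu>\<^sup>2) / 2)) *
      ?F a b c d e f" for a b c d e f
    unfolding H_eq \<Psi>_def prod.case using pos by (simp add: ennreal_mult' split del: if_split cong: if_cong)
      (simp add: w_def ennreal_mult')
  have "\<Psi> \<in> borel_measurable (borel \<Otimes>\<^sub>M (borel \<Otimes>\<^sub>M borel))"
    unfolding \<Psi>_def by measurable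
  then have \<Psi>m [measurable]: "\<Psi> \<in> borel_measurable borel"
    by (simp only: borel_prod)
  have "(\<integral>\<^sup>+h. ennreal (H h) \<partial>lborel) = (\<integral>\<^sup>+a. (\<integral>\<^sup>+b. (\<integral>\<^sup>+c. (\<integral>\<^sup>+d. (\<integral>\<^sup>+e. (\<integral>\<^sup>+f. ennreal (C * exp (- (\<nu>\<^sup>2) / 2)) *
      ?F a b c d e f \<partial>lborel) \<partial>lborel) \<partial>lborel) \<partial>lborel) \<partial>lborel) \<partial>lborel)"
    unfolding H\<Psi>[symmetric] by (rule nn_integral_lborel_sym3) measurable
  also have "\<dots> = ennreal (C * exp (- (\<nu>\<^sup>2) / 2)) * (\<integral>\<^sup>+a. (\<integral>\<^sup>+b. (\<integral>\<^sup>+c. (\<integral>\<^sup>+d. (\<integral>\<^sup>+e. (\<integral>\<^sup>+f.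
      ?F a b c d e f \<partial>lborel) \<partial>lborel) \<partial>lborel) \<partial>lborel) \<partial>lborel) \<partial>lborel)"
    by (simp add: nn_integral_cmult)
  also have "(\<integral>\<^sup>+a. (\<integral>\<^sup>+b. (\<integral>\<^sup>+c. (\<integral>\<^sup>+d. (\<integral>\<^sup>+e. (\<integral>\<^sup>+f.
      ?F a b c d e f \<partial>lborel) \<partial>lborel) \<partial>lborel) \<partial>lborel) \<partial>lborel) \<partial>lborel) = ennreal (8 * pi\<^sup>2 * s ^ 9 / (18225 * r)) * I"
    unfolding \<Psi>_def I_def r_def by (rule nn_integral_pos_def_det_gaussian[OF wm _ s]) (simp add: w_def)
  finally have nnH: "(\<integral>\<^sup>+h. ennreal (H h) \<partial>lborel) = ennreal (C * exp (- (\<nu>\<^sup>2) / 2)) * (ennreal (8 * pi\<^sup>2 * s ^ 9 / (18225 * r)) * I)" .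
  have "peak_density (field_density \<gamma> s1 s) \<nu> = (\<integral>h. H h \<partial>lborel)"
    by (simp add: peak_density_def set_lebesgue_integral_def H_def)
  \<comment> \<open>For a nonnegative measurable function this equality covers an infinite integral
    as well, by the value 0 on both sides. The same conversion is applied to \<open>peak_G\<close>
    below.\<close>
  also have "\<dots> = enn2real (\<integral>\<^sup>+h. ennreal (H h) \<partial>lborel)"
    using H0 by (intro integral_eq_nn_integral) auto
  also have "\<dots> = C * exp (- (\<nu>\<^sup>2) / 2) * (8 * pi\<^sup>2 * s ^ 9 / (18225 * r) * enn2real I)"
    unfolding nnH enn2real_mult using pos s by simp
  also have "\<dots> = (C * (8 * pi\<^sup>2 * s ^ 9 / (18225 * r))) * exp (- (\<nu>\<^sup>2) / 2) * enn2real I"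
    by simp
  also have "C * (8 * pi\<^sup>2 * s ^ 9 / (18225 * r)) = 1 / ((2 * pi) ^ 2 * R ^ 3) * B"
  proof -
    \<comment> \<open>With pi = T^2 / 2 and r = sqrt 5 / T the constants become rational in T, s, s1
      and two square roots, and the powers of T combine to T^4 = (2 pi)^2.\<close>
    define T where "T = sqrt (2 * pi)"
    have T: "T > 0" by (simp add: T_def)
    have pi: "pi = T\<^sup>2 / 2" by (simp add: T_def)
    have r: "r = sqrt 5 / T" by (simp add: r_def T_def real_sqrt_divide)
    have s3: "sqrt 3 ^ 3 = 3 * sqrt 3" by (simp add: power3_eq_cube)
    have "C * (8 * pi\<^sup>2 * s ^ 9 / (18225 * r)) = B * ((sqrt 3 ^ 3 / (T ^ 3 * s1 ^ 3)) * (675 / 2 * sqrt 5 / (T ^ 6 * s ^ 6)) *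
      (8 * (T\<^sup>2 / 2)\<^sup>2 * s ^ 9 / (18225 * (sqrt 5 / T))))"
      unfolding C_def r T_def[symmetric] pi[symmetric] by (simp add: power_divide power_mult_distrib)
    also have "(sqrt 3 ^ 3 / (T ^ 3 * s1 ^ 3)) * (675 / 2 * sqrt 5 / (T ^ 6 * s ^ 6)) *
      (8 * (T\<^sup>2 / 2)\<^sup>2 * s ^ 9 / (18225 * (sqrt 5 / T))) = sqrt 3 * s ^ 3 / (9 * T ^ 4 * s1 ^ 3)"
      unfolding s3 using T s s1 by (simp add: field_simps eval_nat_numeral)
    also have "\<dots> = 1 / ((2 * pi) ^ 2 * R ^ 3)"
    proof -
      have R3: "R ^ 3 = 3 * sqrt 3 * s1 ^ 3 / s ^ 3" unfolding R_def by (simp add: power_divide power_mult_distrib s3)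
      have T4: "(2 * pi) ^ 2 = T ^ 4" unfolding pi by (simp add: power_mult[symmetric])
      show ?thesis unfolding R3 T4 using T s s1 by (simp add: field_simps)
    qed
    finally show ?thesis by simp
  qed
  also have "1 / ((2 * pi) ^ 2 * R ^ 3) * B * exp (- (\<nu>\<^sup>2) / 2) * enn2real I
    = 1 / ((2 * pi) ^ 2 * R ^ 3) * exp (- (\<nu>\<^sup>2) / 2) * (B * enn2real I)"
    by simp
  also have "B * enn2real I = peak_G \<gamma> (\<gamma> * \<nu>)"
  proof -
    have "continuous_on UNIV erf"
      using has_real_derivative_erf by (intro continuous_at_imp_continuous_on) (auto intro: DERIV_isCont)
    then have [measurable]: "erf \<in> borel_measurable borel" by (rule borel_measurable_continuous_onI)
    have [measurable]: "peak_f \<in> borel_measurable borel" unfolding peak_f_def[abs_def] by measurable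
    \<comment> \<open>The integral for \<open>peak_G\<close> includes the endpoint 0 and the reduced
      one does not; since \<open>peak_f\<close> vanishes there, the integrands agree
      pointwise.\<close>
    have f0: "peak_f 0 = 0" by (simp add: peak_f_def)
    have nonneg: "0 \<le> indicator {0..} x * (B * (peak_f x * w x))" for x :: real
      using nn_integral_peak_f(2)[of x] f0 pos by (cases "x = 0") (auto simp: indicator_def w_def)
    have "peak_G \<gamma> (\<gamma> * \<nu>) = (\<integral>x. indicator {0..} x * (B * (peak_f x * w x)) \<partial>lborel)"
      unfolding peak_G_def set_lebesgue_integral_def B_def w_def
      by (intro Bochner_Integration.integral_cong) (auto simp: mult_ac)
    also have "\<dots> = enn2real (\<integral>\<^sup>+x. ennreal (indicator {0..} x * (B * (peak_f x * w x))) \<partial>lborel)"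
      using nonneg by (intro integral_eq_nn_integral) auto
    also have "(\<integral>\<^sup>+x. ennreal (indicator {0..} x * (B * (peak_f x * w x))) \<partial>lborel)
      = (\<integral>\<^sup>+x. ennreal B * (if 0 < x then ennreal (peak_f x * w x) else 0) \<partial>lborel)"
      using f0 pos by (intro nn_integral_cong) (auto simp: indicator_def ennreal_mult')
    also have "\<dots> = ennreal B * I"
      unfolding I_def by (rule nn_integral_cmult) measurable
    finally show ?thesis using pos by (simp add: enn2real_mult)
  qed
  finally show ?thesis .
qed

section \<open>From the covariances to the density\<close>

lemma field_variance:
  fixes M :: "'a measure" and \<delta> :: "'a \<Rightarrow> real" and \<eta> :: "'a \<Rightarrow> real ^ 3" and A :: "'a \<Rightarrow> real ^ 3 ^ 3"
  assumes gaussian: "centered_gaussian_vector M (\<lambda>\<omega>. (\<delta> \<omega>, \<eta> \<omega>, upper_entries (A \<omega>)))"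
    and dd: "(\<integral>\<omega>. (\<delta> \<omega>)\<^sup>2 \<partial>M) = s0\<^sup>2"
    and dg: "\<And>i. (\<integral>\<omega>. \<delta> \<omega> * \<eta> \<omega> $ i \<partial>M) = 0"
    and dh: "\<And>i j. (\<integral>\<omega>. \<delta> \<omega> * A \<omega> $ i $ j \<partial>M) = s1\<^sup>2 / 3 * kron i j"
    and gg: "\<And>i j. (\<integral>\<omega>. \<eta> \<omega> $ i * \<eta> \<omega> $ j \<partial>M) = s1\<^sup>2 / 3 * kron i j"
    and gh: "\<And>i j k. (\<integral>\<omega>. \<eta> \<omega> $ i * A \<omega> $ j $ k \<partial>M) = 0"
    and hh: "\<And>i j k l. (\<integral>\<omega>. A \<omega> $ i $ j * A \<omega> $ k $ l \<partial>M)
      = s\<^sup>2 / 15 * (kron i j * kron k l + kron i k * kron j l + kron i l * kron j k)"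
  shows "(\<integral>\<omega>. ((w, v, u1, u2, u3, u4, u5, u6) \<bullet> (\<delta> \<omega>, \<eta> \<omega>, upper_entries (A \<omega>)))\<^sup>2 \<partial>M) =
    s0\<^sup>2 * w\<^sup>2 + 2 / 3 * s1\<^sup>2 * w * (u1 + u4 + u6) + s1\<^sup>2 / 3 * (v \<bullet> v) + s\<^sup>2 / 15 *
      (3 * u1\<^sup>2 + 3 * u4\<^sup>2 + 3 * u6\<^sup>2 + 2 * u1 * u4 + 2 * u1 * u6 + 2 * u4 * u6 + u2\<^sup>2 + u3\<^sup>2 + u5\<^sup>2)"
proof -
  \<comment> \<open>Numbering the ten coordinates turns the variance into one finite double sum that
    expands into the given covariances.\<close>
  define X where "X i \<omega> = [\<delta> \<omega>, \<eta> \<omega> $ 1, \<eta> \<omega> $ 2, \<eta> \<omega> $ 3, A \<omega> $ 1 $ 1, A \<omega> $ 1 $ 2, A \<omega> $ 1 $ 3,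
    A \<omega> $ 2 $ 2, A \<omega> $ 2 $ 3, A \<omega> $ 3 $ 3] ! i" for i \<omega>
  define c where "c i = [w, v $ 1, v $ 2, v $ 3, u1, u2, u3, u4, u5, u6] ! i" for i
  \<comment> \<open>Unit vectors dual to the coordinates: each X i is a linear functional of the
    Gaussian vector, hence centered Gaussian and square integrable.\<close>
  define E :: "nat \<Rightarrow> real \<times> (real ^ 3) \<times> sym3" where
    "E i = [(1, 0, 0), (0, axis 1 1, 0), (0, axis 2 1, 0), (0, axis 3 1, 0), (0, 0, 1, 0, 0, 0, 0, 0), (0, 0, 0, 1, 0, 0, 0, 0),
      (0, 0, 0, 0, 1, 0, 0, 0), (0, 0, 0, 0, 0, 1, 0, 0), (0, 0, 0, 0, 0, 0, 1, 0), (0, 0, 0, 0, 0, 0, 0, 1)] ! i" for i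
  have I: "{..<10} = {0, 1, 2, 3, 4, 5, 6, 7, 8, 9::nat}" by auto
  have XE: "X i = (\<lambda>\<omega>. E i \<bullet> (\<delta> \<omega>, \<eta> \<omega>, upper_entries (A \<omega>)))" if "i \<in> {..<10}" for i
    using that unfolding I X_def E_def upper_entries_def
    by (auto simp: fun_eq_iff inner_axis')
  have gX: "centered_gaussian M (X i)" if "i \<in> {..<10}" for i
    unfolding XE[OF that] using gaussian unfolding centered_gaussian_vector_def by (rule spec)
  have "(w, v, u1, u2, u3, u4, u5, u6) \<bullet> (\<delta> \<omega>, \<eta> \<omega>, upper_entries (A \<omega>)) = (\<Sum>i<10. c i * X i \<omega>)" for \<omega>
    unfolding I c_def X_def upper_entries_def by (simp add: inner_vec_def sum_3)
  then have "(\<integral>\<omega>. ((w, v, u1, u2, u3, u4, u5, u6) \<bullet> (\<delta> \<omega>, \<eta> \<omega>, upper_entries (A \<omega>)))\<^sup>2 \<partial>M) = (\<integral>\<omega>. (\<Sum>i<10. c i * X i \<omega>)\<^sup>2 \<partial>M)"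
    by simp
  also have "\<dots> = (\<Sum>i<10. \<Sum>j<10. c i * c j * (\<integral>\<omega>. X i \<omega> * X j \<omega> \<partial>M))"
  proof (rule second_moment_sum)
    fix i :: nat assume "i \<in> {..<10}"
    from gX[OF this] show "X i \<in> borel_measurable M" "integrable M (\<lambda>\<omega>. (X i \<omega>)\<^sup>2)"
      by (simp_all add: centered_gaussian_def centered_gaussian_char(1))
  qed
  also have "\<dots> = s0\<^sup>2 * w\<^sup>2 + 2 / 3 * s1\<^sup>2 * w * (u1 + u4 + u6) + s1\<^sup>2 / 3 * (v \<bullet> v) + s\<^sup>2 / 15 *
      (3 * u1\<^sup>2 + 3 * u4\<^sup>2 + 3 * u6\<^sup>2 + 2 * u1 * u4 + 2 * u1 * u6 + 2 * u4 * u6 + u2\<^sup>2 + u3\<^sup>2 + u5\<^sup>2)"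
  proof -
    have kron: "kron (i::3) i = 1" "kron (1::3) 2 = 0" "kron (1::3) 3 = 0" "kron (2::3) 1 = 0" "kron (2::3) 3 = 0"
      "kron (3::3) 1 = 0" "kron (3::3) 2 = 0" for i
      by (simp_all add: kron_def)
    have gd: "(\<integral>\<omega>. \<eta> \<omega> $ i * \<delta> \<omega> \<partial>M) = 0" for i
      using dg[of i] by (simp add: mult.commute)
    have hd: "(\<integral>\<omega>. A \<omega> $ i $ j * \<delta> \<omega> \<partial>M) = s1\<^sup>2 / 3 * kron i j" for i j
      using dh[of i j] by (simp add: mult.commute)
    have hg: "(\<integral>\<omega>. A \<omega> $ j $ k * \<eta> \<omega> $ i \<partial>M) = 0" for i j k
      using gh[of i j k] by (simp add: mult.commute)
    have dd': "(\<integral>\<omega>. \<delta> \<omega> * \<delta> \<omega> \<partial>M) = s0\<^sup>2" using dd by (simp add: power2_eq_square)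
    show ?thesis
      unfolding I c_def X_def
      by (simp add: dd' dg gd dh hd gg gh hg hh kron inner_vec_def sum_3)
        (simp add: field_simps power2_eq_square)
  qed
  finally show ?thesis .
qed

theorem mainTheorem2:
  fixes M :: "'a measure" and \<delta> :: "real ^ 3 \<Rightarrow> 'a \<Rightarrow> real" and P :: "real \<Rightarrow> real"
    and \<sigma> :: "nat \<Rightarrow> real" and \<gamma> R \<nu> :: real and x :: "real ^ 3"
    and q :: "real \<times> (real ^ 3) \<times> sym3 \<Rightarrow> real"
  assumes prob: "prob_space M"
    and gaussian: "centered_gaussian_field M \<delta>"
    and homogeneous: "homogeneous_field M \<delta>"
    and isotropic: "isotropic_field M \<delta>"
    and smooth: "AE \<omega> in M. C2 (\<lambda>y. \<delta> y \<omega>)"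
    and spectrum: "has_power_spectrum M \<delta> P"
    and moments_finite: "\<And>j. j \<le> 2 \<Longrightarrow> set_integrable lborel {0<..} (spectral_integrand P j)"
    and moments: "\<And>j. j \<le> 2 \<Longrightarrow> (\<sigma> j) ^ 2 = (LBINT k : {0<..}. spectral_integrand P j k)"
    and moments_pos: "\<And>j. j \<le> 2 \<Longrightarrow> 0 < \<sigma> j"
    and one_point_gaussian: "\<And>y. centered_gaussian_vector M
          (\<lambda>\<omega>. (\<delta> y \<omega>, field_grad \<delta> y \<omega>, upper_entries (field_neg_hess \<delta> y \<omega>)))"
    and cov_delta_delta: "\<And>y. (\<integral>\<omega>. (\<delta> y \<omega>) ^ 2 \<partial>M) = (\<sigma> 0) ^ 2"
    and cov_delta_grad: "\<And>y i. (\<integral>\<omega>. \<delta> y \<omega> * field_grad \<delta> y \<omega> $ i \<partial>M) = 0"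
    and cov_delta_hess: "\<And>y i j. (\<integral>\<omega>. \<delta> y \<omega> * field_neg_hess \<delta> y \<omega> $ i $ j \<partial>M)
          = (\<sigma> 1) ^ 2 / 3 * kron i j"
    and cov_grad_grad: "\<And>y i j. (\<integral>\<omega>. field_grad \<delta> y \<omega> $ i * field_grad \<delta> y \<omega> $ j \<partial>M)
          = (\<sigma> 1) ^ 2 / 3 * kron i j"
    and cov_grad_hess: "\<And>y i j k. (\<integral>\<omega>. field_grad \<delta> y \<omega> $ i * field_neg_hess \<delta> y \<omega> $ j $ k \<partial>M) = 0"
    and cov_hess_hess: "\<And>y i j k l.
          (\<integral>\<omega>. field_neg_hess \<delta> y \<omega> $ i $ j * field_neg_hess \<delta> y \<omega> $ k $ l \<partial>M)
          = (\<sigma> 2) ^ 2 / 15 * (kron i j * kron k l + kron i k * kron j l + kron i l * kron j k)"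
    and gamma: "\<gamma> = (\<sigma> 1) ^ 2 / (\<sigma> 0 * \<sigma> 2)" "\<gamma> < 1"
    and q_nonneg: "\<And>p. 0 \<le> q p"
    and q_continuous: "continuous_on UNIV q"
    and q_density: "distributed M lborel
          (\<lambda>\<omega>. (\<delta> x \<omega> / \<sigma> 0, field_grad \<delta> x \<omega>, upper_entries (field_neg_hess \<delta> x \<omega>)))
          (\<lambda>p. ennreal (q p))"
    and R: "R = sqrt 3 * \<sigma> 1 / \<sigma> 2"
  shows "peak_density q \<nu> =
           1 / ((2 * pi) ^ 2 * R ^ 3) * exp (- (\<nu> ^ 2) / 2) * peak_G \<gamma> (\<gamma> * \<nu>)"
proof -
  have pos: "0 < \<sigma> 0" "0 < \<sigma> 1" "0 < \<sigma> 2" using moments_pos by auto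
  then have "0 < \<gamma>" unfolding gamma(1) by simp
  then have \<gamma>: "\<bar>\<gamma>\<bar> < 1" using gamma(2) by simp
  note fd = field_density_properties[OF pos(2,3) \<gamma>]
  define X where "X \<omega> = (\<delta> x \<omega> / \<sigma> 0, field_grad \<delta> x \<omega>, upper_entries (field_neg_hess \<delta> x \<omega>))" for \<omega>
  define Z where "Z \<omega> = (\<delta> x \<omega>, field_grad \<delta> x \<omega>, upper_entries (field_neg_hess \<delta> x \<omega>))" for \<omega>
  have X: "distributed M lborel X (\<lambda>p. ennreal (q p))"
    using q_density unfolding X_def .
  have Xm: "X \<in> M \<rightarrow>\<^sub>M borel"
    using distributed_measurable[OF X] by simp
  have qm [measurable]: "q \<in> borel_measurable borel"
    using q_continuous by (rule borel_measurable_continuous_onI)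
  have distr: "distr M lborel X = density lborel (\<lambda>p. ennreal (q p))"
    by (rule distributed_distr_eq_density[OF X])
  \<comment> \<open>A nonnegative density of a probability law has total mass 1; the uniqueness
    result needs integrability.\<close>
  have q_int: "integrable lborel q"
  proof -
    interpret D: prob_space "distr M lborel X"
      by (rule prob_space.prob_space_distr[OF prob distributed_measurable[OF X]])
    have "(\<integral>\<^sup>+p. ennreal (norm (q p)) \<partial>lborel) = emeasure (density lborel (\<lambda>p. ennreal (q p))) (space lborel)"
      using q_nonneg by (simp add: emeasure_density)
    also have "\<dots> = 1" using D.emeasure_space_1 unfolding distr by simp
    finally show ?thesis by (simp add: integrable_iff_bounded)
  qed
  have "char_density q U = char_density (field_density \<gamma> (\<sigma> 1) (\<sigma> 2)) U" for U
  proof -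
    obtain w v u1 u2 u3 u4 u5 u6 where U: "U = (w, v, u1, u2, u3, u4, u5, u6)"
      by (metis surj_pair)
    \<comment> \<open>Moving the normalisation of the height into the coefficient w expresses the
      pairing through the unnormalised vector \<open>Z\<close>, whose covariances are given.\<close>
    define Y where "Y \<omega> = (w / \<sigma> 0, v, u1, u2, u3, u4, u5, u6) \<bullet> Z \<omega>" for \<omega>
    have UX: "U \<bullet> X \<omega> = Y \<omega>" for \<omega>
      by (simp add: U X_def Y_def Z_def)
    have "(\<lambda>p. iexp (U \<bullet> p)) \<in> borel_measurable borel" by measurable
    then have cm [measurable]: "(\<lambda>p. cis (U \<bullet> p)) \<in> borel_measurable borel" by (simp add: cis_conv_exp)
    have "char_density q U = (\<integral>p. q p *\<^sub>R cis (U \<bullet> p) \<partial>lborel)"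
      unfolding char_density_def by (simp add: scaleR_conv_of_real mult.commute)
    also have "\<dots> = (\<integral>p. cis (U \<bullet> p) \<partial>distr M lborel X)"
      unfolding distr using q_nonneg by (subst integral_density) auto
    also have "\<dots> = (\<integral>\<omega>. cis (U \<bullet> X \<omega>) \<partial>M)"
      by (rule integral_distr) (use Xm in auto)
    also have "\<dots> = (\<integral>\<omega>. cis (Y \<omega>) \<partial>M)" by (simp only: UX)
    also have "\<dots> = complex_of_real (exp (- (\<integral>\<omega>. (Y \<omega>)\<^sup>2 \<partial>M) / 2))"
      using one_point_gaussian[of x] unfolding Y_def Z_def
      by (intro centered_gaussian_char(2)) (simp only: centered_gaussian_vector_def)
    also have "(\<integral>\<omega>. (Y \<omega>)\<^sup>2 \<partial>M) = (\<sigma> 0)\<^sup>2 * (w / \<sigma> 0)\<^sup>2 + 2 / 3 * (\<sigma> 1)\<^sup>2 * (w / \<sigma> 0) * (u1 + u4 + u6)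
      + (\<sigma> 1)\<^sup>2 / 3 * (v \<bullet> v) + (\<sigma> 2)\<^sup>2 / 15 *
      (3 * u1\<^sup>2 + 3 * u4\<^sup>2 + 3 * u6\<^sup>2 + 2 * u1 * u4 + 2 * u1 * u6 + 2 * u4 * u6 + u2\<^sup>2 + u3\<^sup>2 + u5\<^sup>2)"
      unfolding Y_def Z_def
      by (rule field_variance[OF one_point_gaussian cov_delta_delta cov_delta_grad cov_delta_hess cov_grad_grad
            cov_grad_hess cov_hess_hess])
    also have "(\<sigma> 0)\<^sup>2 * (w / \<sigma> 0)\<^sup>2 = w\<^sup>2"
      using pos by (simp add: power_divide)
    \<comment> \<open>By the definition of \<gamma>, \<sigma>_1^2 / \<sigma>_0 = \<gamma>
      \<sigma>_2; the correlation of height and trace enters the density only in this form.\<close>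
    also have "2 / 3 * (\<sigma> 1)\<^sup>2 * (w / \<sigma> 0) * (u1 + u4 + u6) = 2 / 3 * \<gamma> * \<sigma> 2 * w * (u1 + u4 + u6)"
      using pos by (simp add: gamma(1))
    finally show ?thesis unfolding U fd(3) .
  qed
  then have "q = field_density \<gamma> (\<sigma> 1) (\<sigma> 2)"
    by (rule continuous_density_eqI[OF q_int q_continuous fd(1,2)])
  then show ?thesis
    using peak_density_field_density[OF pos(2,3) \<gamma>] by (simp only: R)
qed

end
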